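(* Let $g\ge 5$ be an integer and let $G$ be a finite graph (multiple edges allowed, no loops) with girth $g(G)\ge g$ and $\mu(G)\ge \lfloor g/2\rfloor+1$. If $\chi'(G)=\Delta(G)+\lceil \mu(G)/\lfloor g/2\rfloor\rceil$, then $G$ contains (as a subgraph) a ring graph $R$ with $\chi'(R)=\chi'(G)$.
   Context: Graphs may have parallel edges but no loops. $\chi'(G)$ is the chromatic index (least $k$ such that the edges can be colored with $k$ colors so that edges sharing a vertex receive distinct colors), $\Delta(G)$ is the maximum degree, and $\mu(G)$ is the multiplicity, i.e. the maximum number of parallel edges joining two vertices. The girth $g(G)$ is the smallest integer $g\ge 3$ such that $G$ has a cycle of length $g$ (so parallel edges do not count as cycles), and $g(G)=\infty$ if no such cycle exists. A ring graph is a graph obtained from a cycle by duplicating some of its edges (i.e. replacing some edges by several parallel edges). *)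

theory Defs
  imports Complex_Main "HOL-Library.Extended_Nat"
begin

text \<open>Edges have their own identity, and \<open>ends\<close> maps an edge to its set of endvertices;
  distinct edges with the same endvertices are parallel.\<close>

record ('v, 'e) multigraph =
  verts :: "'v set"
  edges :: "'e set"
  ends :: "'e \<Rightarrow> 'v set"

definition finite_multigraph :: "('v, 'e) multigraph \<Rightarrow> bool" where
  "finite_multigraph G \<longleftrightarrow> finite (verts G) \<and> finite (edges G) \<and>
     (\<forall>e\<in>edges G. ends G e \<subseteq> verts G \<and> card (ends G e) = 2)"

definition subgraph :: "('v, 'e) multigraph \<Rightarrow> ('v, 'e) multigraph \<Rightarrow> bool" where
  "subgraph H G \<longleftrightarrow> finite_multigraph H \<and> finite_multigraph G \<and>
     verts H \<subseteq> verts G \<and> edges H \<subseteq> edges G \<and> (\<forall>e\<in>edges H. ends H e = ends G e)"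

definition proper_edge_coloring :: "('v, 'e) multigraph \<Rightarrow> nat \<Rightarrow> ('e \<Rightarrow> nat) \<Rightarrow> bool" where
  "proper_edge_coloring G k c \<longleftrightarrow> (\<forall>e\<in>edges G. c e < k) \<and>
     (\<forall>e\<in>edges G. \<forall>f\<in>edges G. e \<noteq> f \<and> ends G e \<inter> ends G f \<noteq> {} \<longrightarrow> c e \<noteq> c f)"

definition chromatic_index :: "('v, 'e) multigraph \<Rightarrow> nat" where
  "chromatic_index G = (LEAST k. \<exists>c. proper_edge_coloring G k c)"

definition vertex_degree :: "('v, 'e) multigraph \<Rightarrow> 'v \<Rightarrow> nat" where
  "vertex_degree G v = card {e \<in> edges G. v \<in> ends G e}"

text \<open>In the two maxima below, \<open>0\<close> is inserted only to cover graphs with fewer than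
  one, respectively two, vertices.\<close>

definition max_degree :: "('v, 'e) multigraph \<Rightarrow> nat" where
  "max_degree G = Max (insert 0 (vertex_degree G ` verts G))"

definition edge_multiplicity :: "('v, 'e) multigraph \<Rightarrow> nat" where
  "edge_multiplicity G = Max (insert 0
     {card {e \<in> edges G. ends G e = {u, v}} | u v. u \<in> verts G \<and> v \<in> verts G \<and> u \<noteq> v})"

definition cycle_graph :: "nat \<Rightarrow> ('v, 'e) multigraph \<Rightarrow> bool" where
  "cycle_graph n C \<longleftrightarrow> n \<ge> 3 \<and> (\<exists>vs es.
     length vs = n \<and> distinct vs \<and> verts C = set vs \<and>
     length es = n \<and> distinct es \<and> edges C = set es \<and>
     (\<forall>i<n. ends C (es ! i) = {vs ! i, vs ! (Suc i mod n)}))"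

text \<open>The infimum of the empty set in \<^typ>\<open>enat\<close> is \<open>\<infinity>\<close>.\<close>

definition girth :: "('v, 'e) multigraph \<Rightarrow> enat" where
  "girth G = Inf {enat n | n. \<exists>C. subgraph C G \<and> cycle_graph n C}"

text \<open>A cycle \<open>C\<close>, each of whose edges may be accompanied in \<open>R\<close> by further edges
  parallel to it.\<close>

definition ring_graph :: "('v, 'e) multigraph \<Rightarrow> bool" where
  "ring_graph R \<longleftrightarrow> (\<exists>C n. cycle_graph n C \<and> subgraph C R \<and> verts C = verts R \<and>
     (\<forall>e\<in>edges R. \<exists>f\<in>edges C. ends R e = ends R f))"

end

theory Submission imports Defs "HOL-Combinatorics.Transposition" begin

text \<open>
  Write \<open>h = g div 2\<close> and \<open>\<chi>'(G) = k + 1\<close>, so \<open>k = \<Delta> + s\<close> with \<open>s \<ge> 1\<close> and \<open>\<mu> \<le> h (s + 1)\<close>.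
  Take a minimal set of edges that is not \<open>k\<close>-colourable and colour all of it but one edge \<open>e0\<close>.
  By Tashkinov's theorem, on the vertex set \<open>S\<close> of a maximal Tashkinov tree no colour is missing
  twice, and by maximality no colour missing on \<open>S\<close> leaves \<open>S\<close>. Let \<open>M\<close> be the number of colours
  missing on \<open>S\<close>. Counting the edges in these colours inside \<open>S\<close> gives weights of at most \<open>\<mu>\<close>
  whose sum at a vertex is \<open>M - m v\<close>, where \<open>m v \<ge> s\<close> and the \<open>m v\<close> add up to \<open>M - 2\<close>. This forces
  strong expansion of the underlying simple graph on \<open>S\<close>, which for girth at least \<open>2 h\<close> leaves only
  odd cycles. Since a cycle can be spanned by a Tashkinov tree avoiding any prescribed colour, every
  other colour crosses the boundary of \<open>S\<close> just once. So \<open>S\<close> spans \<open>k (|S| - 1) / 2 + 1\<close>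
  edges, too many for \<open>k\<close> colours, and a second application of the expansion argument, now to all
  edges inside \<open>S\<close>, shows that they form a ring graph.
\<close>

section \<open>Tashkinov trees\<close>

text \<open>The expansion comes from a cancellation of \<open>s + 1\<close>. Let \<open>p\<close> be
  the size of \<open>S\<close>. The vertices other than \<open>v\<close> contribute at least
  \<open>(p - 1) * s\<close> to the sum \<open>M - 2\<close>, so \<open>v\<close> carries weight at
  least \<open>(p - 1) * s + 2\<close>, which is at least half of \<open>(p + 1) * (s + 1)\<close>.
  A parallel class weighs at most \<open>h * (s + 1)\<close>. Hence every vertex has at least
  \<open>(p + 1) / (2 * h)\<close> neighbours, and a similar count holds for sets of vertices.
  Degrees that grow linearly with \<open>p\<close> clash with large girth, because neighbourhoods
  that overlap little need too many vertices; a cycle with fewer than \<open>4 * h\<close> vertices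
  escapes. The obstacle is that Tashkinov's theorem speaks only of colours missing on
  \<open>S\<close>. Any other colour might leave \<open>S\<close> several times, and then
  \<open>S\<close> would span too few edges for the final count. The cycle structure is what
  excludes this, so it has to be found first from the missing colours alone; only afterwards are all
  edges inside \<open>S\<close> under control.\<close>

lemma rtranclp_distinct_path:
  assumes "R\<^sup>*\<^sup>* x y"
  shows "\<exists>xs. xs \<noteq> [] \<and> hd xs = x \<and> last xs = y \<and> distinct xs \<and> successively R xs"
  using assms
proof (induction rule: rtranclp_induct)
  case base
  show ?case by (rule exI[of _ "[x]"]) simp
next
  case (step y z)
  then obtain xs where xs: "xs \<noteq> []" "hd xs = x" "last xs = y" "distinct xs" "successively R xs"
    by blast
  show ?case
  proof (cases "z \<in> set xs")
    case True
    then obtain as bs where "xs = as @ z # bs" by (meson split_list)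
    with xs show ?thesis
      by (intro exI[of _ "as @ [z]"]) (auto simp: successively_append_iff hd_append split: if_splits)
  next
    case False
    with xs step.hyps show ?thesis
      by (intro exI[of _ "xs @ [z]"]) (auto simp: successively_append_iff)
  qed
qed

lemma rtranclp_symmetric:
  assumes "\<And>u v. R u v \<Longrightarrow> R v u" and "R\<^sup>*\<^sup>* x y"
  shows "R\<^sup>*\<^sup>* y x"
  using assms(2)
  by (induction rule: rtranclp_induct) (auto intro: converse_rtranclp_into_rtranclp assms(1))

text \<open>A path from \<open>x\<close> to \<open>y\<close> is already closed under
  \<open>R\<close>, since its interior vertices have used up both neighbours and its ends their only
  one. So \<open>z\<close> would be an interior vertex with two neighbours. Applied to Kempe chains,
  this says that a chain has at most two ends.\<close>

lemma component_at_most_two_ends: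
  assumes sym: "\<And>u v. R u v \<Longrightarrow> R v u"
    and deg2: "\<And>v a b c. R v a \<Longrightarrow> R v b \<Longrightarrow> R v c \<Longrightarrow> a = b \<or> a = c \<or> b = c"
    and deg1: "\<And>v a b. v \<in> {x, y, z} \<Longrightarrow> R v a \<Longrightarrow> R v b \<Longrightarrow> a = b"
    and ne: "x \<noteq> y" "x \<noteq> z" "y \<noteq> z"
    and xy: "R\<^sup>*\<^sup>* x y" and xz: "R\<^sup>*\<^sup>* x z"
  shows False
proof -
  obtain xs where xs: "xs \<noteq> []" "hd xs = x" "last xs = y" "distinct xs" "successively R xs"
    using rtranclp_distinct_path[OF xy] by blast
  define m where "m = length xs - 1"
  have len: "length xs = Suc m" using xs(1) m_def by simp
  have x0: "xs ! 0 = x" using xs by (simp add: hd_conv_nth)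
  have ym: "xs ! m = y" using xs by (simp add: last_conv_nth m_def)
  have m0: "0 < m" using x0 ym ne(1) by (cases m) auto
  have step: "R (xs ! i) (xs ! Suc i)" if "i < m" for i
    using xs(5) that len by (auto simp: successively_conv_nth)
  have closed: "w \<in> set xs" if v: "v \<in> set xs" and "R v w" for v w
  proof -
    obtain i where i: "i \<le> m" "v = xs ! i" using v len by (auto simp: in_set_conv_nth less_Suc_eq_le)
    consider "i = 0" | "i = m" | "0 < i" "i < m" using i by linarith
    then show ?thesis
    proof cases
      case 1
      then have "w = xs ! 1" using deg1[of x w "xs ! 1"] step[of 0] that(2) i x0 m0 by auto
      then show ?thesis using len m0 by simp
    next
      case 2
      then have "R y (xs ! (m - 1))" using step[of "m - 1"] m0 ym sym by auto
      then have "w = xs ! (m - 1)" using deg1[of y w] that(2) i 2 ym by auto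
      then show ?thesis using len m0 by simp
    next
      case 3
      have "R v (xs ! (i - 1))" using step[of "i - 1"] 3 i sym by auto
      moreover have "R v (xs ! Suc i)" using step[of i] 3 i by auto
      moreover have "xs ! (i - 1) \<noteq> xs ! Suc i"
        using xs(4) 3 len by (simp add: nth_eq_iff_index_eq)
      ultimately have "w = xs ! (i - 1) \<or> w = xs ! Suc i" using deg2 that(2) by metis
      then show ?thesis using len 3 by auto
    qed
  qed
  have "z \<in> set xs" using xz
    by (induction rule: rtranclp_induct) (use closed xs in \<open>auto intro: hd_in_set\<close>)
  then obtain i where i: "i \<le> m" "z = xs ! i" using len by (auto simp: in_set_conv_nth less_Suc_eq_le)
  then have i': "0 < i" "i < m" using x0 ym ne by (auto simp: le_less intro: ccontr)
  have "R z (xs ! (i - 1))" using step[of "i - 1"] i i' sym by auto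
  moreover have "R z (xs ! Suc i)" using step[of i] i' i by auto
  moreover have "xs ! (i - 1) \<noteq> xs ! Suc i"
    using xs(4) i' len by (simp add: nth_eq_iff_index_eq)
  ultimately show False using deg1[of z] by blast
qed

section \<open>Colourings with one uncoloured edge, and Kempe changes\<close>

definition proper_on :: "'e set \<Rightarrow> ('e \<Rightarrow> 'v set) \<Rightarrow> nat \<Rightarrow> ('e \<Rightarrow> nat) \<Rightarrow> bool" where
  "proper_on E en k c \<longleftrightarrow> (\<forall>e\<in>E. c e < k) \<and>
     (\<forall>e\<in>E. \<forall>f\<in>E. e \<noteq> f \<and> en e \<inter> en f \<noteq> {} \<longrightarrow> c e \<noteq> c f)"

locale near_coloring =
  fixes E :: "'e set" and en :: "'e \<Rightarrow> 'v set" and k s :: nat and e0 :: 'e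
  assumes finite_E: "finite E"
    and card_en: "f \<in> E \<Longrightarrow> card (en f) = 2"
    and e0: "e0 \<in> E"
    and degree: "card {f \<in> E. v \<in> en f} + s \<le> k"
    and s: "1 \<le> s"
    and not_colorable: "\<not> proper_on E en k c"
begin

abbreviation col :: "('e \<Rightarrow> nat) \<Rightarrow> bool" where
  "col \<phi> \<equiv> proper_on (E - {e0}) en k \<phi>"

definition miss :: "('e \<Rightarrow> nat) \<Rightarrow> 'v \<Rightarrow> nat set" where
  "miss \<phi> v = {c. c < k \<and> (\<forall>f\<in>E - {e0}. v \<in> en f \<longrightarrow> \<phi> f \<noteq> c)}"

lemma finite_miss [simp]: "finite (miss \<phi> v)"
  by (rule finite_subset[of _ "{..<k}"]) (auto simp: miss_def)

lemma card_miss: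
  assumes "col \<phi>"
  shows "card (miss \<phi> v) + card {f \<in> E. v \<in> en f} = k + (if v \<in> en e0 then 1 else 0)"
proof -
  let ?A = "{f \<in> E - {e0}. v \<in> en f}"
  have fin: "finite ?A" using finite_E by simp
  have inj: "inj_on \<phi> ?A" using assms by (auto simp: inj_on_def proper_on_def)
  have sub: "\<phi> ` ?A \<subseteq> {..<k}" using assms by (auto simp: proper_on_def)
  have "miss \<phi> v = {..<k} - \<phi> ` ?A" by (auto simp: miss_def)
  then have "card (miss \<phi> v) = k - card ?A"
    using card_Diff_subset[OF _ sub] fin card_image[OF inj] by simp
  moreover have "card ?A \<le> k" using card_mono[OF _ sub] card_image[OF inj] by simp
  moreover have "card {f \<in> E. v \<in> en f} = card ?A + (if v \<in> en e0 then 1 else 0)"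
  proof (cases "v \<in> en e0")
    case True
    then have "{f \<in> E. v \<in> en f} = insert e0 ?A" using e0 by auto
    then show ?thesis using True fin by simp
  next
    case False
    then have "{f \<in> E. v \<in> en f} = ?A" by auto
    then show ?thesis using False by simp
  qed
  ultimately show ?thesis by simp
qed

lemma card_miss_ge:
  assumes "col \<phi>"
  shows "s + (if v \<in> en e0 then 1 else 0) \<le> card (miss \<phi> v)"
  using card_miss[OF assms, of v] degree[of v] by (simp split: if_splits)

lemma miss_nonempty: "col \<phi> \<Longrightarrow> \<exists>c. c \<in> miss \<phi> v"
  using card_miss_ge[of \<phi> v] s by (auto simp: ex_in_conv split: if_splits)

lemma en_pairE:
  assumes "f \<in> E" "v \<in> en f"
  obtains u where "en f = {v, u}" "u \<noteq> v"
  using card_en[OF assms(1)] assms(2) by (auto simp: card_2_iff doubleton_eq_iff)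

definition kadj :: "('e \<Rightarrow> nat) \<Rightarrow> nat \<Rightarrow> nat \<Rightarrow> 'v \<Rightarrow> 'v \<Rightarrow> bool" where
  "kadj \<phi> a b u v \<longleftrightarrow> (\<exists>f\<in>E - {e0}. en f = {u, v} \<and> \<phi> f \<in> {a, b})"

abbreviation comp :: "('e \<Rightarrow> nat) \<Rightarrow> nat \<Rightarrow> nat \<Rightarrow> 'v \<Rightarrow> 'v set" where
  "comp \<phi> a b v \<equiv> {w. (kadj \<phi> a b)\<^sup>*\<^sup>* v w}"

text \<open>Exchanging two colours is legitimate on any union of chains, not only on a single
  \<open>comp\<close>. The boundary argument uses this for the complement of a vertex set and for a
  set made of one vertex inside and a component outside.\<close>

definition kclosed :: "('e \<Rightarrow> nat) \<Rightarrow> nat \<Rightarrow> nat \<Rightarrow> 'v set \<Rightarrow> bool" where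
  "kclosed \<phi> a b K \<longleftrightarrow>
     (\<forall>f\<in>E - {e0}. \<phi> f \<in> {a, b} \<longrightarrow> en f \<inter> K \<noteq> {} \<longrightarrow> en f \<subseteq> K)"

definition kswap :: "('e \<Rightarrow> nat) \<Rightarrow> nat \<Rightarrow> nat \<Rightarrow> 'v set \<Rightarrow> 'e \<Rightarrow> nat" where
  "kswap \<phi> a b K f = (if en f \<inter> K = {} then \<phi> f else transpose a b (\<phi> f))"

lemma kadj_sym: "kadj \<phi> a b u v \<Longrightarrow> kadj \<phi> a b v u"
  by (auto simp: kadj_def insert_commute)

lemma kclosed_comp: "kclosed \<phi> a b (comp \<phi> a b v)"
  unfolding kclosed_def
proof (intro ballI impI subsetI)
  fix f x assume f: "f \<in> E - {e0}" "\<phi> f \<in> {a, b}" "en f \<inter> comp \<phi> a b v \<noteq> {}" "x \<in> en f"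
  then obtain w where w: "w \<in> en f" "(kadj \<phi> a b)\<^sup>*\<^sup>* v w" by auto
  obtain u where u: "en f = {w, u}" using en_pairE[of f w] f w by auto
  then have "kadj \<phi> a b w u" using f by (auto simp: kadj_def)
  then show "x \<in> comp \<phi> a b v" using w u f(4) by auto
qed

lemma kswap_other: "\<phi> f \<notin> {a, b} \<Longrightarrow> kswap \<phi> a b K f = \<phi> f"
  by (simp add: kswap_def transpose_def)

lemma transpose_less: "a < k \<Longrightarrow> b < k \<Longrightarrow> c < k \<Longrightarrow> transpose a b c < k"
  by (simp add: transpose_def)

lemma col_kswap:
  assumes "col \<phi>" "a < k" "b < k" "kclosed \<phi> a b K"
  shows "col (kswap \<phi> a b K)"
  unfolding proper_on_def
proof (intro conjI ballI impI)
  fix e assume "e \<in> E - {e0}"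
  then show "kswap \<phi> a b K e < k"
    using assms transpose_less[of a b "\<phi> e"] by (auto simp: kswap_def proper_on_def)
next
  fix e f assume e: "e \<in> E - {e0}" and f: "f \<in> E - {e0}" and ef: "e \<noteq> f \<and> en e \<inter> en f \<noteq> {}"
  have ne: "\<phi> e \<noteq> \<phi> f" using assms(1) e f ef by (auto simp: proper_on_def)
  have mixed: "\<phi> g \<notin> {a, b}"
    if "g \<in> E - {e0}" "en g \<inter> K \<noteq> {}" "en g \<inter> en g' \<noteq> {}" "en g' \<inter> K = {}" for g g'
    using assms(4) that unfolding kclosed_def by blast
  show "kswap \<phi> a b K e \<noteq> kswap \<phi> a b K f"
  proof (cases "(en e \<inter> K = {}) = (en f \<inter> K = {})")
    case True
    then show ?thesis using ne by (auto simp: kswap_def dest: injD[OF inj_transpose])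
  next
    case False
    then have "kswap \<phi> a b K e = \<phi> e" "kswap \<phi> a b K f = \<phi> f"
      using mixed[OF e _ _, of f] mixed[OF f _ _, of e] ef
      by (auto simp: kswap_def transpose_def Int_commute)
    then show ?thesis using ne by simp
  qed
qed

lemma miss_kswap:
  assumes "a < k" "b < k" "kclosed \<phi> a b K"
  shows "c \<in> miss (kswap \<phi> a b K) v \<longleftrightarrow> (if v \<in> K then transpose a b c else c) \<in> miss \<phi> v"
proof (cases "v \<in> K")
  case True
  have "kswap \<phi> a b K f = transpose a b (\<phi> f)" if "v \<in> en f" for f
    using True that by (auto simp: kswap_def)
  moreover have "transpose a b x = c \<longleftrightarrow> x = transpose a b c" for x
    by (metis transpose_involutory)
  moreover have "c < k \<longleftrightarrow> transpose a b c < k"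
    using assms transpose_less by (metis transpose_involutory)
  ultimately show ?thesis using True by (auto simp: miss_def)
next
  case False
  have "kswap \<phi> a b K f = \<phi> f" if "v \<in> en f" "f \<in> E - {e0}" for f
    using False that assms(3) by (auto simp: kswap_def kclosed_def transpose_def)
  then show ?thesis using False by (auto simp: miss_def)
qed

lemma kadj_colour_unique:
  assumes "col \<phi>" "f \<in> E - {e0}" "g \<in> E - {e0}" "v \<in> en f" "v \<in> en g" "\<phi> f = \<phi> g"
  shows "f = g"
  using assms unfolding proper_on_def by blast

lemma kadj_deg2:
  assumes "col \<phi>" "kadj \<phi> a b v p" "kadj \<phi> a b v q" "kadj \<phi> a b v r"
  shows "p = q \<or> p = r \<or> q = r"
proof -
  obtain f g h where *: "f \<in> E - {e0}" "en f = {v, p}" "\<phi> f \<in> {a, b}"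
      "g \<in> E - {e0}" "en g = {v, q}" "\<phi> g \<in> {a, b}" "h \<in> E - {e0}" "en h = {v, r}" "\<phi> h \<in> {a, b}"
    using assms(2-4) unfolding kadj_def by blast
  then have "f = g \<or> f = h \<or> g = h"
    using kadj_colour_unique[OF assms(1)] by (metis insertCI insertE singletonD)
  then show ?thesis using * by (metis doubleton_eq_iff)
qed

lemma comp_three_ends:
  assumes "col \<phi>" and "x \<noteq> y" "x \<noteq> z" "y \<noteq> z"
    and en: "\<And>v. v \<in> {x, y, z} \<Longrightarrow> a \<in> miss \<phi> v \<or> b \<in> miss \<phi> v"
    and "y \<in> comp \<phi> a b x" "z \<in> comp \<phi> a b x"
  shows False
proof (rule component_at_most_two_ends[of "kadj \<phi> a b" x y z])
  show "kadj \<phi> a b u v \<Longrightarrow> kadj \<phi> a b v u" for u v by (rule kadj_sym)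
next
  show "kadj \<phi> a b v p \<Longrightarrow> kadj \<phi> a b v q \<Longrightarrow> kadj \<phi> a b v r \<Longrightarrow> p = q \<or> p = r \<or> q = r" for v p q r
    by (rule kadj_deg2[OF assms(1)])
next
  fix v p q assume v: "v \<in> {x, y, z}" and "kadj \<phi> a b v p" "kadj \<phi> a b v q"
  then obtain f g where *: "f \<in> E - {e0}" "en f = {v, p}" "\<phi> f \<in> {a, b}"
      "g \<in> E - {e0}" "en g = {v, q}" "\<phi> g \<in> {a, b}"
    unfolding kadj_def by blast
  then have "\<phi> f = \<phi> g" using en[OF v] unfolding miss_def by fastforce
  then have "f = g" using kadj_colour_unique[OF assms(1), of f g v] * by simp
  then show "p = q" using * by (metis doubleton_eq_iff)
qed (use assms in auto)

lemma comp_sym: "w \<in> comp \<phi> a b v \<Longrightarrow> v \<in> comp \<phi> a b w"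
  unfolding mem_Collect_eq by (rule rtranclp_symmetric[rotated]) (auto intro: kadj_sym)

lemma comp_trans: "w \<in> comp \<phi> a b v \<Longrightarrow> x \<in> comp \<phi> a b w \<Longrightarrow> x \<in> comp \<phi> a b v"
  by (auto intro: rtranclp_trans)

text \<open>In a Tashkinov tree \<open>f i\<close> is the edge attaching \<open>y i\<close> to an earlier vertex, so \<open>f 1 = e0\<close>,
  and \<open>f 0\<close> is irrelevant. The predicate \<open>tail p\<close> says that the vertices from \<open>y p\<close> on form a path.\<close>

definition tash :: "('e \<Rightarrow> nat) \<Rightarrow> nat \<Rightarrow> (nat \<Rightarrow> 'v) \<Rightarrow> (nat \<Rightarrow> 'e) \<Rightarrow> bool" where
  "tash \<phi> n y f \<longleftrightarrow> 1 \<le> n \<and> inj_on y {..n} \<and> f 1 = e0 \<and> en e0 = {y 0, y 1} \<and>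
     (\<forall>i. 2 \<le> i \<and> i \<le> n \<longrightarrow> f i \<in> E - {e0} \<and> (\<exists>j<i. en (f i) = {y j, y i}) \<and>
        (\<exists>j<i. \<phi> (f i) \<in> miss \<phi> (y j)))"

definition tail :: "nat \<Rightarrow> nat \<Rightarrow> (nat \<Rightarrow> 'v) \<Rightarrow> (nat \<Rightarrow> 'e) \<Rightarrow> bool" where
  "tail p n y f \<longleftrightarrow> (\<forall>i. p < i \<and> i \<le> n \<longrightarrow> en (f i) = {y (i - 1), y i})"

definition elem :: "('e \<Rightarrow> nat) \<Rightarrow> nat \<Rightarrow> (nat \<Rightarrow> 'v) \<Rightarrow> bool" where
  "elem \<phi> n y \<longleftrightarrow> (\<forall>i j. i < j \<and> j \<le> n \<longrightarrow> miss \<phi> (y i) \<inter> miss \<phi> (y j) = {})"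

lemma tash_prefix: "tash \<phi> n y f \<Longrightarrow> 1 \<le> m \<Longrightarrow> m \<le> n \<Longrightarrow> tash \<phi> m y f"
  by (auto simp: tash_def intro: inj_on_subset)

lemma tail_prefix: "tail p n y f \<Longrightarrow> m \<le> n \<Longrightarrow> tail p m y f"
  by (auto simp: tail_def)

lemma elem_eq:
  "elem \<phi> n y \<Longrightarrow> i \<le> n \<Longrightarrow> j \<le> n \<Longrightarrow> c \<in> miss \<phi> (y i) \<Longrightarrow> c \<in> miss \<phi> (y j) \<Longrightarrow> i = j"
  unfolding elem_def by (metis disjoint_iff nat_neq_iff)

text \<open>Each of the \<open>m + 1\<close> vertices misses a colour because
  \<open>1 \<le> s\<close>, and the two ends of the uncoloured edge miss one more each.\<close>

lemma card_Union_miss: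
  assumes "col \<phi>" "tash \<phi> n y f" "elem \<phi> m y" "1 \<le> m" "m \<le> n"
  shows "m + 3 \<le> card (\<Union>j\<le>m. miss \<phi> (y j))"
proof -
  have "card (\<Union>j\<le>m. miss \<phi> (y j)) = (\<Sum>j\<le>m. card (miss \<phi> (y j)))"
    using assms(3) by (intro card_UN_disjoint) (auto dest: elem_eq)
  also have "\<dots> \<ge> (\<Sum>j\<le>m. if j \<le> 1 then 2 else 1)"
  proof (rule sum_mono)
    fix j assume "j \<in> {..m}"
    have "j \<le> 1 \<Longrightarrow> y j \<in> en e0" using assms(2) by (auto simp: tash_def le_Suc_eq)
    then show "(if j \<le> 1 then 2 else 1) \<le> card (miss \<phi> (y j))"
      using card_miss_ge[OF assms(1), of "y j"] s by auto
  qed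
  moreover have "(\<Sum>j\<le>m. if j \<le> 1 then 2 else 1 :: nat) = m + 3" using assms(4)
  proof (induction m rule: dec_induct)
    case base
    show ?case by (simp add: numeral_eq_Suc)
  qed auto
  ultimately show ?thesis by simp
qed

end

section \<open>Recolouring a minimal tree with a repeated missing colour\<close>

text \<open>Tashkinov's theorem is proved by induction on the path number \<open>p\<close> first and on the size \<open>n\<close>
  second. A colour missing both at \<open>y n\<close> and earlier is replaced, by Kempe changes at \<open>y n\<close>, by
  one that is missing at later and later vertices. Once it is missing at \<open>y (n - 1)\<close>, recolouring
  the last edge gives a smaller tree with a repeated colour.\<close>

locale minimal_tree = near_coloring E en k s e0
  for E :: "'e set" and en :: "'e \<Rightarrow> 'v set" and k s :: nat and e0 :: 'e +
  fixes p n :: nat and y :: "nat \<Rightarrow> 'v" and f :: "nat \<Rightarrow> 'e"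
  assumes IH_path: "\<lbrakk>p' < p; col \<phi>; tash \<phi> n' y' f'; tail p' n' y' f'\<rbrakk> \<Longrightarrow> elem \<phi> n' y'"
    and IH_size: "\<lbrakk>n' < n; col \<phi>; tash \<phi> n' y' f'; tail p n' y' f'\<rbrakk> \<Longrightarrow> elem \<phi> n' y'"
    and tail: "tail p n y f"
    and n: "2 \<le> n"
begin

abbreviation "T \<phi> \<equiv> col \<phi> \<and> tash \<phi> n y f"

lemma T_elem: "T \<phi> \<Longrightarrow> m < n \<Longrightarrow> 1 \<le> m \<Longrightarrow> elem \<phi> m y"
  using IH_size[of m \<phi> y f] tash_prefix[of \<phi> n y f m] tail_prefix[OF tail, of m] by simp

lemma T_eq: "T \<phi> \<Longrightarrow> i < n \<Longrightarrow> j < n \<Longrightarrow> c \<in> miss \<phi> (y i) \<Longrightarrow> c \<in> miss \<phi> (y j) \<Longrightarrow> i = j"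
  using elem_eq[OF T_elem[of \<phi> "n - 1"], of i j] n by auto

lemma T_inj: "T \<phi> \<Longrightarrow> i \<le> n \<Longrightarrow> j \<le> n \<Longrightarrow> y i = y j \<longleftrightarrow> i = j"
  by (auto simp: tash_def inj_on_def)

lemma T_edge:
  assumes "T \<phi>" "2 \<le> r" "r \<le> n"
  obtains i j where "f r \<in> E" "f r \<noteq> e0" "i < r" "en (f r) = {y i, y r}" "j < r" "\<phi> (f r) \<in> miss \<phi> (y j)"
  using assms by (auto simp: tash_def)

lemma T_colour_late:
  assumes "T \<phi>" "i < n" "2 \<le> r" "r \<le> n" "\<phi> (f r) \<in> miss \<phi> (y i)"
  shows "i < r"
  using T_edge[OF assms(1,3,4)] T_eq[OF assms(1) assms(2) _ assms(5)] assms(4)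
  by (metis less_le_trans)

lemma free_colour:
  assumes "T \<phi>" "1 \<le> l" "l < n" "finite U" "card U \<le> l + 2"
  shows "\<exists>j d. j \<le> l \<and> d \<in> miss \<phi> (y j) \<and> d \<notin> U"
proof -
  have "card U < card (\<Union>j\<le>l. miss \<phi> (y j))"
    using card_Union_miss[of \<phi> n y f l] T_elem[OF assms(1)] assms by simp
  then have "\<not> (\<Union>j\<le>l. miss \<phi> (y j)) \<subseteq> U" using card_mono[OF assms(4)] by (meson leD)
  then show ?thesis by blast
qed

lemma T_linked:
  assumes "T \<phi>" "i < j" "j < n" "a \<in> miss \<phi> (y i)" "b \<in> miss \<phi> (y j)"
    and unused: "\<forall>r. 2 \<le> r \<and> r \<le> j \<longrightarrow> \<phi> (f r) \<noteq> a"
  shows "y i \<in> comp \<phi> a b (y j)"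
proof (rule ccontr)
  let ?K = "comp \<phi> a b (y j)"
  let ?\<psi> = "kswap \<phi> a b ?K"
  assume ni: "y i \<notin> ?K"
  have ab: "a < k" "b < k" using assms(4,5) by (auto simp: miss_def)
  have col: "col ?\<psi>" using col_kswap[OF _ ab kclosed_comp] assms(1) by blast
  have keep: "c \<in> miss ?\<psi> v \<longleftrightarrow> c \<in> miss \<phi> v" if "c \<notin> {a, b}" for c v
    using miss_kswap[OF ab kclosed_comp] that by (auto simp: transpose_def)
  have "tash ?\<psi> j y f"
    unfolding tash_def
  proof (intro conjI allI impI)
    fix r assume r: "2 \<le> r \<and> r \<le> j"
    then obtain i' j' where e: "f r \<in> E" "f r \<noteq> e0" "i' < r" "en (f r) = {y i', y r}" "j' < r"
        "\<phi> (f r) \<in> miss \<phi> (y j')"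
      using T_edge[OF assms(1), of r] assms(3) by (metis le_trans less_imp_le)
    show "f r \<in> E - {e0}" using e by simp
    show "\<exists>j<r. en (f r) = {y j, y r}" using e by blast
    have nb: "\<phi> (f r) \<noteq> b" using T_colour_late[OF assms(1,3), of r] assms(3,5) r by auto
    have na: "\<phi> (f r) \<noteq> a" using unused r by simp
    have "?\<psi> (f r) = \<phi> (f r)" using na nb by (simp add: kswap_other)
    then show "\<exists>j<r. ?\<psi> (f r) \<in> miss ?\<psi> (y j)" using keep na nb e by auto
  qed (use tash_prefix[of \<phi> n y f j] assms in \<open>auto simp: tash_def\<close>)
  then have "elem ?\<psi> j y" using IH_size[OF assms(3) col] tail_prefix[OF tail] assms(3) by simp
  moreover have "a \<in> miss ?\<psi> (y i)" using miss_kswap[OF ab kclosed_comp] ni assms(4) by simp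
  moreover have "a \<in> miss ?\<psi> (y j)" using miss_kswap[OF ab kclosed_comp] assms(5) by simp
  ultimately show False using assms(2) elem_eq[of ?\<psi> j y i j a] by simp
qed

text \<open>Among the vertices before \<open>y n\<close> only \<open>y i\<close> can miss
  \<open>a\<close> and only \<open>y j\<close> can miss \<open>b\<close>; both lie outside
  \<open>K\<close>, so the change affects missing colours at \<open>y n\<close> alone. By
  \<open>late\<close>, a recoloured tree edge comes after both \<open>y i\<close> and
  \<open>y j\<close>, so either of the two colours is legal on it.\<close>

lemma T_swap:
  fixes a b \<phi>
  defines "K \<equiv> comp \<phi> a b (y n)"
  defines "\<psi> \<equiv> kswap \<phi> a b K"
  assumes T: "T \<phi>" and ij: "i < n" "j < n" and a: "a \<in> miss \<phi> (y i)" and b: "b \<in> miss \<phi> (y j)"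
    and out: "y i \<notin> K" "y j \<notin> K"
    and late: "\<forall>r. 2 \<le> r \<and> r \<le> n \<and> \<phi> (f r) \<in> {a, b} \<and> en (f r) \<inter> K \<noteq> {} \<longrightarrow> i < r \<and> j < r"
  shows "T \<psi>" and "\<And>t. t < n \<Longrightarrow> miss \<psi> (y t) = miss \<phi> (y t)"
    and "a \<in> miss \<phi> (y n) \<Longrightarrow> b \<in> miss \<psi> (y n)"
    and "b \<in> miss \<phi> (y n) \<Longrightarrow> a \<in> miss \<psi> (y n)"
proof -
  have ab: "a < k" "b < k" using a b by (auto simp: miss_def)
  have cl: "kclosed \<phi> a b K" unfolding K_def by (rule kclosed_comp)
  have mk: "c \<in> miss \<psi> v \<longleftrightarrow> (if v \<in> K then transpose a b c else c) \<in> miss \<phi> v" for c v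
    unfolding \<psi>_def by (rule miss_kswap[OF ab cl])
  have yn: "y n \<in> K" by (simp add: K_def)
  show "a \<in> miss \<phi> (y n) \<Longrightarrow> b \<in> miss \<psi> (y n)" "b \<in> miss \<phi> (y n) \<Longrightarrow> a \<in> miss \<psi> (y n)"
    using mk yn by auto
  show same: "miss \<psi> (y t) = miss \<phi> (y t)" if t: "t < n" for t
  proof (cases "y t \<in> K")
    case True
    then have "a \<notin> miss \<phi> (y t)" "b \<notin> miss \<phi> (y t)"
      using T_eq[OF T t] ij a b out by blast+
    then show ?thesis using mk True by (auto simp: transpose_def split: if_splits)
  next
    case False
    then show ?thesis using mk by auto
  qed
  have "tash \<psi> n y f"
    unfolding tash_def
  proof (intro conjI allI impI)
    fix r assume r: "2 \<le> r \<and> r \<le> n"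
    then obtain i' j' where e: "f r \<in> E" "f r \<noteq> e0" "i' < r" "en (f r) = {y i', y r}" "j' < r"
        "\<phi> (f r) \<in> miss \<phi> (y j')"
      using T_edge[OF T, of r] by metis
    show "f r \<in> E - {e0}" using e by simp
    show "\<exists>j<r. en (f r) = {y j, y r}" using e by blast
    show "\<exists>j<r. \<psi> (f r) \<in> miss \<psi> (y j)"
    proof (cases "\<phi> (f r) \<in> {a, b} \<and> en (f r) \<inter> K \<noteq> {}")
      case True
      then have "i < r" "j < r" using late r by auto
      moreover have "\<psi> (f r) \<in> {a, b}" using True by (auto simp: \<psi>_def kswap_def)
      ultimately show ?thesis using a b same ij by blast
    next
      case False
      then have "\<psi> (f r) = \<phi> (f r)" by (auto simp: \<psi>_def kswap_def transpose_def)
      then show ?thesis using e same r by (metis less_le_trans)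
    qed
  qed (use T in \<open>auto simp: tash_def\<close>)
  then show "T \<psi>" using col_kswap[OF _ ab cl] T \<psi>_def by blast
qed

text \<open>By \<open>T_linked\<close> the vertices \<open>y i\<close> and \<open>y j\<close> are
  the two ends of one chain, so \<open>y n\<close>, where one of the colours is missing, is on
  another chain. Changing that chain trades a repetition of \<open>a\<close> for one of
  \<open>b\<close>, or conversely.\<close>

lemma T_transfer:
  fixes a b \<phi>
  defines "\<psi> \<equiv> kswap \<phi> a b (comp \<phi> a b (y n))"
  assumes T: "T \<phi>" and ij: "i < j" "j < n" and a: "a \<in> miss \<phi> (y i)" and b: "b \<in> miss \<phi> (y j)"
    and unused: "\<forall>r. 2 \<le> r \<and> r \<le> j \<longrightarrow> \<phi> (f r) \<noteq> a"
    and yn: "a \<in> miss \<phi> (y n) \<or> b \<in> miss \<phi> (y n)"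
  shows "T \<psi>" and "\<And>t. t < n \<Longrightarrow> miss \<psi> (y t) = miss \<phi> (y t)"
    and "a \<in> miss \<phi> (y n) \<Longrightarrow> b \<in> miss \<psi> (y n)"
    and "b \<in> miss \<phi> (y n) \<Longrightarrow> a \<in> miss \<psi> (y n)"
proof -
  let ?K = "comp \<phi> a b (y n)"
  have link: "y i \<in> comp \<phi> a b (y j)" by (rule T_linked[OF T ij a b unused])
  have "y n \<notin> comp \<phi> a b (y j)"
    using comp_three_ends[of \<phi> "y j" "y i" "y n" a b] link T T_inj[OF T] ij a b yn by auto
  then have out: "y j \<notin> ?K" using comp_sym by blast
  then have out': "y i \<notin> ?K" using link comp_sym comp_trans by blast
  have "j < r" if "2 \<le> r" "r \<le> n" "\<phi> (f r) \<in> {a, b}" for r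
    using that unused T_colour_late[OF T ij(2), of r] b by force
  then have late: "\<forall>r. 2 \<le> r \<and> r \<le> n \<and> \<phi> (f r) \<in> {a, b} \<and> en (f r) \<inter> ?K \<noteq> {} \<longrightarrow> i < r \<and> j < r"
    using ij by force
  have "i < n" using ij by simp
  note sw = T_swap[OF T this ij(2) a b out' out late, folded \<psi>_def]
  show "T \<psi>" using sw(1) by blast
  show "\<And>t. t < n \<Longrightarrow> miss \<psi> (y t) = miss \<phi> (y t)" using sw(2) by blast
  show "a \<in> miss \<phi> (y n) \<Longrightarrow> b \<in> miss \<psi> (y n)" using sw(3) by blast
  show "b \<in> miss \<phi> (y n) \<Longrightarrow> a \<in> miss \<psi> (y n)" using sw(4) by blast
qed


lemma T_path_end:
  assumes T: "T \<phi>" and "p \<le> i" "i < n" "a \<in> miss \<phi> (y i)" "a \<in> miss \<phi> (y n)"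
  shows False
  using assms
proof (induction "n - i" arbitrary: i a \<phi> rule: less_induct)
  case less
  note T = less.prems(1)
  show False
  proof (cases "Suc i = n")
    case True
    have en: "en (f n) = {y i, y n}" using tail True less.prems(2) by (auto simp: tail_def)
    obtain t where t: "t < n" "\<phi> (f n) \<in> miss \<phi> (y t)" and fn: "f n \<in> E" "f n \<noteq> e0"
      using T_edge[OF T n order_refl] by metis
    have ti: "t < i"
    proof -
      have "t \<noteq> i" using t(2) fn en by (auto simp: miss_def)
      then show ?thesis using t(1) True by simp
    qed
    \<comment> \<open>Giving \<open>a\<close> to the last edge frees its old colour at
      \<open>y i\<close>. That colour is also missing at the earlier vertex \<open>y t\<close>, so
      the tree that ends at \<open>y i\<close> has a repetition.\<close>
    let ?\<psi> = "\<phi>(f n := a)"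
    have other: "y r \<notin> en (f n)" if "r < i" for r
      using en T_inj[OF T, of r i] T_inj[OF T, of r n] that less.prems(3) by auto
    have "a < k" using less.prems by (auto simp: miss_def)
    then have col: "col ?\<psi>"
      using T less.prems(4,5) en fn unfolding proper_on_def miss_def by (auto simp: Int_commute)
    have miss: "miss ?\<psi> (y r) = miss \<phi> (y r)" if "r < i" for r
    proof -
      have "?\<psi> g = \<phi> g" if "y r \<in> en g" for g using other[OF \<open>r < i\<close>] that by auto
      then show ?thesis unfolding miss_def by auto
    qed
    have "tash ?\<psi> i y f"
      unfolding tash_def
    proof (intro conjI allI impI)
      fix r assume r: "2 \<le> r \<and> r \<le> i"
      then obtain i' j' where e: "f r \<in> E" "f r \<noteq> e0" "i' < r" "en (f r) = {y i', y r}" "j' < r"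
          "\<phi> (f r) \<in> miss \<phi> (y j')"
        using T_edge[OF T, of r] True by (metis Suc_leD le_SucI)
      have "f r \<noteq> f n"
      proof
        assume "f r = f n"
        then have "y i' \<in> en (f n)" using e(4) by simp
        then show False using other[of i'] e(3) r by simp
      qed
      then show "\<exists>j<r. ?\<psi> (f r) \<in> miss ?\<psi> (y j)" using e miss r by auto
      show "f r \<in> E - {e0}" "\<exists>j<r. en (f r) = {y j, y r}" using e by auto
    qed (use tash_prefix[of \<phi> n y f i] T True n in \<open>auto simp: tash_def\<close>)
    then have "elem ?\<psi> i y" using IH_size[of i, OF _ col] tail_prefix[OF tail] less.prems(3) by simp
    moreover have "\<phi> (f n) \<in> miss ?\<psi> (y t)" using t miss ti by simp
    moreover have "\<phi> (f n) \<in> miss ?\<psi> (y i)"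
    proof -
      have "\<phi> (f n) \<noteq> a" using less.prems(5) en fn by (auto simp: miss_def)
      moreover have "\<phi> g \<noteq> \<phi> (f n)" if "g \<in> E - {e0}" "y i \<in> en g" "g \<noteq> f n" for g
        using kadj_colour_unique[of \<phi> g "f n" "y i"] T that fn en by auto
      moreover have "\<phi> (f n) < k" using t(2) by (simp add: miss_def)
      ultimately show ?thesis by (auto simp: miss_def)
    qed
    ultimately show False using ti elem_eq[of ?\<psi> i y t i] by auto
  next
    case False
    then have i: "Suc i < n" using less.prems by simp
    obtain b where b: "b \<in> miss \<phi> (y (Suc i))" using miss_nonempty T by blast
    \<comment> \<open>An edge up to \<open>f i\<close> is too early for a colour missing at
      \<open>y i\<close>, and \<open>f (Suc i)\<close> is incident with \<open>y i\<close> because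
      this part of the tree is a path.\<close>
    have unused: "\<forall>r. 2 \<le> r \<and> r \<le> Suc i \<longrightarrow> \<phi> (f r) \<noteq> a"
    proof (intro allI impI notI)
      fix r assume that: "2 \<le> r \<and> r \<le> Suc i"
      assume eq: "\<phi> (f r) = a"
      then have "i < r" using T_colour_late[OF T less.prems(3), of r] that less.prems i by simp
      then have "r = Suc i" using that by simp
      moreover have "en (f (Suc i)) = {y i, y (Suc i)}"
        using tail i less.prems(2) by (auto simp: tail_def)
      moreover have "f r \<in> E - {e0}" using T_edge[OF T, of r] that i by auto
      ultimately show False using eq less.prems(4) by (auto simp: miss_def)
    qed
    note tr = T_transfer[OF T lessI i less.prems(4) b unused disjI1[OF less.prems(5)]]
    show False
      by (rule less.hyps[OF _ tr(1) _ i _ tr(3)[OF less.prems(5)]]) (use i b tr(2) less.prems in auto)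
  qed
qed

text \<open>Otherwise the first \<open>p - 1\<close> vertices followed by a segment of the chain up to \<open>y n\<close> would be a
  tree of smaller path number, again with a repeated colour.\<close>

lemma T_head_chain:
  assumes T: "T \<phi>" and p: "3 \<le> p" "p \<le> n" and i: "i \<le> p - 2" and j: "j \<le> p - 2"
    and a: "a \<in> miss \<phi> (y i)" "a \<in> miss \<phi> (y n)" and b: "b \<in> miss \<phi> (y j)" and t: "t \<le> p - 2"
  shows "y t \<notin> comp \<phi> a b (y n)"
proof
  assume "y t \<in> comp \<phi> a b (y n)"
  then have "y n \<in> comp \<phi> a b (y t)" by (rule comp_sym)
  then obtain xs where xs: "xs \<noteq> []" "hd xs = y t" "last xs = y n" "distinct xs"
      "successively (kadj \<phi> a b) xs"
    using rtranclp_distinct_path[of "kadj \<phi> a b" "y t" "y n"] by auto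
  define l where "l = p - 2"
  have l: "1 \<le> l" "l < n" "l + 1 < p" "i \<le> l" "j \<le> l" "t \<le> l" using p i j t l_def by auto
  define A where "A = y ` {..l}"
  have "\<exists>x\<in>set xs. x \<in> A" using hd_in_set[OF xs(1)] xs(2) l by (auto simp: A_def)
  \<comment> \<open>Cutting after the last vertex in the head makes \<open>ws\<close> disjoint from
    it, so head and \<open>ws\<close> together form a tree. Its path part starts at
    \<open>l + 1 = p - 1\<close>, and the colours \<open>a\<close> and \<open>b\<close> on it are
    missing in the head.\<close>
  then obtain us z ws where split: "xs = us @ z # ws" "z \<in> A" "\<forall>x\<in>set ws. x \<notin> A"
    using split_list_last_prop[where xs = xs and P = "\<lambda>x. x \<in> A"] by blast
  have ynA: "y n \<notin> A" using T_inj[OF T] l by (auto simp: A_def)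
  have ws: "ws \<noteq> []" "last ws = y n" using xs(3) split ynA by (auto split: if_splits)
  have sw: "successively (kadj \<phi> a b) (z # ws)" using xs(5) split(1) by (simp add: successively_append_iff)
  have dw: "distinct ws" using xs(4) split(1) by simp
  define y' where "y' = (\<lambda>i. if i \<le> l then y i else ws ! (i - l - 1))"
  define h where "h = (\<lambda>i. SOME e. e \<in> E - {e0} \<and> en e = {(z # ws) ! (i - l - 1), (z # ws) ! (i - l)} \<and> \<phi> e \<in> {a, b})"
  define f' where "f' = (\<lambda>i. if i \<le> l then f i else h i)"
  define m where "m = l + length ws"
  have h: "h r \<in> E - {e0} \<and> en (h r) = {(z # ws) ! (r - l - 1), (z # ws) ! (r - l)} \<and> \<phi> (h r) \<in> {a, b}"
    if "l < r" "r \<le> m" for r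
  proof -
    have "kadj \<phi> a b ((z # ws) ! (r - l - 1)) ((z # ws) ! Suc (r - l - 1))"
      using that unfolding m_def by (intro successively_nth[OF sw]) auto
    moreover have "Suc (r - l - 1) = r - l" using that by simp
    ultimately have "\<exists>e. e \<in> E - {e0} \<and> en e = {(z # ws) ! (r - l - 1), (z # ws) ! (r - l)} \<and> \<phi> e \<in> {a, b}"
      unfolding kadj_def by auto
    then show ?thesis unfolding h_def by (rule someI_ex)
  qed
  have y'w: "y' r = (z # ws) ! (r - l)" if "l < r" for r
    using that by (simp add: y'_def nth_Cons')
  obtain zi where zi: "zi \<le> l" "z = y zi" using split(2) by (auto simp: A_def)
  have "tash \<phi> m y' f'"
    unfolding tash_def
  proof (intro conjI allI impI)
    show "1 \<le> m" using l m_def by simp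
    show "inj_on y' {..m}"
    proof (rule inj_onI)
      fix u v assume uv: "u \<in> {..m}" "v \<in> {..m}" "y' u = y' v"
      have nA: "y' r \<notin> A" if "l < r" "r \<le> m" for r
        using that split(3) unfolding y'_def m_def by auto
      have inA: "y' r \<in> A" if "r \<le> l" for r using that by (auto simp: y'_def A_def)
      have "(u \<le> l) = (v \<le> l)" using nA inA uv by (metis atMost_iff not_le)
      then show "u = v"
        using uv T_inj[OF T, of u v] l dw
        by (cases "u \<le> l") (auto simp: y'_def m_def nth_eq_iff_index_eq)
    qed
    show "f' 1 = e0" "en e0 = {y' 0, y' 1}" using T l by (auto simp: f'_def y'_def tash_def)
    fix r assume r: "2 \<le> r \<and> r \<le> m"
    show "f' r \<in> E - {e0}"
    proof (cases "r \<le> l")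
      case True
      then show ?thesis using T_edge[OF T, of r] r l by (auto simp: f'_def)
    next
      case False
      then show ?thesis using h[of r] r by (simp add: f'_def)
    qed
    show "\<exists>j<r. en (f' r) = {y' j, y' r}"
    proof (cases "r \<le> l")
      case True
      then obtain t where "t < r" "en (f r) = {y t, y r}" using T_edge[OF T, of r] r l by auto
      then show ?thesis using True by (intro exI[of _ t]) (auto simp: f'_def y'_def)
    next
      case False
      then have "en (f' r) = {(z # ws) ! (r - l - 1), y' r}" using h[of r] r y'w[of r] by (simp add: f'_def)
      moreover have "\<exists>j<r. (z # ws) ! (r - l - 1) = y' j"
      proof (cases "r = Suc l")
        case True
        then show ?thesis using zi by (intro exI[of _ zi]) (auto simp: y'_def)
      next
        case F: False
        then show ?thesis using False y'w[of "r - 1"] by (intro exI[of _ "r - 1"]) auto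
      qed
      ultimately show ?thesis by metis
    qed
    show "\<exists>j<r. \<phi> (f' r) \<in> miss \<phi> (y' j)"
    proof (cases "r \<le> l")
      case True
      then obtain j where "j < r" "\<phi> (f r) \<in> miss \<phi> (y j)" using T_edge[OF T, of r] r l by auto
      then show ?thesis using True by (intro exI[of _ j]) (auto simp: f'_def y'_def)
    next
      case False
      then have "\<phi> (f' r) \<in> {a, b}" using h[of r] r by (simp add: f'_def)
      moreover have "y' i = y i" "y' j = y j" "i < r" "j < r" using l False by (auto simp: y'_def)
      ultimately show ?thesis using a(1) b by (metis insertE singletonD)
    qed
  qed
  moreover have "tail (l + 1) m y' f'"
    unfolding tail_def
  proof (intro allI impI)
    fix r assume r: "l + 1 < r \<and> r \<le> m"
    then have "l < r - 1" by linarith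
    then show "en (f' r) = {y' (r - 1), y' r}"
      using r h[of r] y'w[of r] y'w[of "r - 1"] by (simp add: f'_def diff_commute)
  qed
  ultimately have "elem \<phi> m y'" using IH_path l T by blast
  moreover have "y' m = y n" using ws by (simp add: y'_def m_def last_conv_nth)
  moreover have "y' i = y i" using l by (simp add: y'_def)
  ultimately show False using elem_eq[of \<phi> m y' i m a] a l ws(1) by (simp add: m_def)
qed

lemma T_make_colour_unused:
  assumes T: "T \<phi>" and p: "3 \<le> p" "p \<le> n" and i: "i \<le> p - 2"
    and a: "a \<in> miss \<phi> (y i)" "a \<in> miss \<phi> (y n)"
    and far: "\<exists>t\<le>p - 2. en (f p) = {y t, y p}"
  obtains \<psi> j b where "T \<psi>" "j \<le> p - 2" "b \<in> miss \<psi> (y j)" "b \<in> miss \<psi> (y n)"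
    "\<forall>r. 2 \<le> r \<and> r \<le> p \<longrightarrow> \<psi> (f r) \<noteq> b"
proof -
  let ?U = "(\<lambda>r. \<phi> (f r)) ` {2..p}"
  have "card ?U \<le> p - 1" using card_image_le[of "{2..p}" "\<lambda>r. \<phi> (f r)"] by simp
  then obtain j b where j: "j \<le> p - 2" and b: "b \<in> miss \<phi> (y j)" "b \<notin> ?U"
    using free_colour[OF T, of "p - 2" ?U] p by fastforce
  let ?K = "comp \<phi> a b (y n)"
  let ?\<psi> = "kswap \<phi> a b ?K"
  have avoid: "y t \<notin> ?K" if "t \<le> p - 2" for t
    by (rule T_head_chain[OF T p i j a b(1) that])
  have near: "\<exists>t\<le>p - 2. y t \<in> en (f r)" if r: "2 \<le> r" "r \<le> p" for r
  proof (cases "r = p")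
    case True
    then show ?thesis using far by auto
  next
    case False
    obtain t where "t < r" "en (f r) = {y t, y r}" using T_edge[OF T, of r] r p by auto
    then show ?thesis using False r by (intro exI[of _ t]) auto
  qed
  have cl: "kclosed \<phi> a b ?K" by (rule kclosed_comp)
  have untouched: "en (f r) \<inter> ?K = {}" if r: "2 \<le> r" "r \<le> p" "\<phi> (f r) \<in> {a, b}" for r
  proof (rule ccontr)
    assume *: "en (f r) \<inter> ?K \<noteq> {}"
    have "f r \<in> E - {e0}" using T_edge[OF T, of r] r p by auto
    then have "en (f r) \<subseteq> ?K" using cl * r(3) unfolding kclosed_def by blast
    then show False using near[OF r(1,2)] avoid by blast
  qed
  have late: "\<forall>r. 2 \<le> r \<and> r \<le> n \<and> \<phi> (f r) \<in> {a, b} \<and> en (f r) \<inter> ?K \<noteq> {} \<longrightarrow> i < r \<and> j < r"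
  proof (intro allI impI)
    fix r assume r: "2 \<le> r \<and> r \<le> n \<and> \<phi> (f r) \<in> {a, b} \<and> en (f r) \<inter> ?K \<noteq> {}"
    then have "\<not> r \<le> p" using untouched[of r] by blast
    then show "i < r \<and> j < r" using i j by linarith
  qed
  have "i < n" "j < n" using i j p by auto
  note sw = T_swap[OF T this a(1) b(1) avoid[OF i] avoid[OF j] late]
  have "?\<psi> (f r) = \<phi> (f r)" if "2 \<le> r" "r \<le> p" for r
    using untouched[OF that] by (cases "\<phi> (f r) \<in> {a, b}") (simp add: kswap_def, simp add: kswap_other)
  then have "\<forall>r. 2 \<le> r \<and> r \<le> p \<longrightarrow> ?\<psi> (f r) \<noteq> b" using b(2) by auto
  then show thesis using that[of ?\<psi> j b] sw(1) sw(2)[OF \<open>j < n\<close>] sw(3)[OF a(2)] j b(1) by blast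
qed

lemma T_no_repetition:
  assumes T: "T \<phi>" and p0: "p = 0 \<or> 3 \<le> p" and pn: "p \<le> n"
    and far: "3 \<le> p \<Longrightarrow> en (f p) \<noteq> {y (p - 1), y p}"
    and i: "i < n" and a: "a \<in> miss \<phi> (y i)" "a \<in> miss \<phi> (y n)"
  shows False
proof (cases "p \<le> i")
  case True
  then show False using T_path_end[OF T _ i a] by simp
next
  case False
  then have p: "3 \<le> p" using p0 by auto
  have far': "\<exists>t\<le>p - 2. en (f p) = {y t, y p}"
  proof -
    obtain t where "t < p" "en (f p) = {y t, y p}" using T_edge[OF T, of p] p pn by auto
    then show ?thesis using far p by (intro exI[of _ t]) (cases "t = p - 1", auto)
  qed
  have "\<exists>\<psi> j b. T \<psi> \<and> j \<le> p - 2 \<and> b \<in> miss \<psi> (y j) \<and> b \<in> miss \<psi> (y n)"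
  proof (cases "i \<le> p - 2")
    case True
    then show ?thesis using T a by blast
  next
    case F: False
    then have ip: "i = p - 1" using False by simp
    let ?U = "(\<lambda>r. \<phi> (f r)) ` {2..p - 1}"
    have "card ?U \<le> p - 2" using card_image_le[of "{2..p - 1}" "\<lambda>r. \<phi> (f r)"] by simp
    then obtain j b where j: "j \<le> p - 2" and b: "b \<in> miss \<phi> (y j)" "b \<notin> ?U"
      using free_colour[OF T, of "p - 2" ?U] p pn by fastforce
    have ji: "j < i" using j ip p by simp
    have un: "\<forall>r. 2 \<le> r \<and> r \<le> i \<longrightarrow> \<phi> (f r) \<noteq> b" using b(2) ip by auto
    note tr = T_transfer[OF T ji i b(1) a(1) un disjI2[OF a(2)]]
    have "j < n" using ji i by simp
    then show ?thesis using tr(1) tr(2)[of j] tr(4) a(2) b(1) j by blast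
  qed
  then obtain \<phi>1 j1 b1 where 1: "T \<phi>1" "j1 \<le> p - 2" "b1 \<in> miss \<phi>1 (y j1)" "b1 \<in> miss \<phi>1 (y n)"
    by blast
  obtain \<psi> j b where T2: "T \<psi>" and j: "j \<le> p - 2" and b: "b \<in> miss \<psi> (y j)" "b \<in> miss \<psi> (y n)"
    and unused: "\<forall>r. 2 \<le> r \<and> r \<le> p \<longrightarrow> \<psi> (f r) \<noteq> b"
    using T_make_colour_unused[OF 1(1) p pn 1(2-4) far'] by blast
  show False
  proof (cases "p < n")
    case True
    obtain c where c: "c \<in> miss \<psi> (y p)" using miss_nonempty T2 by blast
    have jp: "j < p" using j p by simp
    note tr = T_transfer[OF T2 jp True b(1) c unused disjI1[OF b(2)]]
    show False by (rule T_path_end[OF tr(1) order_refl True _ tr(3)[OF b(2)]]) (use tr(2)[of p] c True in auto)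
  next
    case False
    then have pn': "p = n" using pn by simp
    \<comment> \<open>The edge \<open>f n\<close> is attached before \<open>y (n - 1)\<close>. If
      its colour is missing before \<open>y (n - 1)\<close> as well, the tree stays valid without
      \<open>y (n - 1)\<close>, and its path number drops to \<open>n - 1\<close>.\<close>
    have shortcut: False
      if T3: "T \<chi>" and ij: "i \<le> n - 2" "j \<le> n - 2" and "\<chi> (f n) \<in> miss \<chi> (y i)"
        and "d \<in> miss \<chi> (y j)" "d \<in> miss \<chi> (y n)" for \<chi> i j d
    proof -
      let ?y = "y(n - 1 := y n)" and ?f = "f(n - 1 := f n)"
      have n3: "3 \<le> n" using p pn by simp
      have "tash \<chi> (n - 1) ?y ?f"
        unfolding tash_def
      proof (intro conjI allI impI)
        show "inj_on ?y {..n - 1}"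
          using T_inj[OF T3] n3 by (auto simp: inj_on_def)
        fix r assume r: "2 \<le> r \<and> r \<le> n - 1"
        then have rn: "r \<le> n" by linarith
        obtain t where t: "t \<le> n - 2" "en (f n) = {y t, y n}" using far' pn' by blast
        have "f r \<in> E - {e0}" if "2 \<le> r" "r \<le> n" for r using T_edge[OF T3 that] by auto
        then show "?f r \<in> E - {e0}" using r rn n3 by auto
        show "\<exists>j<r. en (?f r) = {?y j, ?y r}"
        proof (cases "r = n - 1")
          case True
          then show ?thesis using t n3 by (intro exI[of _ t]) auto
        next
          case False
          obtain t where "t < r" "en (f r) = {y t, y r}" using T_edge[OF T3, of r] r rn by auto
          then show ?thesis using False r by (intro exI[of _ t]) auto
        qed
        show "\<exists>j<r. \<chi> (?f r) \<in> miss \<chi> (?y j)"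
        proof (cases "r = n - 1")
          case True
          then show ?thesis using that n3 by (intro exI[of _ i]) auto
        next
          case False
          obtain t where "t < r" "\<chi> (f r) \<in> miss \<chi> (y t)" using T_edge[OF T3, of r] r rn by auto
          then show ?thesis using False r by (intro exI[of _ t]) auto
        qed
      qed (use T3 n3 in \<open>auto simp: tash_def\<close>)
      moreover have "tail (n - 1) (n - 1) ?y ?f" unfolding tail_def by (meson leD)
      ultimately have "elem \<chi> (n - 1) ?y" using IH_path[of "n - 1"] pn' n3 T3 by simp
      moreover have "j \<noteq> n - 1" "j \<le> n - 1" using ij n3 by linarith+
      ultimately show False using elem_eq[of \<chi> "n - 1" ?y j "n - 1" d] that by auto
    qed
    obtain t where t: "t < n" "\<psi> (f n) \<in> miss \<psi> (y t)" using T_edge[OF T2 n order_refl] by metis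
    show False
    proof (cases "t \<le> n - 2")
      case True
      then show False using shortcut[OF T2 True _ t(2) b] j pn' by simp
    next
      case Ft: False
      then have tn: "t = n - 1" using t by simp
      let ?c = "\<psi> (f n)"
      have jt: "j < t" using j tn pn' p by simp
      have un: "\<forall>r. 2 \<le> r \<and> r \<le> t \<longrightarrow> \<psi> (f r) \<noteq> b" using unused t(1) pn' by auto
      \<comment> \<open>Two changes lead to the situation of \<open>shortcut\<close>. The first
        gives \<open>f n\<close> the colour \<open>b\<close>, which is missing at
        \<open>y j\<close>, and leaves \<open>?c\<close> repeated at \<open>y (n - 1)\<close> and
        \<open>y n\<close>. The second replaces that repetition by a colour \<open>d\<close> missing
        in the head; \<open>f n\<close> keeps \<open>b\<close> because \<open>d\<close> and
        \<open>?c\<close> differ from \<open>b\<close>.\<close>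
      define \<psi>' where "\<psi>' = kswap \<psi> b ?c (comp \<psi> b ?c (y n))"
      note tr = T_transfer[OF T2 jt t(1) b(1) t(2) un disjI1[OF b(2)], folded \<psi>'_def]
      have "y n \<in> en (f n)" using far' pn' by auto
      then have fn: "\<psi>' (f n) = b" by (auto simp: \<psi>'_def kswap_def)
      have miss': "miss \<psi>' (y r) = miss \<psi> (y r)" if "r < n" for r using tr(2) that by blast
      have T3: "T \<psi>'" using tr(1) by blast
      have cn: "?c \<in> miss \<psi>' (y n)" using tr(3)[OF b(2)] by blast
      have ct: "?c \<in> miss \<psi>' (y t)" using t miss' by simp
      let ?U = "insert b ((\<lambda>r. \<psi>' (f r)) ` {2..n - 1})"
      have "card ?U \<le> n - 1"
        using card_image_le[of "{2..n - 1}" "\<lambda>r. \<psi>' (f r)"]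
          card_insert_le_m1[of "n - 1" "(\<lambda>r. \<psi>' (f r)) ` {2..n - 1}" b] p pn' by simp
      then obtain j2 d where j2: "j2 \<le> n - 2" and d: "d \<in> miss \<psi>' (y j2)" "d \<notin> ?U"
        using free_colour[OF T3, of "n - 2" ?U] p pn' by fastforce
      have jt2: "j2 < t" using j2 tn p pn' by simp
      have un2: "\<forall>r. 2 \<le> r \<and> r \<le> t \<longrightarrow> \<psi>' (f r) \<noteq> d" using d(2) tn by auto
      define \<chi> where "\<chi> = kswap \<psi>' d ?c (comp \<psi>' d ?c (y n))"
      note tr2 = T_transfer[OF T3 jt2 t(1) d(1) ct un2 disjI2[OF cn], folded \<chi>_def]
      have "b \<noteq> ?c" using unused pn' n by auto
      then have "\<chi> (f n) = b" using fn d(2) by (auto simp: \<chi>_def kswap_def transpose_def)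
      moreover have "b \<in> miss \<chi> (y j)" using tr2(2)[of j] miss' b(1) jt t(1) by auto
      moreover have "d \<in> miss \<chi> (y j2)" using tr2(2)[of j2] d(1) jt2 t(1) by auto
      moreover have "d \<in> miss \<chi> (y n)" using tr2(4)[OF cn] by blast
      moreover have "T \<chi>" using tr2(1) by blast
      ultimately show False using shortcut[of \<chi> j j2 d] j j2 pn' by simp
    qed
  qed
qed

end

section \<open>Tashkinov's theorem\<close>

context near_coloring
begin

theorem tashkinov:
  assumes "col \<phi>" "tash \<phi> n y f" "tail p n y f"
  shows "elem \<phi> n y"
  using assms
proof (induction p arbitrary: n y f \<phi> rule: less_induct)
  case (less p)
  note IH_path = less.IH
  show ?case using less.prems
  proof (induction n arbitrary: y f \<phi> rule: less_induct)
    case (less n)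
    note T = less.prems
    show ?case
    proof (rule ccontr)
      assume "\<not> elem \<phi> n y"
      then obtain i j c where ij: "i < j" "j \<le> n" "c \<in> miss \<phi> (y i)" "c \<in> miss \<phi> (y j)"
        unfolding elem_def by blast
      have jn: "j = n"
      proof (rule ccontr)
        assume "j \<noteq> n"
        then have "elem \<phi> j y" using less.IH[of j \<phi> y f] T ij tash_prefix[of \<phi> n y f j] tail_prefix[of p n y f j] by simp
        then show False using elem_eq[of \<phi> j y i j c] ij by simp
      qed
      have n1: "1 \<le> n" using T(2) by (simp add: tash_def)
      have n2: "2 \<le> n"
      proof (rule ccontr)
        assume "\<not> 2 \<le> n"
        then have "n = 1" using n1 by simp
        then have m: "c \<in> miss \<phi> (y 0)" "c \<in> miss \<phi> (y 1)" using ij jn by auto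
        have "proper_on E en k (\<phi>(e0 := c))"
          using T(1) T(2) m unfolding proper_on_def miss_def tash_def by (auto simp: Int_commute)
        then show False using not_colorable by blast
      qed
      have pn: "p \<le> n"
      proof (rule ccontr)
        assume "\<not> p \<le> n"
        then have "elem \<phi> n y" using IH_path[of n \<phi> n y f] T by (simp add: tail_def)
        then show False using elem_eq[of \<phi> n y i n c] ij jn by simp
      qed
      have far: "en (f p) \<noteq> {y (p - 1), y p}" if "1 \<le> p"
      proof
        assume "en (f p) = {y (p - 1), y p}"
        then have "tail (p - 1) n y f" using T(3) that unfolding tail_def
          by (metis Suc_diff_1 Suc_leI diff_Suc_1 le_neq_implies_less less_le_trans zero_less_one)
        then have "elem \<phi> n y" using IH_path[of "p - 1" \<phi> n y f] T that by simp
        then show False using elem_eq[of \<phi> n y i n c] ij jn by simp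
      qed
      \<comment> \<open>The edge \<open>f 1\<close> always joins \<open>y 0\<close> and
        \<open>y 1\<close>, contrary to \<open>far\<close> for \<open>p = 1\<close>.\<close>
      have p1: "p \<noteq> 1" using far T(2) by (auto simp: tash_def)
      have p2: "p \<noteq> 2"
      proof
        assume p: "p = 2"
        \<comment> \<open>By \<open>far\<close> the edge \<open>f 2\<close> is attached to
          \<open>y 0\<close>. After exchanging the names of \<open>y 0\<close> and
          \<open>y 1\<close> the whole tree is a path, with path number \<open>0\<close>.\<close>
        define y' where "y' = y \<circ> transpose 0 (1::nat)"
        have y': "y' 0 = y 1" "y' 1 = y 0" "\<And>r. 2 \<le> r \<Longrightarrow> y' r = y r"
          by (auto simp: y'_def transpose_def)
        have ex: "(\<exists>j<r. P (y' j)) \<longleftrightarrow> (\<exists>j<r. P (y j))" if "2 \<le> r" for r P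
        proof -
          have "bij_betw (transpose 0 (1::nat)) {..<r} {..<r}"
            using that by (intro bij_betw_byWitness[of _ "transpose 0 1"]) (auto simp: transpose_def)
          then have "transpose 0 (1::nat) ` {..<r} = {..<r}" by (rule bij_betw_imp_surj_on)
          then have "y' ` {..<r} = y ` {..<r}" unfolding y'_def image_comp[symmetric] by simp
          then show ?thesis by (metis (no_types, lifting) image_iff lessThan_iff)
        qed
        have "tash \<phi> n y' f"
          unfolding tash_def
        proof (intro conjI allI impI)
          show "inj_on y' {..n}"
            unfolding y'_def
          proof (rule comp_inj_on)
            show "inj_on (transpose 0 (1::nat)) {..n}" by simp
            have "transpose 0 (1::nat) ` {..n} \<subseteq> {..n}" using n2 by (auto simp: transpose_def)
            then show "inj_on y (transpose 0 (1::nat) ` {..n})"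
              using T(2) inj_on_subset unfolding tash_def by blast
          qed
          show "en e0 = {y' 0, y' 1}" using T(2) y' by (auto simp: tash_def)
          fix r assume r: "2 \<le> r \<and> r \<le> n"
          show "\<exists>j<r. en (f r) = {y' j, y' r}"
            using T(2) r ex[of r "\<lambda>v. en (f r) = {v, y r}"] y'(3)[of r] by (simp add: tash_def)
          show "\<exists>j<r. \<phi> (f r) \<in> miss \<phi> (y' j)"
            using T(2) r ex[of r "\<lambda>v. \<phi> (f r) \<in> miss \<phi> v"] by (simp add: tash_def)
          show "f r \<in> E - {e0}" using T(2) r by (simp add: tash_def)
        qed (use T(2) in \<open>auto simp: tash_def\<close>)
        moreover have "tail 0 n y' f"
          unfolding tail_def
        proof (intro allI impI)
          fix r assume r: "0 < r \<and> r \<le> n"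
          consider "r = 1" | "r = 2" | "2 < r" using r by linarith
          then show "en (f r) = {y' (r - 1), y' r}"
          proof cases
            case 1
            then show ?thesis using T(2) y' by (auto simp: tash_def)
          next
            case 2
            obtain t where "t < 2" "en (f 2) = {y t, y 2}" using T(2) n2 by (auto simp: tash_def)
            then show ?thesis using far p 2 y' by (auto simp: less_2_cases_iff)
          next
            case 3
            then show ?thesis using T(3) p r y'(3)[of r] y'(3)[of "r - 1"] by (simp add: tail_def)
          qed
        qed
        ultimately have "elem \<phi> n y'" using IH_path[of 0 \<phi> n y' f] T p by simp
        moreover have "\<exists>i'<n. y' i' = y i" using ij jn n2 ex[of n "\<lambda>v. v = y i"] by auto
        ultimately show False using elem_eq[of \<phi> n y' _ n c] ij jn y'(3)[OF n2] by (metis less_imp_le nat_less_le)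
      qed
      interpret minimal_tree E en k s e0 p n y f
        using IH_path less.IH T(3) n2 by unfold_locales blast+
      have "p = 0 \<or> 3 \<le> p" using p1 p2 by linarith
      then show False using T_no_repetition[of \<phi> i c] T pn far ij jn by simp
    qed
  qed
qed

end

section \<open>Weighted graphs forced to be odd cycles\<close>

lemma even_symmetric_sum:
  fixes x :: "'v \<Rightarrow> 'v \<Rightarrow> nat"
  assumes "finite S" "\<And>u v. x u v = x v u" "\<And>u. x u u = 0"
  shows "even (\<Sum>u\<in>S. \<Sum>v\<in>S. x u v)"
  using assms(1)
proof (induction S rule: finite_induct)
  case (insert a S)
  have "(\<Sum>u\<in>insert a S. \<Sum>v\<in>insert a S. x u v) =
      (\<Sum>v\<in>S. x a v) + ((\<Sum>u\<in>S. x u a) + (\<Sum>u\<in>S. \<Sum>v\<in>S. x u v))"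
    using insert.hyps assms(3) by (simp add: sum.distrib)
  also have "(\<Sum>u\<in>S. x u a) = (\<Sum>v\<in>S. x a v)" using assms(2) by (intro sum.cong) auto
  finally show ?case using insert.IH by simp
qed simp

text \<open>Both sides carry the same total weight, so \<open>M\<close> times the difference of
  their sizes is a difference of sums of \<open>m\<close>. The sizes differ because
  \<open>card S\<close> is odd, but \<open>m\<close> sums only to \<open>M - 2\<close>.\<close>

lemma weights_not_bipartite:
  fixes x :: "'v \<Rightarrow> 'v \<Rightarrow> nat" and m :: "'v \<Rightarrow> nat"
  assumes fin: "finite S" and sym: "\<And>u v. x u v = x v u"
    and deg: "\<And>v. v \<in> S \<Longrightarrow> (\<Sum>u\<in>S. x v u) + m v = M"
    and sum_m: "(\<Sum>v\<in>S. m v) + 2 = M" and odd: "odd (card S)"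
    and A: "A \<subseteq> S" and cross: "\<And>u v. u \<in> S \<Longrightarrow> v \<in> S \<Longrightarrow> 0 < x u v \<Longrightarrow> (u \<in> A) \<noteq> (v \<in> A)"
  shows False
proof -
  define B where "B = S - A"
  have B: "B \<subseteq> S" "A \<inter> B = {}" "A \<union> B = S" using A by (auto simp: B_def)
  have fins: "finite A" "finite B" using fin A B finite_subset by blast+
  have part: "(\<Sum>u\<in>X. \<Sum>v\<in>S. x u v) + (\<Sum>u\<in>X. m u) = card X * M" if "X \<subseteq> S" for X
  proof -
    have "(\<Sum>u\<in>X. \<Sum>v\<in>S. x u v) + (\<Sum>u\<in>X. m u) = (\<Sum>u\<in>X. M)"
      unfolding sum.distrib[symmetric] using that deg by (intro sum.cong) auto
    then show ?thesis by simp
  qed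
  have "(\<Sum>u\<in>A. \<Sum>v\<in>S. x u v) = (\<Sum>u\<in>A. \<Sum>v\<in>B. x u v)"
    using A B fin cross by (intro sum.cong sum.mono_neutral_right) (auto simp: B_def)
  also have "\<dots> = (\<Sum>v\<in>B. \<Sum>u\<in>A. x u v)" by (rule sum.swap)
  also have "\<dots> = (\<Sum>v\<in>B. \<Sum>u\<in>S. x v u)"
    using A B fin cross sym by (intro sum.cong sum.mono_neutral_cong_left) (auto simp: B_def)
  finally have eq: "(\<Sum>u\<in>A. \<Sum>v\<in>S. x u v) = (\<Sum>v\<in>B. \<Sum>u\<in>S. x v u)" .
  have mm: "(\<Sum>v\<in>A. m v) + (\<Sum>v\<in>B. m v) + 2 = M"
    using sum_m sum.union_disjoint[OF fins B(2), of m] B(3) by simp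
  have "card A + card B = card S" using card_Un_disjoint[OF fins B(2)] B(3) by simp
  then have "card A \<noteq> card B" using odd by (metis even_add)
  then consider "card B + 1 \<le> card A" | "card A + 1 \<le> card B" by linarith
  then show False
  proof cases
    case 1
    then have "(card B + 1) * M \<le> card A * M" by (rule mult_right_mono) simp
    then show False using part[OF A] part[OF B(1)] eq mm by (simp add: algebra_simps)
  next
    case 2
    then have "(card A + 1) * M \<le> card B * M" by (rule mult_right_mono) simp
    then show False using part[OF A] part[OF B(1)] eq mm by (simp add: algebra_simps)
  qed
qed

definition cyc :: "('v \<Rightarrow> 'v \<Rightarrow> bool) \<Rightarrow> 'v list \<Rightarrow> bool" where
  "cyc R vs \<longleftrightarrow> 3 \<le> length vs \<and> distinct vs \<and> successively R vs \<and> R (last vs) (hd vs)"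

lemma cyc_mono:
  assumes "cyc R vs" "\<And>u v. R u v \<Longrightarrow> Q u v"
  shows "cyc Q vs"
  using assms successively_mono[of R vs Q] by (simp add: cyc_def)

lemma cyc_rotate:
  assumes "cyc R vs"
  shows "cyc R (rotate i vs)"
proof -
  have "cyc R (rotate1 vs)" if "cyc R vs" for vs
    using that by (cases vs) (auto simp: cyc_def successively_append_iff successively_Cons hd_append)
  then show ?thesis using assms by (induction i) auto
qed

text \<open>The list names its first vertex again at the end, so even length means an odd number of
  steps. At any further repetition a shortest such closed walk splits into two closed walks, one of
  which is again odd and shorter.\<close>

lemma odd_cycle_exists:
  fixes R :: "'v \<Rightarrow> 'v \<Rightarrow> bool"
  assumes sym: "\<And>u v. R u v \<Longrightarrow> R v u" and irr: "\<And>u. \<not> R u u"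
    and ow: "xs \<noteq> []" "successively R xs" "hd xs = last xs" "even (length xs)"
  shows "\<exists>vs. cyc R vs \<and> odd (length vs)"
proof -
  let ?P = "\<lambda>xs. xs \<noteq> [] \<and> successively R xs \<and> hd xs = last xs \<and> even (length xs)"
  obtain ws where ws: "?P ws" and least: "\<And>zs. ?P zs \<Longrightarrow> length ws \<le> length zs"
    using ow ex_has_least_nat[of ?P xs length] by blast
  define vs where "vs = butlast ws"
  have wsvs: "vs @ [last ws] = ws" using ws by (simp add: vs_def)
  have "length ws \<noteq> 0" "even (length ws)" using ws by simp_all
  then have "2 \<le> length ws" by presburger
  then have "length vs \<noteq> 0" by (simp add: vs_def)
  then have vne: "vs \<noteq> []" by blast
  have "hd (vs @ [last ws]) = last ws" "successively R (vs @ [last ws])" using ws wsvs by auto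
  then have hd: "hd vs = last ws" and suc: "successively R vs" "R (last vs) (hd vs)"
    using vne by (auto simp: successively_append_iff)
  have "distinct vs"
  proof (rule ccontr)
    assume "\<not> distinct vs"
    then obtain as z bs cs where dec: "vs = as @ [z] @ bs @ [z] @ cs"
      using not_distinct_decomp by blast
    define l where "l = last ws"
    have w: "ws = as @ z # bs @ z # cs @ [l]" using wsvs dec l_def by simp
    have s1: "successively R (z # bs @ [z])" "successively R (as @ z # cs @ [l])"
      using ws unfolding w by (auto simp: successively_append_iff successively_Cons hd_append split: if_splits)
    have hl: "hd (as @ z # cs @ [l]) = l" using ws unfolding w by (cases as) auto
    have "even (length (z # bs @ [z])) \<or> even (length (as @ z # cs @ [l]))"
      using ws unfolding w by auto
    then show False
    proof
      assume "even (length (z # bs @ [z]))"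
      then have "length ws \<le> length (z # bs @ [z])" using s1(1) by (intro least) auto
      then show False unfolding w by simp
    next
      assume "even (length (as @ z # cs @ [l]))"
      then have "length ws \<le> length (as @ z # cs @ [l])" using s1(2) hl by (intro least) auto
      then show False unfolding w by simp
    qed
  qed
  moreover have "odd (length vs)" using ws wsvs by (metis even_Suc length_append_singleton)
  moreover have "length vs \<noteq> 1" using suc irr by (auto simp: length_Suc_conv)
  moreover have "3 \<le> length vs" using calculation by presburger
  ultimately show ?thesis using suc by (auto simp: cyc_def)
qed

text \<open>The locale has two instances: the edges that carry a colour missing on the tree, with
  \<open>M\<close> the number of these colours, and all edges inside the tree's vertex set, with
  \<open>M = k\<close>. In both, \<open>m v\<close> is what the degree of \<open>v\<close> lacks to
  \<open>M\<close>.\<close>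

locale ring_weights =
  fixes S :: "'v set" and x :: "'v \<Rightarrow> 'v \<Rightarrow> nat" and m :: "'v \<Rightarrow> nat" and M \<mu> h s g :: nat
  assumes fin: "finite S" and sym: "x u v = x v u" and irr: "x u u = 0"
    and x_le: "x u v \<le> \<mu>"
    and deg: "v \<in> S \<Longrightarrow> (\<Sum>u\<in>S. x v u) + m v = M"
    and m_ge: "v \<in> S \<Longrightarrow> s \<le> m v"
    and sum_m: "(\<Sum>v\<in>S. m v) + 2 = M" and s: "1 \<le> s" and \<mu>: "\<mu> \<le> h * (s + 1)"
    and oddS: "odd (card S)" and h: "2 \<le> h" and g: "2 * h \<le> g" "5 \<le> g"
    and girth: "cyc (\<lambda>u v. u \<in> S \<and> v \<in> S \<and> 0 < x u v) vs \<Longrightarrow> g \<le> length vs"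
    and connected: "u \<in> S \<Longrightarrow> v \<in> S \<Longrightarrow> (\<lambda>u v. u \<in> S \<and> v \<in> S \<and> 0 < x u v)\<^sup>*\<^sup>* u v"
begin

definition adj :: "'v \<Rightarrow> 'v \<Rightarrow> bool" where
  "adj = (\<lambda>u v. u \<in> S \<and> v \<in> S \<and> 0 < x u v)"

definition N :: "'v \<Rightarrow> 'v set" where
  "N v = {u. adj v u}"

lemma adj_sym: "adj u v \<Longrightarrow> adj v u"
  using sym by (auto simp: adj_def)

lemma adj_S: "adj u v \<Longrightarrow> u \<in> S \<and> v \<in> S"
  by (simp add: adj_def)

lemma adj_irr: "\<not> adj u u"
  using irr by (auto simp: adj_def)

lemma N_S: "N v \<subseteq> S" by (auto simp: N_def adj_def)

lemma finite_N [simp]: "finite (N v)" using fin N_S finite_subset by blast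

lemma in_N: "u \<in> N v \<longleftrightarrow> adj v u" by (simp add: N_def)

lemma in_N_sym: "u \<in> N v \<longleftrightarrow> v \<in> N u" using adj_sym by (auto simp: N_def)

lemma cyc_girth: "cyc adj vs \<Longrightarrow> g \<le> length vs"
  unfolding adj_def by (rule girth)

lemma successively_adj_rev: "successively adj (rev xs) \<longleftrightarrow> successively adj xs"
proof -
  have eq: "(\<lambda>u v. adj v u) = adj" using adj_sym by blast
  show ?thesis unfolding successively_rev eq ..
qed

abbreviation "p \<equiv> card S"

section \<open>Expansion from weighted degree sums\<close>

lemma M_ge: "p * s + 2 \<le> M"
  using sum_m sum_mono[of S "\<lambda>_. s" m] m_ge by simp

text \<open>The weights leaving \<open>I\<close> outside \<open>Z\<close> are at least the difference of the weighted
  degree sums of \<open>I\<close> and \<open>Z\<close>; the worst case for the comparison with \<open>\<mu>\<close> is \<open>s = 1\<close>.\<close>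

lemma expansion_aux:
  assumes I: "I \<subseteq> S" and Z: "Z \<subseteq> S" and IZ: "I \<inter> Z = {}" and c: "card Z < card I"
  shows "int ((p + 1) * (card I - card Z) * (s + 1)) + 2 * int (\<Sum>z\<in>Z. \<Sum>u\<in>S - I. x z u)
    \<le> int (2 * h * (\<Sum>i\<in>I. card (N i - Z)) * (s + 1))"
proof -
  define X where "X = (\<Sum>i\<in>I. \<Sum>u\<in>S - Z. x i u)"
  define Y where "Y = (\<Sum>i\<in>I. \<Sum>u\<in>Z. x i u)"
  define V where "V = (\<Sum>z\<in>Z. \<Sum>u\<in>S - I. x z u)"
  define e where "e = (\<Sum>i\<in>I. card (N i - Z))"
  define j where "j = int (card I) - int (card Z)"
  have fins: "finite I" "finite Z" using I Z fin finite_subset by blast+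
  have DI: "X + Y + (\<Sum>i\<in>I. m i) = card I * M"
  proof -
    have "X + Y + (\<Sum>i\<in>I. m i) = (\<Sum>i\<in>I. (\<Sum>u\<in>S - Z. x i u) + (\<Sum>u\<in>Z. x i u) + m i)"
      by (simp add: X_def Y_def sum.distrib)
    also have "\<dots> = (\<Sum>i\<in>I. M)"
    proof (rule sum.cong[OF refl])
      fix i assume "i \<in> I"
      then show "(\<Sum>u\<in>S - Z. x i u) + (\<Sum>u\<in>Z. x i u) + m i = M"
        using I deg[of i] sum.subset_diff[OF Z fin, of "x i"] by auto
    qed
    finally show ?thesis by simp
  qed
  have DZ: "V + Y + (\<Sum>z\<in>Z. m z) = card Z * M"
  proof -
    have "Y = (\<Sum>z\<in>Z. \<Sum>u\<in>I. x z u)"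
      unfolding Y_def by (subst sum.swap) (simp add: sym)
    then have "V + Y + (\<Sum>z\<in>Z. m z) = (\<Sum>z\<in>Z. (\<Sum>u\<in>S - I. x z u) + (\<Sum>u\<in>I. x z u) + m z)"
      by (simp add: V_def sum.distrib)
    also have "\<dots> = (\<Sum>i\<in>Z. M)"
    proof (rule sum.cong[OF refl])
      fix z assume "z \<in> Z"
      then show "(\<Sum>u\<in>S - I. x z u) + (\<Sum>u\<in>I. x z u) + m z = M"
        using Z deg[of z] sum.subset_diff[OF I fin, of "x z"] by auto
    qed
    finally show ?thesis by simp
  qed
  \<comment> \<open>The vertices outside \<open>I\<close> and \<open>Z\<close> take at least
    \<open>s\<close> each out of the sum \<open>M - 2\<close>; this limits how much \<open>m\<close>
    can lower the weighted degrees on \<open>I\<close>.\<close>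
  have mS: "(\<Sum>i\<in>I. m i) + (\<Sum>z\<in>Z. m z) + (p - card I - card Z) * s + 2 \<le> M"
  proof -
    have "(\<Sum>v\<in>S. m v) = (\<Sum>v\<in>S - (I \<union> Z). m v) + (\<Sum>v\<in>I \<union> Z. m v)"
      using I Z fin by (intro sum.subset_diff) auto
    moreover have "(\<Sum>v\<in>I \<union> Z. m v) = (\<Sum>i\<in>I. m i) + (\<Sum>z\<in>Z. m z)"
      by (rule sum.union_disjoint[OF fins IZ])
    moreover have "card (S - (I \<union> Z)) = p - card I - card Z"
      using I Z fins IZ by (simp add: card_Diff_subset card_Un_disjoint)
    then have "(p - card I - card Z) * s \<le> (\<Sum>v\<in>S - (I \<union> Z). m v)"
      using sum_mono[of "S - (I \<union> Z)" "\<lambda>_. s" m] m_ge by simp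
    ultimately show ?thesis using sum_m by simp
  qed
  have pIZ: "card I + card Z \<le> p"
    using card_mono[OF fin, of "I \<union> Z"] I Z card_Un_disjoint[OF fins IZ] by simp
  have Zs: "card Z * s \<le> (\<Sum>z\<in>Z. m z)" using sum_mono[of Z "\<lambda>_. s" m] m_ge Z by auto
  have Xe: "X \<le> \<mu> * e"
  proof -
    have "(\<Sum>u\<in>S - Z. x i u) \<le> \<mu> * card (N i - Z)" if "i \<in> I" for i
    proof -
      have "(\<Sum>u\<in>S - Z. x i u) = (\<Sum>u\<in>N i - Z. x i u)"
        using that I fin by (intro sum.mono_neutral_right) (auto simp: N_def adj_def)
      also have "\<dots> \<le> card (N i - Z) * \<mu>" using sum_mono[of "N i - Z" "x i" "\<lambda>_. \<mu>"] x_le by simp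
      finally show ?thesis by (simp add: mult.commute)
    qed
    then show ?thesis unfolding X_def e_def sum_distrib_left by (rule sum_mono)
  qed
  have j1: "1 \<le> j" using c by (simp add: j_def)
  have "int X + int Y + int (\<Sum>i\<in>I. m i) = int (card I) * int M"
    using DI by (metis of_nat_add of_nat_mult)
  moreover have "int V + int Y + int (\<Sum>z\<in>Z. m z) = int (card Z) * int M"
    using DZ by (metis of_nat_add of_nat_mult)
  ultimately have "int X = j * int M - int (\<Sum>i\<in>I. m i) + int (\<Sum>z\<in>Z. m z) + int V"
    unfolding j_def by (simp add: algebra_simps)
  moreover have "int (\<Sum>i\<in>I. m i) + int (\<Sum>z\<in>Z. m z) + (int p - int (card I) - int (card Z)) * int s + 2 \<le> int M"
  proof -
    have "int ((p - card I - card Z) * s) = (int p - int (card I) - int (card Z)) * int s"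
      using pIZ by (simp add: of_nat_diff)
    then show ?thesis using mS by linarith
  qed
  moreover have "int (card Z) * int s \<le> int (\<Sum>z\<in>Z. m z)" using Zs by (metis of_nat_le_iff of_nat_mult)
  ultimately have X1: "(j - 1) * int M + 2 + (int p - j) * int s + int V \<le> int X"
    unfolding j_def by (simp add: algebra_simps)
  have "(j - 1) * (int p * int s + 2) \<le> (j - 1) * int M"
    using M_ge j1 by (intro mult_left_mono) (auto simp flip: of_nat_mult of_nat_add)
  with X1 have X2: "j * ((int p - 1) * int s + 2) + int V \<le> int X" by (simp add: algebra_simps)
  have "3 \<le> p"
  proof -
    have "p \<noteq> 1"
    proof
      assume "p = 1"
      then obtain v where "S = {v}" by (meson card_1_singletonE)
      then show False using deg[of v] sum_m irr[of v] by simp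
    qed
    then show ?thesis using oddS by presburger
  qed
  \<comment> \<open>The product is exactly the difference of the two sides of the next
    inequality.\<close>
  then have "0 \<le> (int p - 3) * (int s - 1)" using s by simp
  then have "(int p + 1) * (int s + 1) \<le> 2 * ((int p - 1) * int s + 2)" by (simp add: algebra_simps)
  then have "j * ((int p + 1) * (int s + 1)) \<le> j * (2 * ((int p - 1) * int s + 2))"
    using j1 by (intro mult_left_mono) auto
  then have X3: "j * ((int p + 1) * (int s + 1)) + 2 * int V \<le> 2 * int X" using X2 by linarith
  have "X \<le> h * (s + 1) * e" using Xe \<mu> by (meson le_trans mult_le_mono1)
  then have "2 * int X \<le> int (2 * h * e * (s + 1))" by (simp add: algebra_simps flip: of_nat_mult of_nat_add)
  moreover have "int ((p + 1) * (card I - card Z) * (s + 1)) = j * ((int p + 1) * (int s + 1))"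
  proof -
    have "int (card I - card Z) = j" unfolding j_def using c by simp
    then show ?thesis unfolding of_nat_mult by (simp add: add.commute)
  qed
  ultimately show ?thesis using X3 unfolding V_def e_def by linarith
qed

lemma expansion:
  assumes "I \<subseteq> S" "Z \<subseteq> S" "I \<inter> Z = {}" "card Z < card I"
  shows "(p + 1) * (card I - card Z) \<le> 2 * h * (\<Sum>i\<in>I. card (N i - Z))"
proof -
  have "(p + 1) * (card I - card Z) * (s + 1) \<le> 2 * h * (\<Sum>i\<in>I. card (N i - Z)) * (s + 1)"
    using expansion_aux[OF assms] by linarith
  then show ?thesis unfolding mult_le_cancel2 by simp
qed

text \<open>The edge from \<open>z\<close> to \<open>u\<close> contributes to the weight leaving
  \<open>Z\<close> for vertices outside \<open>I\<close>, a term that \<open>expansion\<close>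
  throws away.\<close>

lemma expansion_strict:
  assumes "I \<subseteq> S" "Z \<subseteq> S" "I \<inter> Z = {}" "card Z < card I" and z: "z \<in> Z" "u \<notin> I" "adj z u"
  shows "(p + 1) * (card I - card Z) < 2 * h * (\<Sum>i\<in>I. card (N i - Z))"
proof -
  have "finite Z" using assms fin finite_subset by blast
  have "0 < x z u" "u \<in> S" using z by (auto simp: adj_def)
  then have "0 < (\<Sum>u\<in>S - I. x z u)" using fin z(2) by (intro sum_pos2[of _ u]) auto
  then have "0 < (\<Sum>z\<in>Z. \<Sum>u\<in>S - I. x z u)" 
    by (rule sum_pos2[OF \<open>finite Z\<close> z(1)]) simp
  then have "(p + 1) * (card I - card Z) * (s + 1) < 2 * h * (\<Sum>i\<in>I. card (N i - Z)) * (s + 1)"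
    using expansion_aux[OF assms(1-4)] by linarith
  then show ?thesis unfolding mult_less_cancel2 by simp
qed

lemma degree_bound: "v \<in> S \<Longrightarrow> p + 1 \<le> 2 * h * card (N v)"
  using expansion[of "{v}" "{}"] by simp

text \<open>Without odd cycles the parity of walks from a fixed vertex would split \<open>S\<close>
  into two sides, which \<open>weights_not_bipartite\<close> forbids.\<close>

lemma ex_odd_cycle: "\<exists>vs. cyc adj vs \<and> odd (length vs)"
proof (rule ccontr)
  assume none: "\<nexists>vs. cyc adj vs \<and> odd (length vs)"
  have no_walk: False if "xs \<noteq> []" "successively adj xs" "hd xs = last xs" "even (length xs)" for xs
    using odd_cycle_exists[of adj xs] adj_sym adj_irr that none by blast
  obtain b where b: "b \<in> S" using oddS by (metis card.empty ex_in_conv even_zero)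
  define wk where "wk = (\<lambda>v xs. xs \<noteq> [] \<and> successively adj xs \<and> hd xs = b \<and> last xs = v)"
  define A where "A = {v \<in> S. \<exists>xs. wk v xs \<and> odd (length xs)}"
  have walk: "\<exists>xs. wk v xs" if "v \<in> S" for v
    using rtranclp_distinct_path[OF connected[OF b that, folded adj_def]] unfolding wk_def by blast
  have "(u \<in> A) \<noteq> (v \<in> A)" if uv: "adj u v" for u v
  proof
    assume eq: "(u \<in> A) = (v \<in> A)"
    show False
    proof (cases "u \<in> A")
      case True
      then obtain xs ys where xs: "wk u xs" "odd (length xs)" and ys: "wk v ys" "odd (length ys)"
        using eq by (auto simp: A_def)
      show False
        using no_walk[of "xs @ rev ys"] xs ys uv unfolding wk_def
        by (auto simp: successively_append_iff successively_adj_rev hd_rev last_rev simp del: successively_rev)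
    next
      case False
      obtain xs where xs: "wk u xs" using walk adj_S uv by blast
      then have "even (length xs)" using False adj_S uv by (auto simp: A_def)
      then have "wk v (xs @ [v]) \<and> odd (length (xs @ [v]))"
        using xs uv by (auto simp: wk_def successively_append_iff)
      then have "v \<in> A" using adj_S[OF uv] unfolding A_def by blast
      then show False using eq False by simp
    qed
  qed
  then show False
    using weights_not_bipartite[OF fin sym deg sum_m oddS, of A] unfolding adj_def A_def by blast
qed

section \<open>Shortest odd cycles\<close>

definition odd_min :: "'v list \<Rightarrow> bool" where
  "odd_min cs \<longleftrightarrow> cyc adj cs \<and> odd (length cs) \<and>
     (\<forall>vs. cyc adj vs \<and> odd (length vs) \<longrightarrow> length cs \<le> length vs)"

lemma ex_odd_min: "\<exists>cs. odd_min cs"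
  using ex_odd_cycle ex_has_least_nat[of "\<lambda>vs. cyc adj vs \<and> odd (length vs)" _ length]
  unfolding odd_min_def by metis

lemma odd_min_rotate: "odd_min cs \<Longrightarrow> odd_min (rotate i cs)"
  using cyc_rotate by (auto simp: odd_min_def)


text \<open>A path outside a shortest odd cycle \<open>cs\<close> that joins two of its vertices closes up with either
  of the two arcs between them, and exactly one of these two cycles is odd.\<close>

lemma attach:
  assumes cs: "odd_min cs" and zs: "zs \<noteq> []" "distinct zs" "set zs \<inter> set cs = {}" "successively adj zs"
    and i: "i < length cs" "adj (hd zs) (cs ! i)" and a: "a < length cs" "adj (last zs) (cs ! ((i + a) mod length cs))"
    and nontriv: "0 < a \<or> 2 \<le> length zs"
  shows "g \<le> length zs + 1 + a"
    and "odd (length zs + 1 + a) \<Longrightarrow> length cs \<le> length zs + 1 + a"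
    and "0 < a \<Longrightarrow> g \<le> length zs + 1 + (length cs - a)"
    and "0 < a \<Longrightarrow> even (length zs + 1 + a) \<Longrightarrow> a \<le> length zs + 1"
proof -
  define ds where "ds = rotate i cs"
  have ds: "odd_min ds" "length ds = length cs" "set ds = set cs"
    using odd_min_rotate[OF cs] by (auto simp: ds_def)
  have c: "cyc adj ds" "distinct ds" "successively adj ds" "adj (last ds) (hd ds)" "3 \<le> length ds"
    using ds(1) by (auto simp: odd_min_def cyc_def)
  have ne: "ds \<noteq> []" using c(5) by auto
  have nth_ds: "ds ! b = cs ! ((i + b) mod length cs)" if "b < length cs" for b
    unfolding ds_def using that by (rule nth_rotate)
  have "0 < length cs" using c(5) ds(2) by linarith
  then have "ds ! 0 = cs ! i" using nth_ds[of 0] i(1) by simp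
  then have d0: "adj (hd zs) (hd ds)" using i ne by (simp add: hd_conv_nth)
  have da: "adj (last zs) (ds ! a)" using a nth_ds[of a] by simp
  have odd: "odd (length ds)" using ds by (simp add: odd_min_def)
  have "cyc adj (take (Suc a) ds @ rev zs)"
  proof -
    have "last (take (Suc a) ds) = ds ! a" using a ds(2) by (simp add: take_Suc_conv_app_nth)
    then have "successively adj (take (Suc a) ds @ rev zs)"
      using c(3) zs da adj_sym ne
      by (auto simp: successively_append_iff successively_adj_rev hd_rev simp del: successively_rev
          intro!: successively_append_iff[of _ "take (Suc a) ds" "drop (Suc a) ds", THEN iffD1, THEN conjunct1])
    moreover have "distinct (take (Suc a) ds @ rev zs)"
      using c(2) zs(2,3) ds(3) set_take_subset[of "Suc a" ds] by auto
    moreover have "adj (last (take (Suc a) ds @ rev zs)) (hd (take (Suc a) ds @ rev zs))"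
      using d0 zs(1) ne by (simp add: last_rev hd_append)
    moreover have "3 \<le> length (take (Suc a) ds @ rev zs)"
      using nontriv zs(1) a ds(2) by (cases zs) auto
    ultimately show ?thesis by (simp add: cyc_def)
  qed
  moreover have "length (take (Suc a) ds @ rev zs) = length zs + 1 + a" using a ds(2) by simp
  ultimately show "g \<le> length zs + 1 + a"
    "odd (length zs + 1 + a) \<Longrightarrow> length cs \<le> length zs + 1 + a"
    using cyc_girth[of "take (Suc a) ds @ rev zs"] ds(1,2) unfolding odd_min_def by metis+
  assume a0: "0 < a"
  have "cyc adj (drop a ds @ hd ds # zs)"
  proof -
    have dne: "drop a ds \<noteq> []" using a ds(2) by simp
    have "successively adj (take a ds @ drop a ds)" using c(3) by simp
    then have "successively adj (drop a ds)" unfolding successively_append_iff by blast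
    then have "successively adj (drop a ds @ hd ds # zs)"
      using zs d0 adj_sym dne c(4) by (auto simp: successively_append_iff successively_Cons)
    moreover have "distinct (drop a ds @ hd ds # zs)"
    proof -
      have "hd ds \<notin> set (drop a ds)"
      proof -
        have "hd ds \<in> set (take a ds)" using a0 ne by (cases ds; cases a) auto
        then show ?thesis using c(2) set_take_disj_set_drop_if_distinct[of ds a a] by blast
      qed
      then show ?thesis using c(2) zs(2,3) ds(3) set_drop_subset[of a ds] ne by (auto dest: hd_in_set)
    qed
    moreover have "adj (last (drop a ds @ hd ds # zs)) (hd (drop a ds @ hd ds # zs))"
      using da zs(1) dne a ds(2) by (simp add: hd_drop_conv_nth)
    moreover have "3 \<le> length (drop a ds @ hd ds # zs)"
      using zs(1) dne by (cases zs; cases "drop a ds") auto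
    ultimately show ?thesis by (simp add: cyc_def)
  qed
  moreover have len: "length (drop a ds @ hd ds # zs) = length zs + 1 + (length cs - a)" using a ds(2) by simp
  ultimately show "g \<le> length zs + 1 + (length cs - a)"
    using cyc_girth[of "drop a ds @ hd ds # zs"] by metis
  assume "even (length zs + 1 + a)"
  then have "odd (length zs + 1 + (length cs - a))" using odd a ds(2) by auto
  then have "length cs \<le> length zs + 1 + (length cs - a)"
    using \<open>cyc adj (drop a ds @ hd ds # zs)\<close> len ds(1,2) unfolding odd_min_def by metis
  then show "a \<le> length zs + 1" using a by simp
qed

text \<open>A chord cuts the cycle into two cycles whose lengths add up to
  \<open>length cs + 2\<close>. One of them is odd, and it is shorter than
  \<open>cs\<close>.\<close>

lemma chordless:
  assumes cs: "odd_min cs" and "i < length cs" "a < length cs" "adj (cs ! i) (cs ! ((i + a) mod length cs))"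
  shows "a = 1 \<or> a = length cs - 1"
proof (rule ccontr)
  assume *: "\<not> (a = 1 \<or> a = length cs - 1)"
  define ds where "ds = rotate i cs"
  have ds: "odd_min ds" "length ds = length cs" using odd_min_rotate[OF cs] by (auto simp: ds_def)
  have c: "cyc adj ds" "distinct ds" "successively adj ds" "adj (last ds) (hd ds)" "3 \<le> length ds"
    using ds(1) by (auto simp: odd_min_def cyc_def)
  have ne: "ds \<noteq> []" using c(5) by auto
  have nth_ds: "ds ! b = cs ! ((i + b) mod length cs)" if "b < length cs" for b
    unfolding ds_def using that by (rule nth_rotate)
  have "0 < length cs" using c(5) ds(2) by linarith
  then have "ds ! 0 = cs ! i" using nth_ds[of 0] assms(2) by simp
  then have d0: "adj (hd ds) (ds ! a)" using assms(3,4) ne nth_ds[of a] by (simp add: hd_conv_nth)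
  have "a \<noteq> 0" using d0 adj_irr ne by (metis hd_conv_nth)
  then have a: "2 \<le> a" "a + 2 \<le> length ds" using * assms(3) ds(2) by linarith+
  have "successively adj (take (Suc a) ds @ drop (Suc a) ds)" "successively adj (take a ds @ drop a ds)"
    using c(3) by simp_all
  then have suc: "successively adj (take (Suc a) ds)" "successively adj (drop a ds)"
    unfolding successively_append_iff by blast+
  have "last (take (Suc a) ds) = ds ! a" using a by (simp add: take_Suc_conv_app_nth)
  then have c1: "cyc adj (take (Suc a) ds)"
    using suc c(2) d0 a adj_sym ne by (auto simp: cyc_def)
  have "hd ds \<in> set (take a ds)" using a ne by (cases ds; cases a) auto
  then have "hd ds \<notin> set (drop a ds)" using c(2) set_take_disj_set_drop_if_distinct[of ds a a] by blast
  then have c2: "cyc adj (drop a ds @ [hd ds])"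
    using suc c(2,4) d0 a ne by (auto simp: cyc_def successively_append_iff hd_drop_conv_nth)
  have "odd (length ds)" using ds by (simp add: odd_min_def)
  then have "odd (length (take (Suc a) ds)) \<or> odd (length (drop a ds @ [hd ds]))"
    using a by auto
  then have "length ds \<le> length (take (Suc a) ds) \<or> length ds \<le> length (drop a ds @ [hd ds])"
    using c1 c2 ds(1) unfolding odd_min_def by blast
  then show False using a by auto
qed

lemma no_triangle: "adj u v \<Longrightarrow> adj v w \<Longrightarrow> adj w u \<Longrightarrow> False"
  using cyc_girth[of "[u, v, w]"] g adj_irr by (auto simp: cyc_def)

lemma no_square: "adj a b \<Longrightarrow> adj b c \<Longrightarrow> adj c d \<Longrightarrow> adj d a \<Longrightarrow> a \<noteq> c \<Longrightarrow> b \<noteq> d \<Longrightarrow> False"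
  using cyc_girth[of "[a, b, c, d]"] g adj_irr by (auto simp: cyc_def)

end

section \<open>Vertices off a shortest odd cycle\<close>

locale ring_weights_cycle = ring_weights +
  fixes cs :: "'a list"
  assumes cs: "odd_min cs"
begin

abbreviation "n \<equiv> length cs"
abbreviation "W \<equiv> S - set cs"

lemma n_odd: "odd n" and n_ge: "2 * h + 1 \<le> n" and n5: "5 \<le> n"
proof -
  show o: "odd n" using cs by (simp add: odd_min_def)
  have "g \<le> n" using cs cyc_girth by (simp add: odd_min_def)
  then show "2 * h + 1 \<le> n" "5 \<le> n" using g o by presburger+
qed

lemma mod_n [simp]: "i mod n < n" using n5 by (intro mod_less_divisor) auto

lemma cs_distinct: "distinct cs" using cs by (simp add: odd_min_def cyc_def)

lemma cs_adj: "i < n \<Longrightarrow> adj (cs ! i) (cs ! ((i + 1) mod n))"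
proof (cases "i + 1 < n")
  case True
  then show ?thesis using cs by (auto simp: odd_min_def cyc_def intro: successively_nth)
next
  case False
  assume "i < n"
  then have "i + 1 = n" using False by simp
  then have "cs ! i = last cs" "cs ! ((i + 1) mod n) = hd cs" "cs \<noteq> []"
    by (auto simp: last_conv_nth hd_conv_nth)
      (metis \<open>i + 1 = n\<close> add_diff_cancel_right' last_conv_nth list.size(3) add_is_0 one_neq_zero,
       metis hd_conv_nth list.size(3) add_is_0 one_neq_zero \<open>i + 1 = n\<close> mod_self)
  then show ?thesis using cs by (simp add: odd_min_def cyc_def)
qed

lemma cs_S: "set cs \<subseteq> S"
proof
  fix v assume "v \<in> set cs"
  then obtain i where "i < n" "v = cs ! i" by (auto simp: in_set_conv_nth)
  then show "v \<in> S" using cs_adj[of i] adj_S by auto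
qed

lemma p_split: "p = n + card W"
proof -
  have "card (set cs) = n" using cs_distinct by (rule distinct_card)
  then show ?thesis using card_Diff_subset[OF _ cs_S] card_mono[OF fin cs_S] by simp
qed

lemma deg_ge2: "v \<in> S \<Longrightarrow> 2 \<le> card (N v)"
proof (rule ccontr)
  assume v: "v \<in> S" "\<not> 2 \<le> card (N v)"
  then have "2 * h * card (N v) \<le> 2 * h * 1" by (intro mult_left_mono) auto
  then show False using degree_bound[OF v(1)] p_split n_ge by linarith
qed

lemma shift_ex:
  assumes "i < n" "j < n"
  obtains a where "a < n" "j = (i + a) mod n"
proof
  show "(j + n - i) mod n < n" using assms by simp
  show "j = (i + (j + n - i) mod n) mod n" using assms by (simp add: mod_add_right_eq)
qed

text \<open>Two neighbours on \<open>cs\<close> close two cycles through \<open>w\<close>, of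
  lengths adding up to \<open>n + 4\<close>. The odd one has length at least \<open>n\<close>, so
  the other has length at most 4, below the girth.\<close>

lemma W_unique:
  assumes "w \<in> W" "adj w c" "adj w d" "c \<in> set cs" "d \<in> set cs"
  shows "c = d"
proof (rule ccontr)
  assume "c \<noteq> d"
  obtain i j where i: "i < n" "c = cs ! i" and j: "j < n" "d = cs ! j"
    using assms(4,5) by (auto simp: in_set_conv_nth)
  obtain a where a: "a < n" "j = (i + a) mod n" using shift_ex i j by metis
  have a0: "0 < a" using a i j \<open>c \<noteq> d\<close> by (cases a) auto
  note at = attach[OF cs, of "[w]" i a]
  show False
  proof (cases "odd a")
    case True
    then show False using at(2,3) assms i j a a0 g by auto
  next
    case False
    then show False using at(1,4) assms i j a a0 g by auto
  qed
qed

lemma N_cs: "i < n \<Longrightarrow> N (cs ! i) \<inter> set cs = {cs ! ((i + 1) mod n), cs ! ((i + (n - 1)) mod n)}"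
proof
  assume i: "i < n"
  show "N (cs ! i) \<inter> set cs \<subseteq> {cs ! ((i + 1) mod n), cs ! ((i + (n - 1)) mod n)}"
  proof
    fix v assume "v \<in> N (cs ! i) \<inter> set cs"
    then obtain j where j: "j < n" "adj (cs ! i) (cs ! j)" "v = cs ! j" by (auto simp: in_set_conv_nth in_N)
    obtain a where a: "a < n" "j = (i + a) mod n" using shift_ex i j(1) by metis
    then show "v \<in> {cs ! ((i + 1) mod n), cs ! ((i + (n - 1)) mod n)}"
      using chordless[OF cs i a(1)] j by auto
  qed
  have "adj (cs ! ((i + (n - 1)) mod n)) (cs ! (((i + (n - 1)) mod n + 1) mod n))"
    using i by (intro cs_adj) auto
  moreover have "((i + (n - 1)) mod n + 1) mod n = (i + (n - 1) + 1) mod n" by (rule mod_add_left_eq)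
  moreover have "i + (n - 1) + 1 = i + n" "(i + n) mod n = i" using i by simp_all
  ultimately have "adj (cs ! i) (cs ! ((i + (n - 1)) mod n))" using adj_sym by metis
  then show "{cs ! ((i + 1) mod n), cs ! ((i + (n - 1)) mod n)} \<subseteq> N (cs ! i) \<inter> set cs"
    using cs_adj[OF i] i by (auto simp: in_N)
qed

lemma cs_neighbours_distinct: "i < n \<Longrightarrow> cs ! ((i + 1) mod n) \<noteq> cs ! ((i + (n - 1)) mod n)"
proof
  assume i: "i < n" and eq: "cs ! ((i + 1) mod n) = cs ! ((i + (n - 1)) mod n)"
  then have "(i + 1) mod n = (i + (n - 1)) mod n"
    using cs_distinct i by (subst (asm) nth_eq_iff_index_eq) auto
  moreover have "(i + 1) mod n = (if i + 1 = n then 0 else i + 1)" using i by simp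
  moreover have "(i + (n - 1)) mod n = (if i = 0 then n - 1 else i - 1)"
    using i by (cases i) (auto simp: mod_if)
  ultimately show False using i n5 by (auto split: if_splits)
qed

lemma card_N_cs: "c \<in> set cs \<Longrightarrow> card (N c) = 2 + card (N c - set cs)"
proof -
  assume "c \<in> set cs"
  then obtain i where i: "i < n" "c = cs ! i" by (auto simp: in_set_conv_nth)
  have "card (N c \<inter> set cs) = 2" using N_cs[OF i(1)] cs_neighbours_distinct[OF i(1)] i(2) by simp
  moreover have "card (N c) = card (N c \<inter> set cs) + card (N c - set cs)"
    using card_Int_Diff[of "N c" "set cs"] by simp
  ultimately show ?thesis by simp
qed


section \<open>Components and paths off the cycle\<close>

definition Wreach :: "'a \<Rightarrow> 'a set" where
  "Wreach w = {u. (\<lambda>u v. adj u v \<and> u \<in> W \<and> v \<in> W)\<^sup>*\<^sup>* w u}"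

lemma Wreach_refl: "w \<in> Wreach w" by (simp add: Wreach_def)

lemma Wreach_W: "w \<in> W \<Longrightarrow> Wreach w \<subseteq> W"
proof
  fix u assume "w \<in> W" "u \<in> Wreach w"
  from this(2) have "(\<lambda>u v. adj u v \<and> u \<in> W \<and> v \<in> W)\<^sup>*\<^sup>* w u" by (simp add: Wreach_def)
  then show "u \<in> W" using \<open>w \<in> W\<close> by (induction rule: rtranclp_induct) auto
qed

lemma Wreach_step: "u \<in> Wreach w \<Longrightarrow> adj u v \<Longrightarrow> u \<in> W \<Longrightarrow> v \<in> W \<Longrightarrow> v \<in> Wreach w"
  unfolding Wreach_def by (auto intro: rtranclp.rtrancl_into_rtrancl)

lemma Wreach_sym: "u \<in> Wreach w \<Longrightarrow> w \<in> Wreach u"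
  unfolding Wreach_def mem_Collect_eq by (rule rtranclp_symmetric[rotated]) (auto intro: adj_sym)

lemma Wreach_trans: "u \<in> Wreach w \<Longrightarrow> v \<in> Wreach u \<Longrightarrow> v \<in> Wreach w"
  unfolding Wreach_def by (auto intro: rtranclp_trans)

definition Wpath :: "'a list \<Rightarrow> bool" where
  "Wpath zs \<longleftrightarrow> zs \<noteq> [] \<and> distinct zs \<and> set zs \<subseteq> W \<and> successively adj zs"

lemma Wpath_length: "Wpath zs \<Longrightarrow> length zs \<le> card W"
  using card_mono[of W "set zs"] fin by (auto simp: Wpath_def distinct_card)

lemma Wpath_rev: "Wpath zs \<Longrightarrow> Wpath (rev zs)"
  by (auto simp: Wpath_def successively_adj_rev simp del: successively_rev)

lemma Wreach_path:
  assumes "w \<in> W" "u \<in> Wreach w"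
  shows "\<exists>zs. Wpath zs \<and> set zs \<subseteq> Wreach w \<and> hd zs = w \<and> last zs = u"
proof -
  let ?R = "\<lambda>u v. adj u v \<and> u \<in> W \<and> v \<in> W"
  obtain zs where zs: "zs \<noteq> []" "hd zs = w" "last zs = u" "distinct zs" "successively ?R zs"
    using rtranclp_distinct_path[of ?R w u] assms(2) unfolding Wreach_def by auto
  have suc: "successively adj zs" using zs(5) by (rule successively_mono) auto
  have "v \<in> Wreach w" if v: "v \<in> set zs" for v
  proof -
    obtain i where i: "i < length zs" "v = zs ! i" using v by (auto simp: in_set_conv_nth)
    have "zs ! i \<in> Wreach w" using i(1)
    proof (induction i)
      case 0
      then show ?case using zs(1,2) by (simp add: hd_conv_nth Wreach_refl)
    next
      case (Suc i)
      then show ?case using successively_nth[OF zs(5), of i] Wreach_step by auto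
    qed
    then show ?thesis using i by simp
  qed
  then show ?thesis using zs suc Wreach_W[OF assms(1)] by (intro exI[of _ zs]) (auto simp: Wpath_def)
qed

lemma attachW:
  assumes zs: "Wpath zs" and "i < n" "adj (hd zs) (cs ! i)" and "a < n" "adj (last zs) (cs ! ((i + a) mod n))"
    and "0 < a \<or> 2 \<le> length zs"
  shows "g \<le> length zs + 1 + a"
    and "odd (length zs + 1 + a) \<Longrightarrow> n \<le> length zs + 1 + a"
    and "0 < a \<Longrightarrow> g \<le> length zs + 1 + (n - a)"
    and "0 < a \<Longrightarrow> even (length zs + 1 + a) \<Longrightarrow> a \<le> length zs + 1"
  using attach[OF cs, of zs i a] assms unfolding Wpath_def by blast+

text \<open>By maximality all neighbours of the end in \<open>W\<close> lie on the path, and all but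
  the next vertex would close a cycle of at most \<open>card W\<close> vertices, fewer than the
  girth. Together with at most one neighbour on \<open>cs\<close> this leaves exactly one of each
  kind, since degrees are at least 2.\<close>

lemma W_endpoint:
  assumes small: "card W < 2 * h" and zs: "Wpath zs" "set zs \<subseteq> Wreach w" "w \<in> W"
    and longest: "\<And>ys. Wpath ys \<Longrightarrow> set ys \<subseteq> Wreach w \<Longrightarrow> length ys \<le> length zs"
  shows "2 \<le> length zs \<and> card (N (hd zs)) = 2 \<and> (\<exists>c\<in>set cs. adj (hd zs) c)"
proof -
  have z: "zs \<noteq> []" "distinct zs" "set zs \<subseteq> W" "successively adj zs" using zs by (auto simp: Wpath_def)
  have hW: "hd zs \<in> W" using z(3) hd_in_set[OF z(1)] by blast
  have "u = zs ! 1 \<and> 2 \<le> length zs" if u: "u \<in> N (hd zs) \<inter> W" for u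
  proof -
    have adj: "adj (hd zs) u" "u \<in> W" using u by (auto simp: in_N)
    have "u \<in> set zs"
    proof (rule ccontr)
      assume "u \<notin> set zs"
      then have "Wpath (u # zs)" using z adj adj_sym by (auto simp: Wpath_def successively_Cons)
      moreover have "u \<in> Wreach w" using Wreach_step[OF _ adj(1) hW adj(2), of w] hd_in_set[OF z(1)] zs(2) by blast
      ultimately show False using longest[of "u # zs"] zs(2) by simp
    qed
    then obtain j where j: "j < length zs" "u = zs ! j" by (auto simp: in_set_conv_nth)
    have "j \<noteq> 0" using adj adj_irr j z(1) by (metis hd_conv_nth)
    moreover have "\<not> 2 \<le> j"
    proof
      assume j2: "2 \<le> j"
      have "successively adj (take (Suc j) zs @ drop (Suc j) zs)" using z by simp
      then have "successively adj (take (Suc j) zs)" unfolding successively_append_iff by blast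
      moreover have "last (take (Suc j) zs) = u" using j by (simp add: take_Suc_conv_app_nth)
      ultimately have "cyc adj (take (Suc j) zs)"
        using z j j2 adj adj_sym by (auto simp: cyc_def)
      then have "g \<le> length (take (Suc j) zs)" by (rule cyc_girth)
      then show False using Wpath_length[OF zs(1)] small g by simp
    qed
    ultimately have "j = 1" by simp
    then show ?thesis using j by simp
  qed
  then have NW: "N (hd zs) \<inter> W \<subseteq> (if 2 \<le> length zs then {zs ! 1} else {})" by auto
  then have cW: "card (N (hd zs) \<inter> W) \<le> (if 2 \<le> length zs then 1 else 0)"
    using card_mono[OF _ NW] by (auto split: if_splits)
  have NC: "card (N (hd zs) \<inter> set cs) \<le> 1"
    using W_unique[OF hW] by (subst card_le_Suc0_iff_eq[unfolded One_nat_def[symmetric]]) (auto simp: in_N)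
  have "N (hd zs) - set cs = N (hd zs) \<inter> W" using N_S by auto
  then have tot: "card (N (hd zs)) = card (N (hd zs) \<inter> W) + card (N (hd zs) \<inter> set cs)"
    using card_Int_Diff[of "N (hd zs)" "set cs"] by simp
  have two: "2 \<le> card (N (hd zs))" using deg_ge2 hW by simp
  have l2: "2 \<le> length zs" using tot two cW NC by (auto split: if_splits)
  have "card (N (hd zs) \<inter> W) \<le> 1" using cW l2 by simp
  then have "card (N (hd zs) \<inter> set cs) \<noteq> 0" using tot two by linarith
  then have "N (hd zs) \<inter> set cs \<noteq> {}" by auto
  then show ?thesis using l2 tot two cW NC by (auto simp: in_N)
qed

text \<open>Both ends of a longest path with \<open>l\<close> vertices are attached to
  \<open>cs\<close>. At different vertices they close two cycles of total length
  \<open>n + 2 * (l + 1)\<close>; the odd one has at least \<open>n\<close> vertices, so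
  \<open>2 * (l + 1)\<close> is at least the girth. At a common vertex already \<open>l + 1\<close>
  is.\<close>

lemma W_path_exists:
  assumes small: "card W < 2 * h" and w: "w \<in> W"
  shows "\<exists>zs. Wpath zs \<and> set zs \<subseteq> Wreach w \<and> 2 \<le> length zs \<and> h \<le> length zs + 1 \<and>
    card (N (hd zs)) = 2 \<and> (\<exists>c\<in>set cs. adj (hd zs) c)"
proof -
  let ?P = "\<lambda>zs. Wpath zs \<and> set zs \<subseteq> Wreach w"
  have "?P [w]" using w by (simp add: Wpath_def Wreach_refl)
  then obtain zs where zs: "?P zs" and longest: "\<And>ys. ?P ys \<Longrightarrow> length ys \<le> length zs"
    using ex_has_greatest_nat[of ?P "[w]" length "Suc (card W)"] Wpath_length by (metis (no_types, lifting) less_Suc_eq_le)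
  have e1: "2 \<le> length zs \<and> card (N (hd zs)) = 2 \<and> (\<exists>c\<in>set cs. adj (hd zs) c)"
    using W_endpoint[OF small, of zs w] zs longest w by blast
  have "2 \<le> length (rev zs) \<and> card (N (hd (rev zs))) = 2 \<and> (\<exists>c\<in>set cs. adj (hd (rev zs)) c)"
    using W_endpoint[OF small, of "rev zs" w] zs longest w Wpath_rev by simp
  then have "\<exists>c\<in>set cs. adj (last zs) c" by (simp add: hd_rev)
  then obtain j where j: "j < n" "adj (last zs) (cs ! j)" by (auto simp: in_set_conv_nth)
  obtain i where i: "i < n" "adj (hd zs) (cs ! i)" using e1 by (auto simp: in_set_conv_nth)
  obtain a where a: "a < n" "j = (i + a) mod n" using shift_ex i(1) j(1) by metis
  note at = attachW[of zs i a]
  have "h \<le> length zs + 1"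
  proof (cases "a = 0")
    case True
    then show ?thesis using at(1) zs i j a e1 g by auto
  next
    case False
    then show ?thesis using at zs i j a e1 g by (cases "odd (length zs + 1 + a)") auto
  qed
  then show ?thesis using zs e1 by blast
qed

lemma W_reach_card:
  assumes "card W < 2 * h" "w \<in> W"
  shows "2 \<le> card (Wreach w)" "h \<le> card (Wreach w) + 1"
proof -
  obtain zs where zs: "Wpath zs" "set zs \<subseteq> Wreach w" "2 \<le> length zs" "h \<le> length zs + 1"
    using W_path_exists[OF assms] by blast
  have "finite (Wreach w)" using Wreach_W[OF assms(2)] fin finite_subset by blast
  then have "length zs \<le> card (Wreach w)"
    using card_mono[OF _ zs(2)] zs(1) by (auto simp: Wpath_def distinct_card)
  then show "2 \<le> card (Wreach w)" "h \<le> card (Wreach w) + 1" using zs by auto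
qed

text \<open>Degree at most 2 forces \<open>p + 1 \<le> 4 * h\<close> and leaves at most
  \<open>2 * h - 2\<close> vertices in \<open>W\<close>. If there are any, \<open>W\<close> has a
  vertex \<open>u\<close> of degree 2 with a neighbour \<open>c\<close> on \<open>cs\<close>.
  Expansion around \<open>c\<close> shows that both neighbours \<open>v1\<close> and
  \<open>v2\<close> of \<open>c\<close> on \<open>cs\<close> have neighbours in \<open>W\<close>
  too, and there is no room for these without a short cycle.\<close>

lemma low_degree_cycle:
  assumes v: "v \<in> S" "card (N v) \<le> 2"
  shows "W = {}"
proof (rule ccontr)
  assume "W \<noteq> {}"
  then obtain w where w: "w \<in> W" by blast
  have "p + 1 \<le> 2 * h * card (N v)" by (rule degree_bound[OF v(1)])
  also have "\<dots> \<le> 2 * h * 2" using v(2) by (rule mult_left_mono) simp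
  finally have p4: "p + 1 \<le> 4 * h" by simp
  then have small: "card W < 2 * h" using p_split n_ge by linarith
  obtain zs where zs: "Wpath zs" "2 \<le> length zs" "h \<le> length zs + 1" "card (N (hd zs)) = 2"
      "\<exists>c\<in>set cs. adj (hd zs) c"
    using W_path_exists[OF small w] by blast
  define u where "u = hd zs"
  have uW: "u \<in> W" using zs(1) hd_in_set[of zs] unfolding Wpath_def u_def by blast
  have u2: "card (N u) = 2" using zs(4) by (simp add: u_def)
  obtain i where i: "i < n" "adj u (cs ! i)" using zs(5) by (auto simp: in_set_conv_nth u_def)
  define c where "c = cs ! i"
  define v1 where "v1 = cs ! ((i + 1) mod n)"
  define v2 where "v2 = cs ! ((i + (n - 1)) mod n)"
  have Nc: "N c \<inter> set cs = {v1, v2}" using N_cs[OF i(1)] by (simp add: c_def v1_def v2_def)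
  have v12: "v1 \<noteq> v2" using cs_neighbours_distinct[OF i(1)] by (simp add: v1_def v2_def)
  have vc: "adj c v1" "adj c v2" "v1 \<in> set cs" "v2 \<in> set cs" using Nc by (auto simp: in_N)
  have cC: "c \<in> set cs" using i by (simp add: c_def)
  have uc: "adj u c" using i by (simp add: c_def)
  have ne: "c \<noteq> v1" "c \<noteq> v2" "u \<noteq> v1" "u \<noteq> v2" "u \<noteq> c" using vc uW cC adj_irr by auto
  have minus: "card (N t - {c}) = card (N t) - 1" if "adj c t" for t
    using that adj_sym by (simp add: in_N)
  have deg2: "card (N t) = 2" if "t \<in> set cs" "N t \<inter> W = {}" for t
  proof -
    have "N t - set cs = {}" using that(2) N_S by auto
    then show ?thesis using card_N_cs[OF that(1)] by simp
  qed
  have inS: "c \<in> S" "v1 \<in> S" "v2 \<in> S" "u \<in> S" using cC vc uW cs_S by auto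
  have p3: "3 * h \<le> p"
    using Wpath_length[OF zs(1)] zs(3) p_split n_ge by linarith
  \<comment> \<open>Both \<open>t\<close> and \<open>u\<close> have degree 2 and are adjacent to
    \<open>c\<close>, so each has one neighbour besides \<open>c\<close> and expansion gives
    \<open>p + 1 < 4 * h\<close>. It is strict because \<open>c\<close> also sees
    \<open>t'\<close>.\<close>
  have two: False if t: "t \<in> {v1, v2}" "N t \<inter> W = {}" and full: "4 * h \<le> p + 1" for t
  proof -
    obtain t' where t': "t' \<in> {v1, v2}" "t' \<noteq> t" using t(1) v12 by auto
    have tS: "t \<in> S" "adj c t" "adj c t'" "t \<noteq> c" "t \<noteq> u" "t' \<noteq> u" "t \<in> set cs"
      using t(1) t'(1) inS vc ne by auto
    have "(p + 1) * (card {t, u} - card {c}) < 2 * h * (\<Sum>i\<in>{t, u}. card (N i - {c}))"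
      by (rule expansion_strict[where z = c and u = t']) (use tS inS t' ne in auto)
    then show False using minus tS adj_sym[OF uc] u2 deg2[OF tS(7) t(2)] full by simp
  qed
  have adjacent: "2 * h \<le> length ys + 2"
    if ys: "Wpath ys" "hd ys = u" and t: "t \<in> {v1, v2}" "adj (last ys) t" for ys t
  proof (cases "t = v1")
    case True
    then show ?thesis using attachW(1)[of ys i 1] ys t i n5 g by (simp add: v1_def)
  next
    case False
    moreover have "n - 1 < n" "0 < n - 1" "n - (n - 1) = 1" using n5 by linarith+
    ultimately show ?thesis using attachW(3)[of ys i "n - 1"] ys t i g by (auto simp: v2_def)
  qed
  \<comment> \<open>In the component of \<open>u\<close>, a path from \<open>u\<close> to
    \<open>t'\<close> closes through \<open>t\<close> and \<open>c\<close>, which takes at least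
    \<open>2 * h - 2\<close> vertices. Otherwise there are two components with at least
    \<open>h - 1\<close> vertices each.\<close>
  have big: "2 * h \<le> card W + 2" if t: "t \<in> {v1, v2}" "t' \<in> N t \<inter> W" for t t'
  proof (cases "t' \<in> Wreach u")
    case True
    obtain ys where ys: "Wpath ys" "hd ys = u" "last ys = t'" using Wreach_path[OF uW True] by blast
    then show ?thesis using adjacent[OF ys(1,2) t(1)] t(2) Wpath_length[OF ys(1)] adj_sym by (auto simp: in_N)
  next
    case False
    have "Wreach u \<inter> Wreach t' = {}" using False Wreach_sym Wreach_trans by blast
    moreover have "finite (Wreach u)" "finite (Wreach t')"
      using Wreach_W uW t(2) fin finite_subset by blast+
    ultimately have "card (Wreach u) + card (Wreach t') = card (Wreach u \<union> Wreach t')"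
      by (simp add: card_Un_disjoint)
    also have "\<dots> \<le> card W" using Wreach_W uW t(2) fin by (intro card_mono) auto
    finally show ?thesis using W_reach_card(2)[OF small uW] W_reach_card(2)[OF small, of t'] t(2) by auto
  qed
  show False
  proof (cases "N v1 \<inter> W = {} \<and> N v2 \<inter> W = {}")
    case True
    have "(p + 1) * (card {v1, v2, u} - card {c}) \<le> 2 * h * (\<Sum>i\<in>{v1, v2, u}. card (N i - {c}))"
      by (rule expansion) (use inS ne v12 in auto)
    then show False
      using minus vc adj_sym[OF uc] u2 deg2[of v1] deg2[of v2] True ne v12 p3 by simp
  next
    case False
    then obtain t t' where t: "t \<in> {v1, v2}" "t' \<in> N t \<inter> W" by blast
    have cW: "card W = 2 * h - 2" "n = 2 * h + 1"
      using big[OF t] p4 p_split n_ge by linarith+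
    have full: "4 * h \<le> p + 1" using cW p_split h by linarith
    then have "N v1 \<inter> W \<noteq> {}" "N v2 \<inter> W \<noteq> {}" using two[of v1] two[of v2] by blast+
    then obtain w1 w2 where w1: "adj w1 v1" "w1 \<in> W" and w2: "adj w2 v2" "w2 \<in> W"
      using adj_sym unfolding in_N by (metis IntE equals0I in_N)
    have w12: "w1 \<noteq> w2" using W_unique[of w1 v1 v2] w1 w2 vc v12 by blast
    \<comment> \<open>A path from \<open>u\<close> to \<open>a\<close> must use all
      \<open>2 * h - 2\<close> vertices of \<open>W\<close>. It therefore meets \<open>b\<close>
      before its end, and stopping there yields a path too short for
      \<open>adjacent\<close>.\<close>
    have inner: False
      if aR: "a \<in> Wreach u" and tt: "{t, t'} = {v1, v2}" and at: "adj a t" and "b \<in> W" "adj b t'" "a \<noteq> b" for a b t t'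
    proof -
      obtain ys where ys: "Wpath ys" "hd ys = u" "last ys = a" using Wreach_path[OF uW aR] by blast
      have y: "ys \<noteq> []" "distinct ys" "set ys \<subseteq> W" "successively adj ys" using ys by (auto simp: Wpath_def)
      have "t \<in> {v1, v2}" "t' \<in> {v1, v2}" using tt by auto
      then have "card W \<le> length ys" using adjacent[OF ys(1,2), of t] at ys(3) cW h by simp
      then have "set ys = W" using card_seteq[of W "set ys"] fin y by (simp add: distinct_card)
      then obtain as bs where dec: "ys = as @ b # bs" using \<open>b \<in> W\<close> by (metis split_list)
      have bs: "bs \<noteq> []" using dec ys(3) \<open>a \<noteq> b\<close> by auto
      have "Wpath (as @ [b])" using y dec by (auto simp: Wpath_def successively_append_iff successively_Cons)
      moreover have "hd (as @ [b]) = u" using ys(2) dec by (cases as) auto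
      ultimately have "2 * h \<le> length (as @ [b]) + 2"
        using adjacent[of "as @ [b]" t'] \<open>t' \<in> {v1, v2}\<close> \<open>adj b t'\<close> by simp
      moreover have "length (as @ [b]) < length ys" using dec bs by simp
      ultimately show False using Wpath_length[OF ys(1)] cW h by linarith
    qed
    have nr: "w1 \<notin> Wreach u" "w2 \<notin> Wreach u"
      using inner[of w1 v1 v2 w2] inner[of w2 v2 v1 w1] w1 w2 w12 by blast+
    have disj: "Wreach u \<inter> Wreach w1 = {}" using nr Wreach_sym Wreach_trans by blast
    have fins: "finite (Wreach u)" "finite (Wreach w1)"
      using Wreach_W uW w1 fin finite_subset by blast+
    have un: "Wreach u \<union> Wreach w1 \<subseteq> W" using Wreach_W uW w1 by blast
    have cs': "card (Wreach u \<union> Wreach w1) = card (Wreach u) + card (Wreach w1)"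
      by (rule card_Un_disjoint[OF fins disj])
    have "card (Wreach u \<union> Wreach w1) \<le> card W" using un fin by (intro card_mono) auto
    then have cw1: "card (Wreach u \<union> Wreach w1) = card W" "card (Wreach w1) + 1 = h"
      using cs' W_reach_card(2)[OF small uW] W_reach_card(2)[OF small, of w1] w1 cW h by linarith+
    have "Wreach u \<union> Wreach w1 = W" using card_subset_eq[OF _ un cw1(1)] fin by simp
    then have "w2 \<in> Wreach w1" using w2 nr by blast
    then have "w1 \<in> Wreach w2" by (rule Wreach_sym)
    then obtain ys where ys: "Wpath ys" "set ys \<subseteq> Wreach w2" "hd ys = w2" "last ys = w1"
      using Wreach_path w2 by blast
    have "Wreach w2 \<subseteq> Wreach w1" using \<open>w2 \<in> Wreach w1\<close> Wreach_trans by blast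
    then have "length ys \<le> card (Wreach w1)"
      using card_mono[OF fins(2), of "set ys"] ys(1,2) by (auto simp: Wpath_def distinct_card)
    \<comment> \<open>From \<open>v2\<close> to \<open>v1\<close> there are two steps along
      \<open>cs\<close>. With at most \<open>h - 1\<close> vertices of \<open>W\<close> they close a
      cycle of length at most \<open>h + 2\<close>, whence \<open>h = 2\<close>; but then the
      component of \<open>w1\<close> would be a single vertex.\<close>
    moreover have "((i + (n - 1)) mod n + 2) mod n = (i + 1) mod n"
    proof -
      have "((i + (n - 1)) mod n + 2) mod n = (i + (n - 1) + 2) mod n" by (rule mod_add_left_eq)
      also have "i + (n - 1) + 2 = (i + 1) + n" using n5 by simp
      also have "((i + 1) + n) mod n = (i + 1) mod n" by (rule mod_add_self2)
      finally show ?thesis .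
    qed
    then have "g \<le> length ys + 1 + 2"
      using attachW(1)[of ys "(i + (n - 1)) mod n" 2] ys w1 w2 n5 by (simp add: v1_def v2_def)
    ultimately have "h \<le> 2" using cw1 g by linarith
    then show False using cw1(2) W_reach_card(1)[OF small, of w1] w1 by simp
  qed
qed


section \<open>Minimum degree at least three\<close>

lemma sum_card_swap:
  "finite A \<Longrightarrow> finite B \<Longrightarrow> (\<Sum>a\<in>A. card (N a \<inter> B)) = (\<Sum>b\<in>B. card (N b \<inter> A))"
proof -
  assume f: "finite A" "finite B"
  have *: "card (N a \<inter> X) = (\<Sum>b\<in>X. if adj a b then 1 else 0)" if "finite X" for a X
  proof -
    have "N a \<inter> X = X \<inter> {b. adj a b}" by (auto simp: in_N)
    then show ?thesis using that by (simp add: sum.If_cases)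
  qed
  have "(\<Sum>a\<in>A. card (N a \<inter> B)) = (\<Sum>a\<in>A. \<Sum>b\<in>B. if adj a b then 1 else 0)"
    using * f by (intro sum.cong) auto
  also have "\<dots> = (\<Sum>b\<in>B. \<Sum>a\<in>A. if adj b a then 1 else 0)"
    by (subst sum.swap, intro sum.cong refl) (auto dest: adj_sym)
  also have "\<dots> = (\<Sum>b\<in>B. card (N b \<inter> A))"
    using * f by (intro sum.cong) auto
  finally show ?thesis .
qed

text \<open>Each vertex of \<open>cs\<close> has at least \<open>\<delta> - 2\<close> private
  neighbours in \<open>N1\<close>, each vertex of \<open>N1\<close> has at least
  \<open>\<delta> - 1\<close> neighbours in \<open>N2\<close>, and each vertex of \<open>N2\<close>
  has at most two in \<open>N1\<close>. With \<open>\<delta> = d + 3\<close> this gives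
  \<open>n * (d + 2) * (d + 3) \<le> 2 * p\<close>, while the degree bound gives
  \<open>p < n * (d + 3)\<close>.\<close>

lemma min_degree_ge_3_large_girth:
  assumes h4: "4 \<le> h" and \<delta>: "3 \<le> \<delta>" "\<And>v. v \<in> S \<Longrightarrow> \<delta> \<le> card (N v)" and v: "v \<in> S" "card (N v) = \<delta>"
  shows False
proof -
  define N1 where "N1 = {w \<in> W. \<exists>c\<in>set cs. adj w c}"
  define N2 where "N2 = W - N1"
  have fins: "finite N1" "finite N2" "finite W" using fin by (auto simp: N1_def N2_def)
  have g8: "8 \<le> g" using g h4 by simp
  have card1: "n * (\<delta> - 2) \<le> card N1"
  proof -
    have eq: "N1 = (\<Union>c\<in>set cs. N c - set cs)" using adj_sym adj_S by (simp add: N1_def in_N set_eq_iff) blast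
    have "card N1 = (\<Sum>c\<in>set cs. card (N c - set cs))"
      unfolding eq
    proof (rule card_UN_disjoint)
      show "\<forall>c\<in>set cs. \<forall>d\<in>set cs. c \<noteq> d \<longrightarrow> (N c - set cs) \<inter> (N d - set cs) = {}"
        using W_unique adj_sym adj_S by (auto simp: in_N)
    qed auto
    also have "\<dots> \<ge> (\<Sum>c\<in>set cs. \<delta> - 2)"
    proof (rule sum_mono)
      fix c assume "c \<in> set cs"
      then show "\<delta> - 2 \<le> card (N c - set cs)" using card_N_cs[of c] \<delta>(2)[of c] cs_S by auto
    qed
    finally show ?thesis using cs_distinct by (simp add: distinct_card)
  qed
  have indep: False if "w \<in> N1" "w' \<in> N1" "adj w w'" for w w'
  proof -
    obtain i where i: "i < n" "adj w (cs ! i)" using \<open>w \<in> N1\<close> by (auto simp: N1_def in_set_conv_nth)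
    obtain j where j: "j < n" "adj w' (cs ! j)" using \<open>w' \<in> N1\<close> by (auto simp: N1_def in_set_conv_nth)
    obtain a where a: "a < n" "j = (i + a) mod n" using shift_ex i j by metis
    have W: "Wpath [w, w']" using that adj_irr by (auto simp: Wpath_def N1_def)
    note at = attachW[OF W, of i a]
    show False
    proof (cases "a = 0")
      case True
      then show False using at(1) i j a g8 by auto
    next
      case False
      then show False using at i j a g8 by (cases "odd a") auto
    qed
  qed
  \<comment> \<open>The path through \<open>z\<close> closes two cycles of total length
    \<open>n + 8\<close>. The odd one has at least \<open>n\<close> vertices and the even one at
    least 8, so the even one has exactly 8 and uses an arc of 4 steps.\<close>
  have pair: "a = 4 \<or> a = n - 4"
    if "adj z w" "adj z w'" "w \<in> W" "w' \<in> W" "z \<in> W" "w \<noteq> w'" and i: "i < n" "adj w (cs ! i)"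
      and a: "a < n" "adj w' (cs ! ((i + a) mod n))" for z w w' i a
  proof -
    have W: "Wpath [w, z, w']" using that adj_irr adj_sym by (auto simp: Wpath_def)
    note at = attachW[OF W, of i a]
    show ?thesis
    proof (cases "a = 0")
      case True
      then show ?thesis using at(1) i a g8 by auto
    next
      case False
      then show ?thesis using at i a g8 by (cases "odd a") auto
    qed
  qed
  have n9: "9 \<le> n" using n_ge h4 by simp
  have two: "card (N z \<inter> N1) \<le> 2" if z: "z \<in> N2" for z
  proof (rule ccontr)
    assume "\<not> card (N z \<inter> N1) \<le> 2"
    then have "3 \<le> card (N z \<inter> N1)" by simp
    then obtain T where T: "T \<subseteq> N z \<inter> N1" "card T = 3" by (metis obtain_subset_with_card_n)
    then obtain w1 w2 w3 where w: "w1 \<in> N z \<inter> N1" "w2 \<in> N z \<inter> N1" "w3 \<in> N z \<inter> N1"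
        "w1 \<noteq> w2" "w1 \<noteq> w3" "w2 \<noteq> w3"
      by (auto simp: card_3_iff)
    have zW: "z \<in> W" using z by (simp add: N2_def)
    have wW: "w1 \<in> W" "w2 \<in> W" "w3 \<in> W" "adj z w1" "adj z w2" "adj z w3"
      using w by (auto simp: N1_def in_N)
    obtain i1 where i1: "i1 < n" "adj w1 (cs ! i1)" using w(1) by (auto simp: N1_def in_set_conv_nth)
    obtain i2 where i2: "i2 < n" "adj w2 (cs ! i2)" using w(2) by (auto simp: N1_def in_set_conv_nth)
    obtain i3 where i3: "i3 < n" "adj w3 (cs ! i3)" using w(3) by (auto simp: N1_def in_set_conv_nth)
    obtain a where a: "a < n" "i2 = (i1 + a) mod n" using shift_ex i1 i2 by metis
    obtain b where b: "b < n" "i3 = (i1 + b) mod n" using shift_ex i1 i3 by metis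
    have a4: "a = 4 \<or> a = n - 4" using pair[of z w1 w2 i1 a] wW zW w i1 i2 a by simp
    have b4: "b = 4 \<or> b = n - 4" using pair[of z w1 w3 i1 b] wW zW w i1 i3 b by simp
    \<comment> \<open>Attachments at offsets 4 and \<open>n - 4\<close> are \<open>n - 8\<close>
      apart, and this is neither 4 nor \<open>n - 4\<close> as \<open>n\<close> is odd.\<close>
    have step: False if "w \<in> W" "w' \<in> W" "adj z w" "adj z w'" "w \<noteq> w'"
        "adj w (cs ! ((i1 + 4) mod n))" "adj w' (cs ! ((i1 + (n - 4)) mod n))" for w w'
    proof -
      have "((i1 + 4) mod n + (n - 8)) mod n = (i1 + 4 + (n - 8)) mod n" by (rule mod_add_left_eq)
      also have "i1 + 4 + (n - 8) = i1 + (n - 4)" using n9 by simp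
      finally have "n - 8 = 4 \<or> n - 8 = n - 4"
        using pair[of z w w' "(i1 + 4) mod n" "n - 8"] that zW n9 by simp
      then show False using n_odd n9 by presburger
    qed
    have "a \<noteq> b"
    proof
      assume "a = b"
      have "0 < n" using n9 by linarith
      then have "0 = (4::nat) \<or> 0 = n - 4" using \<open>a = b\<close> pair[of z w2 w3 i2 0] wW zW w i2 i3 a b by simp
      then show False using n9 by simp
    qed
    then show False using a4 b4 step[of w2 w3] step[of w3 w2] wW w i2 i3 a b by auto
  qed
  have out: "\<delta> - 1 \<le> card (N w \<inter> N2)" if w: "w \<in> N1" for w
  proof -
    have wW: "w \<in> W" using w by (simp add: N1_def)
    have "card (N w \<inter> set cs) \<le> 1"
      using W_unique[OF wW] by (subst card_le_Suc0_iff_eq[unfolded One_nat_def[symmetric]]) (auto simp: in_N)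
    moreover have "N w - set cs \<subseteq> N w \<inter> N2" using indep[OF w] N_S by (auto simp: N2_def in_N)
    then have "card (N w - set cs) \<le> card (N w \<inter> N2)" by (intro card_mono) auto
    moreover have "card (N w) = card (N w \<inter> set cs) + card (N w - set cs)"
      using card_Int_Diff[of "N w" "set cs"] by simp
    moreover have "\<delta> \<le> card (N w)" using \<delta>(2) wW by simp
    ultimately show ?thesis by linarith
  qed
  have "card N1 * (\<delta> - 1) \<le> (\<Sum>w\<in>N1. card (N w \<inter> N2))"
    using sum_mono[of N1 "\<lambda>_. \<delta> - 1" "\<lambda>w. card (N w \<inter> N2)"] out by simp
  also have "\<dots> = (\<Sum>z\<in>N2. card (N z \<inter> N1))" by (rule sum_card_swap[OF fins(1,2)])
  also have "\<dots> \<le> card N2 * 2" using sum_mono[of N2 "\<lambda>z. card (N z \<inter> N1)" "\<lambda>_. 2"] two by simp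
  finally have e: "card N1 * (\<delta> - 1) \<le> card N2 * 2" .
  have N1W: "N1 \<subseteq> W" by (auto simp: N1_def)
  have "card W = card N1 + card N2"
    unfolding N2_def using card_Diff_subset[OF fins(1) N1W] card_mono[OF fins(3) N1W] by linarith
  then have pn: "p = n + card N1 + card N2" using p_split by simp
  obtain d where d: "\<delta> = d + 3" using \<delta>(1) by (metis add.commute le_Suc_ex)
  have "card N1 * (d + 4) \<le> 2 * card N1 + 2 * card N2" using e d by (simp add: algebra_simps)
  moreover have "n * (d + 1) * (d + 4) \<le> card N1 * (d + 4)" using card1 d by (intro mult_right_mono) simp_all
  ultimately have "2 * n + n * (d + 1) * (d + 4) \<le> 2 * p" using pn by linarith
  moreover have "p + 1 \<le> 2 * h * (d + 3)" using degree_bound[OF v(1)] v(2) d by simp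
  moreover have "2 * h * (d + 3) \<le> n * (d + 3)" using n_ge by (intro mult_right_mono) auto
  ultimately show False by (simp add: algebra_simps)
qed

text \<open>Without 4-cycles the neighbours of \<open>b\<close> share no neighbour except
  \<open>b\<close>, so the sum in \<open>expansion\<close> for \<open>N b\<close> against
  \<open>{b}\<close> counts \<open>Q\<close> exactly.\<close>

lemma second_neighbourhood:
  fixes b
  defines "Q \<equiv> \<Union>u\<in>N b. N u - {b}"
  assumes b: "b \<in> S" and d: "2 \<le> card (N b)"
  shows "(p + 1) * (card (N b) - 1) \<le> 2 * h * card Q" and "Q \<inter> insert b (N b) = {}" and "Q \<subseteq> S"
    and "card Q = (\<Sum>u\<in>N b. card (N u) - 1)"
proof -
  have "card Q = (\<Sum>u\<in>N b. card (N u - {b}))"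
    unfolding Q_def
  proof (rule card_UN_disjoint)
    show "\<forall>u\<in>N b. \<forall>v\<in>N b. u \<noteq> v \<longrightarrow> (N u - {b}) \<inter> (N v - {b}) = {}"
      using no_square[of b] adj_sym unfolding in_N by (auto simp: in_N) metis
  qed auto
  moreover have "card (N u - {b}) = card (N u) - 1" if "u \<in> N b" for u
    using that by (simp add: in_N adj_sym)
  ultimately show "card Q = (\<Sum>u\<in>N b. card (N u) - 1)" by simp
  have "(p + 1) * (card (N b) - card {b}) \<le> 2 * h * (\<Sum>u\<in>N b. card (N u - {b}))"
    using b d N_S adj_irr by (intro expansion) (auto simp: in_N)
  then show "(p + 1) * (card (N b) - 1) \<le> 2 * h * card Q"
    using \<open>card Q = (\<Sum>u\<in>N b. card (N u - {b}))\<close> by simp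
  show "Q \<inter> insert b (N b) = {}"
    using no_triangle adj_sym unfolding Q_def by (auto simp: in_N) metis
  show "Q \<subseteq> S" using N_S unfolding Q_def by blast
qed

text \<open>For \<open>h = 2\<close> expansion of \<open>N b\<close> already makes \<open>Q\<close>
  too large for \<open>S\<close>. For \<open>h = 3\<close> there are no 5-cycles either, so
  \<open>Q\<close> is independent and its expansion has to go into the remaining vertices
  \<open>R\<close>. Each vertex of \<open>R\<close> has at most one neighbour in \<open>Q\<close>
  below each neighbour of \<open>b\<close>, hence at most \<open>d\<close>. Both expansion bounds
  together are inconsistent.\<close>

lemma degree_le_3_small_girth:
  assumes h3: "h \<le> 3" and \<delta>: "\<And>v. v \<in> S \<Longrightarrow> 3 \<le> card (N v)" and b: "b \<in> S"
  shows "card (N b) \<le> 3"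
proof (rule ccontr)
  assume "\<not> card (N b) \<le> 3"
  define d where "d = card (N b)"
  have d4: "4 \<le> d" using \<open>\<not> card (N b) \<le> 3\<close> by (simp add: d_def)
  define Q where "Q = (\<Union>u\<in>N b. N u - {b})"
  define q where "q = card Q"
  have Q: "(p + 1) * (d - 1) \<le> 2 * h * q" "Q \<inter> insert b (N b) = {}" "Q \<subseteq> S" "q = (\<Sum>u\<in>N b. card (N u) - 1)"
    using second_neighbourhood[OF b] d4 unfolding d_def q_def Q_def by auto
  have finQ: "finite Q" using Q(3) fin finite_subset by blast
  have bN: "b \<notin> N b" using adj_irr by (simp add: in_N)
  have ball: "card (insert b (N b) \<union> Q) = 1 + d + q"
    using Q(2) finQ bN by (subst card_Un_disjoint) (auto simp: d_def q_def)
  have ballS: "insert b (N b) \<union> Q \<subseteq> S" using b N_S Q(3) by auto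
  then have p1: "1 + d + q \<le> p" using ball card_mono[OF fin] by metis
  consider "h = 2" | "h = 3" using h h3 by linarith
  then show False
  proof cases
    case 1
    then have le: "(p + 1) * (d - 1) \<le> 4 * q" using Q(1) by simp
    show False
    proof (cases "d = 4")
      case True
      \<comment> \<open>Here \<open>3 * (p + 1) \<le> 4 * q\<close> and \<open>q + 5 \<le> p\<close>
        require \<open>23 \<le> p\<close>, but the degree bound gives
        \<open>p \<le> 15\<close>.\<close>
      then show False using le p1 degree_bound[OF b] 1 by (simp add: d_def)
    next
      case False
      then have "(p + 1) * 4 \<le> (p + 1) * (d - 1)" using d4 by (intro mult_left_mono) auto
      then have "4 * (p + 1) \<le> 4 * q" using le by (metis mult.commute order_trans)
      then have "p + 1 \<le> q" by simp
      then show False using p1 by linarith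
    qed
  next
    case 2
    have q2: "2 * d \<le> q"
    proof -
      have "(\<Sum>u\<in>N b. 2) \<le> q" unfolding Q(4)
      proof (rule sum_mono)
        fix u assume "u \<in> N b"
        then have "3 \<le> card (N u)" using \<delta> N_S by blast
        then show "2 \<le> card (N u) - 1" by linarith
      qed
      then show ?thesis by (simp add: d_def)
    qed
    have g6: "6 \<le> g" using g 2 by simp
    define R where "R = S - (insert b (N b) \<union> Q)"
    have "card R = p - (1 + d + q)" unfolding R_def using ballS ball fin card_Diff_subset[of "insert b (N b) \<union> Q" S] finQ by auto
    then have pR: "p = 1 + d + q + card R" using p1 by simp
    have parent: "\<exists>u. adj b u \<and> adj u y" if "y \<in> Q" for y using that by (auto simp: Q_def in_N)
    have Qindep: False if y: "y \<in> Q" "y' \<in> Q" "adj y y'" for y y'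
    proof -
      obtain u u' where u: "adj b u" "adj u y" "adj b u'" "adj u' y'" using parent y by blast
      show False
      proof (cases "u = u'")
        case True
        then show False using no_triangle[of u y y'] u y(3) adj_sym by blast
      next
        case False
        have "b \<noteq> y" "b \<noteq> y'" "u \<noteq> y" "u \<noteq> y'" "u' \<noteq> y" "u' \<noteq> y'" "b \<noteq> u" "b \<noteq> u'" "y \<noteq> y'"
          using y Q(2) u adj_irr by (auto simp: in_N)
        then have "cyc adj [b, u, y, y', u']" using False u y(3) adj_sym by (auto simp: cyc_def)
        then show False using cyc_girth g6 by fastforce
      qed
    qed
    have "(p + 1) * (card Q - card (N b)) \<le> 2 * h * (\<Sum>y\<in>Q. card (N y - N b))"
      using Q(2,3) N_S q2 d4 by (intro expansion) (auto simp: q_def d_def)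
    moreover have "(\<Sum>y\<in>Q. card (N y - N b)) \<le> (\<Sum>y\<in>Q. card (N y \<inter> R))"
    proof (intro sum_mono card_mono)
      fix y assume y: "y \<in> Q"
      have "b \<notin> N y" using y Q(2) in_N_sym[of b y] by blast
      then show "N y - N b \<subseteq> N y \<inter> R" using Qindep[OF y] N_S by (auto simp: R_def in_N)
    qed auto
    moreover have "(\<Sum>y\<in>Q. card (N y \<inter> R)) = (\<Sum>z\<in>R. card (N z \<inter> Q))"
      using finQ fin by (intro sum_card_swap) (auto simp: R_def)
    moreover have "(\<Sum>z\<in>R. card (N z \<inter> Q)) \<le> (\<Sum>z\<in>R. d)"
    proof (rule sum_mono)
      fix z assume z: "z \<in> R"
      define f where "f = (\<lambda>y. SOME u. adj b u \<and> adj u y)"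
      have f: "adj b (f y) \<and> adj (f y) y" if "y \<in> Q" for y
        unfolding f_def using parent[OF that] by (rule someI_ex)
      have "inj_on f (N z \<inter> Q)"
      proof (rule inj_onI)
        fix y y' assume y: "y \<in> N z \<inter> Q" "y' \<in> N z \<inter> Q" "f y = f y'"
        have "z \<noteq> f y" using f[of y] y z by (auto simp: R_def in_N)
        then show "y = y'" using no_square[of z y "f y" y'] f[of y] f[of y'] y adj_sym by (auto simp: in_N)
      qed
      moreover have "f ` (N z \<inter> Q) \<subseteq> N b" using f by (auto simp: in_N)
      ultimately show "card (N z \<inter> Q) \<le> d" unfolding d_def by (metis card_inj_on_le finite_N)
    qed
    ultimately have le: "(p + 1) * (q - d) \<le> 6 * (d * card R)"
      using 2 unfolding q_def d_def by (simp add: mult.commute)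
    define c where "c = int p + 1"
    define D where "D = int d"
    have e2: "c * (int q - D) \<le> 6 * D * int (card R)"
    proof -
      have "int ((p + 1) * (q - d)) \<le> int (6 * (d * card R))" using le by (simp only: of_nat_le_iff)
      moreover have "int (q - d) = int q - D" using q2 by (simp add: D_def)
      ultimately show ?thesis unfolding of_nat_mult c_def D_def by (simp add: algebra_simps)
    qed
    have e1: "c * (D - 1) \<le> 6 * int q"
    proof -
      have "int ((p + 1) * (d - 1)) \<le> int (6 * q)" using Q(1) 2 by (simp only: of_nat_le_iff)
      moreover have "int (d - 1) = D - 1" using d4 by (simp add: D_def)
      ultimately have "int (p + 1) * (D - 1) \<le> int 6 * int q" by (simp only: of_nat_mult)
      then show ?thesis by (simp add: c_def add.commute)
    qed
    have e3: "c = 2 + D + int q + int (card R)" unfolding c_def D_def using pR by simp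
    have D4: "4 \<le> D" using d4 by (simp add: D_def)
    have c0: "0 \<le> c" by (simp add: c_def)
    \<comment> \<open>In \<open>e2\<close>, rewritten by \<open>e3\<close>, the coefficient of
      \<open>q\<close> is \<open>c + 6 * D\<close>. Multiplying \<open>e1\<close> by the same factor
      eliminates \<open>q\<close> and leaves a quadratic inequality in \<open>c\<close>.\<close>
    have "(c + 6 * D) * (c * (D - 1)) \<le> (c + 6 * D) * (6 * int q)"
      using e1 c0 D4 by (intro mult_left_mono) auto
    moreover have "c * int q + 6 * D * int q \<le> 7 * D * c - 12 * D - 6 * D * D"
    proof -
      have "6 * D * int (card R) = 6 * D * (c - 2 - D - int q)" using e3 by simp
      then show ?thesis using e2 by (simp add: algebra_simps)
    qed
    ultimately have key: "(D - 1) * (c * c) + (6 * (D * D) - 48 * D) * c + 36 * (D * D) + 72 * D \<le> 0"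
      by (simp add: algebra_simps)
    \<comment> \<open>For \<open>D\<close> from 4 to 7 the quadratic in \<open>c\<close> has no real
      root, as the squares below witness. From 8 on none of its coefficients is negative and the
      constant term is positive.\<close>
    consider "D = 4" | "D = 5" | "D = 6" | "D = 7" | "8 \<le> D" using D4 by linarith
    then show False
    proof cases
      case 1
      have "0 \<le> (c - 16) * (c - 16)" by simp
      then show False using key 1 by (simp add: algebra_simps)
    next
      case 2
      have "0 \<le> (4 * c - 45) * (4 * c - 45)" by simp
      then show False using key 2 c0 by (simp add: algebra_simps)
    next
      case 3
      have "0 \<le> (5 * c - 36) * (5 * c - 36)" by simp
      then show False using key 3 c0 by (simp add: algebra_simps)
    next
      case 4
      have "0 \<le> (c - 4) * (c - 4)" by simp
      then show False using key 4 c0 by (simp add: algebra_simps)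
    next
      case 5
      have "0 \<le> (D - 1) * (c * c)" using 5 c0 by simp
      moreover have "6 * (D * D) - 48 * D = 6 * (D * (D - 8))" by (simp add: algebra_simps)
      then have "0 \<le> (6 * (D * D) - 48 * D) * c" using 5 c0 by simp
      moreover have "0 \<le> D * D" by simp
      ultimately show False using key 5 by linarith
    qed
  qed
qed

text \<open>In the remaining case the graph would be cubic on an odd number of vertices.\<close>

lemma W_empty: "W = {}"
proof (cases "\<exists>v\<in>S. card (N v) \<le> 2")
  case True
  then show ?thesis using low_degree_cycle by blast
next
  case False
  then have deg3: "3 \<le> card (N v)" if "v \<in> S" for v using that by force
  have ne: "S \<noteq> {}" using oddS by auto
  show ?thesis
  proof (cases "4 \<le> h")
    case True
    define \<delta> where "\<delta> = Min ((\<lambda>v. card (N v)) ` S)"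
    have "\<delta> \<in> (\<lambda>v. card (N v)) ` S" unfolding \<delta>_def using fin ne by (intro Min_in) auto
    then obtain v where v: "v \<in> S" "card (N v) = \<delta>" by auto
    have "\<delta> \<le> card (N u)" if "u \<in> S" for u unfolding \<delta>_def using fin that by (intro Min_le) auto
    then show ?thesis using min_degree_ge_3_large_girth[OF True, of \<delta> v] v deg3[OF v(1)] by auto
  next
    case F: False
    have three: "card (N v) = 3" if v: "v \<in> S" for v
    proof -
      have "card (N v) \<le> 3" by (rule degree_le_3_small_girth) (use F deg3 v in auto)
      then show ?thesis using deg3[OF v] by linarith
    qed
    have "even (\<Sum>u\<in>S. \<Sum>v\<in>S. if adj u v then 1 else 0 :: nat)"
      using fin adj_irr by (intro even_symmetric_sum) (auto dest: adj_sym)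
    moreover have "(\<Sum>v\<in>S. if adj u v then 1 else 0 :: nat) = card (N u)" for u
    proof -
      have "N u = S \<inter> {v. adj u v}" by (auto simp: N_def adj_def)
      then show ?thesis using fin by (simp add: sum.If_cases)
    qed
    ultimately have "even (p * 3)" using three by simp
    then show ?thesis using oddS by simp
  qed
qed

end

section \<open>The odd cycle spanning the weighted graph\<close>

context ring_weights
begin

text \<open>The first vertex is prescribed so that the cycle can later be cut open at a vertex
  outside a given part of \<open>S\<close>.\<close>

theorem ring_structure:
  assumes v0: "v0 \<in> S"
  shows "\<exists>cs. cyc adj cs \<and> set cs = S \<and> cs ! 0 = v0 \<and>
     (\<forall>u v. adj u v \<longrightarrow> (\<exists>i<length cs. {u, v} = {cs ! i, cs ! ((i + 1) mod length cs)}))"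
proof -
  obtain ds where ds: "odd_min ds" using ex_odd_min by blast
  interpret D: ring_weights_cycle S x m M \<mu> h s g ds by unfold_locales (rule ds)
  have "v0 \<in> set ds" using D.W_empty v0 by blast
  then obtain j where j: "j < length ds" "v0 = ds ! j" by (auto simp: in_set_conv_nth)
  define cs where "cs = rotate j ds"
  have cs: "odd_min cs" unfolding cs_def by (rule odd_min_rotate[OF ds])
  have "0 < length ds" using j(1) by linarith
  then have cs0: "cs ! 0 = v0" unfolding cs_def using nth_rotate[of 0 ds j] j by simp
  interpret ring_weights_cycle S x m M \<mu> h s g cs by unfold_locales (rule cs)
  have S: "set cs = S" using W_empty cs_S by auto
  have "\<exists>i<length cs. {u, v} = {cs ! i, cs ! ((i + 1) mod length cs)}" if uv: "adj u v" for u v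
  proof -
    have "u \<in> set cs" "v \<in> set cs" using adj_S[OF uv] S by auto
    then obtain i where i: "i < length cs" "u = cs ! i" by (auto simp: in_set_conv_nth)
    have "v \<in> N (cs ! i) \<inter> set cs" using uv i \<open>v \<in> set cs\<close> by (simp add: in_N)
    then consider "v = cs ! ((i + 1) mod n)" | "v = cs ! ((i + (n - 1)) mod n)" using N_cs[OF i(1)] by auto
    then show ?thesis
    proof cases
      case 1
      then show ?thesis using i by blast
    next
      case 2
      have "((i + (n - 1)) mod n + 1) mod n = (i + (n - 1) + 1) mod n" by (rule mod_add_left_eq)
      moreover have "i + (n - 1) + 1 = i + n" "(i + n) mod n = i" using i by simp_all
      ultimately show ?thesis
        using 2 i by (intro exI[of _ "(i + (n - 1)) mod n"]) (auto simp: insert_commute)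
    qed
  qed
  then show ?thesis using cs S cs0 unfolding odd_min_def by blast
qed

end

section \<open>Maximal trees span ring graphs\<close>

context near_coloring
begin

lemma tash_edge:
  assumes "tash \<phi> n y f" "2 \<le> i" "i \<le> n"
  shows "f i \<in> E - {e0}" "\<exists>j<i. en (f i) = {y j, y i}" "\<exists>j<i. \<phi> (f i) \<in> miss \<phi> (y j)"
  using assms unfolding tash_def by blast+

lemma tash_extend:
  assumes "tash \<phi> n y f" "e \<in> E - {e0}" "j \<le> n" "en e = {y j, w}" "w \<notin> y ` {..n}"
    "t \<le> n" "\<phi> e \<in> miss \<phi> (y t)"
  shows "tash \<phi> (Suc n) (y(Suc n := w)) (f(Suc n := e))"
  unfolding tash_def
proof (intro conjI allI impI)
  show "inj_on (y(Suc n := w)) {..Suc n}"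
    using assms(1,5) by (auto simp: tash_def atMost_Suc inj_on_def)
  fix i assume i: "2 \<le> i \<and> i \<le> Suc n"
  show "(f(Suc n := e)) i \<in> E - {e0}" using assms i by (auto simp: tash_def)
  show "\<exists>j<i. en ((f(Suc n := e)) i) = {(y(Suc n := w)) j, (y(Suc n := w)) i}"
  proof (cases "i = Suc n")
    case True
    then show ?thesis using assms by (intro exI[of _ j]) auto
  next
    case False
    then obtain j where "j < i" "en (f i) = {y j, y i}" using tash_edge(2)[OF assms(1), of i] i by auto
    then show ?thesis using False i by (intro exI[of _ j]) auto
  qed
  show "\<exists>j<i. \<phi> ((f(Suc n := e)) i) \<in> miss \<phi> ((y(Suc n := w)) j)"
  proof (cases "i = Suc n")
    case True
    then show ?thesis using assms by (intro exI[of _ t]) auto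
  next
    case False
    then obtain j where "j < i" "\<phi> (f i) \<in> miss \<phi> (y j)" using tash_edge(3)[OF assms(1), of i] i by auto
    then show ?thesis using False i by (intro exI[of _ j]) auto
  qed
qed (use assms(1) in \<open>auto simp: tash_def\<close>)

lemma tash_size:
  assumes "tash \<phi> n y f"
  shows "n < card (\<Union>(en ` E))"
proof -
  have "y i \<in> \<Union>(en ` E)" if "i \<le> n" for i
  proof (cases "i \<le> 1")
    case True
    then have "y i \<in> en e0" using assms by (auto simp: tash_def le_Suc_eq)
    then show ?thesis using e0 by blast
  next
    case False
    then have "2 \<le> i" by simp
    then obtain j where "f i \<in> E" "en (f i) = {y j, y i}" using tash_edge[OF assms _ \<open>i \<le> n\<close>] by blast
    then show ?thesis by blast
  qed
  moreover have "finite (\<Union>(en ` E))"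
    using finite_E card_en by (auto intro: card_ge_0_finite)
  ultimately have "card (y ` {..n}) \<le> card (\<Union>(en ` E))" by (intro card_mono) auto
  then show ?thesis using assms by (simp add: tash_def card_image)
qed

lemma tash_initial:
  shows "\<exists>y f. tash \<phi> 1 y f"
proof -
  obtain u v where uv: "en e0 = {u, v}" "u \<noteq> v" using card_en[OF e0] by (auto simp: card_2_iff)
  then show ?thesis
    by (intro exI[of _ "\<lambda>i. if i = 0 then u else v"] exI[of _ "\<lambda>_. e0"]) (auto simp: tash_def inj_on_def)
qed

section \<open>Trees closed under missing colours\<close>

definition avoids :: "('e \<Rightarrow> nat) \<Rightarrow> nat set \<Rightarrow> nat \<Rightarrow> (nat \<Rightarrow> 'e) \<Rightarrow> bool" where
  "avoids \<phi> D n f \<longleftrightarrow> (\<forall>i. 2 \<le> i \<and> i \<le> n \<longrightarrow> \<phi> (f i) \<notin> D)"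

definition closed_tree :: "('e \<Rightarrow> nat) \<Rightarrow> nat set \<Rightarrow> nat \<Rightarrow> (nat \<Rightarrow> 'v) \<Rightarrow> (nat \<Rightarrow> 'e) \<Rightarrow> bool" where
  "closed_tree \<phi> D n y f \<longleftrightarrow> col \<phi> \<and> tash \<phi> n y f \<and> avoids \<phi> D n f \<and>
     (\<forall>e\<in>E - {e0}. \<phi> e \<in> (\<Union>v\<in>y ` {..n}. miss \<phi> v) - D \<longrightarrow> en e \<inter> y ` {..n} \<noteq> {} \<longrightarrow> en e \<subseteq> y ` {..n})"

lemma maximal_closed:
  assumes col: "col \<phi>" and T: "tash \<phi> n y f" "avoids \<phi> D n f"
    and max: "\<And>y f. tash \<phi> (Suc n) y f \<Longrightarrow> avoids \<phi> D (Suc n) f \<Longrightarrow> False"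
  shows "closed_tree \<phi> D n y f"
  unfolding closed_tree_def
proof (intro conjI ballI impI)
  fix e assume e: "e \<in> E - {e0}" "\<phi> e \<in> (\<Union>v\<in>y ` {..n}. miss \<phi> v) - D" "en e \<inter> y ` {..n} \<noteq> {}"
  then obtain j t where j: "j \<le> n" "y j \<in> en e" and t: "t \<le> n" "\<phi> e \<in> miss \<phi> (y t)" by auto
  obtain w where w: "en e = {y j, w}" using en_pairE[of e "y j"] e j by auto
  show "en e \<subseteq> y ` {..n}"
  proof (rule ccontr)
    assume "\<not> en e \<subseteq> y ` {..n}"
    then have wn: "w \<notin> y ` {..n}" using w j by auto
    have "avoids \<phi> D (Suc n) (f(Suc n := e))" using T(2) e(2) by (auto simp: avoids_def)
    then show False using max tash_extend[OF T(1) e(1) j(1) w wn t] by blast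
  qed
qed (use assms in auto)

lemma ex_closed_tree:
  assumes "col \<phi>"
  shows "\<exists>n y f. closed_tree \<phi> D n y f"
proof -
  let ?P = "\<lambda>n. \<exists>y f. tash \<phi> n y f \<and> avoids \<phi> D n f"
  have "avoids \<phi> D 1 f" for f unfolding avoids_def by (intro allI impI) linarith
  then have "?P 1" using tash_initial[of \<phi>] by blast
  then obtain n where n: "?P n" "\<And>m. ?P m \<Longrightarrow> m \<le> n"
    using Greatest_le_nat[of ?P _ "card (\<Union>(en ` E))"] GreatestI_nat[of ?P 1 "card (\<Union>(en ` E))"] tash_size
    by (metis (no_types, lifting) less_imp_le)
  then obtain y f where "tash \<phi> n y f" "avoids \<phi> D n f" by blast
  then have "closed_tree \<phi> D n y f"
    using n(2)[of "Suc n"] by (intro maximal_closed[OF assms]) auto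
  then show ?thesis by blast
qed

lemma matching_card:
  assumes "F \<subseteq> E" "\<And>e f. e \<in> F \<Longrightarrow> f \<in> F \<Longrightarrow> e \<noteq> f \<Longrightarrow> en e \<inter> en f = {}"
  shows "card (\<Union>(en ` F)) = 2 * card F"
proof -
  have "card (\<Union>(en ` F)) = (\<Sum>e\<in>F. card (en e))"
    using assms finite_E finite_subset card_en by (intro card_UN_disjoint) (auto intro: card_ge_0_finite simp: subset_iff)
  also have "\<dots> = 2 * card F" using assms(1) card_en by (simp add: subset_iff)
  finally show ?thesis .
qed

lemma colour_class_card:
  assumes "col \<phi>"
  shows "card (\<Union>(en ` {e \<in> E - {e0}. \<phi> e = c \<and> P e})) = 2 * card {e \<in> E - {e0}. \<phi> e = c \<and> P e}"
  using kadj_colour_unique[OF assms] by (intro matching_card) blast+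

lemma sum_pairs:
  assumes "finite S" "v \<in> S" "F \<subseteq> E" "\<And>e. e \<in> F \<Longrightarrow> v \<in> en e \<Longrightarrow> en e \<subseteq> S"
  shows "(\<Sum>u\<in>S. card {e \<in> F. en e = {v, u}}) = card {e \<in> F. v \<in> en e}"
proof -
  have "{e \<in> F. v \<in> en e} = (\<Union>u\<in>S. {e \<in> F. en e = {v, u}})"
  proof (intro equalityI subsetI)
    fix e assume "e \<in> {e \<in> F. v \<in> en e}"
    then have e: "e \<in> F" "v \<in> en e" by auto
    then obtain u where "en e = {v, u}" using en_pairE assms(3) by blast
    moreover have "en e \<subseteq> S" using assms(4) e by blast
    ultimately show "e \<in> (\<Union>u\<in>S. {e \<in> F. en e = {v, u}})" using e by blast
  qed auto
  moreover have "card (\<Union>u\<in>S. {e \<in> F. en e = {v, u}}) = (\<Sum>u\<in>S. card {e \<in> F. en e = {v, u}})"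
    using assms(1) finite_subset[OF assms(3) finite_E]
    by (intro card_UN_disjoint) (auto simp: doubleton_eq_iff)
  ultimately show ?thesis by simp
qed

end

section \<open>Colour weights on a closed tree\<close>

locale near_ring = near_coloring E en k s e0
  for E :: "'e set" and en :: "'e \<Rightarrow> 'v set" and k s :: nat and e0 :: 'e +
  fixes \<mu> h g :: nat
  assumes mult: "card {f \<in> E. en f = {u, v}} \<le> \<mu>"
    and \<mu>: "\<mu> \<le> h * (s + 1)" and h: "2 \<le> h" and g: "2 * h \<le> g" "5 \<le> g"
    and girth: "cyc (\<lambda>u v. \<exists>f\<in>E. en f = {u, v}) vs \<Longrightarrow> g \<le> length vs"
    and colorable: "\<exists>\<phi>. col \<phi>"

text \<open>The set \<open>D\<close> is empty for a tree of maximum size and a singleton for a tree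
  made to avoid one colour. Each end of \<open>e0\<close> misses at least two colours, so excluding
  one still leaves a colour there: this keeps \<open>\<Gamma>\<close> nonempty and the subtraction
  in \<open>m\<close> exact.\<close>

locale closed_tree = near_ring E en k s e0 \<mu> h g
  for E :: "'e set" and en :: "'e \<Rightarrow> 'v set" and k s :: nat and e0 :: 'e and \<mu> h g :: nat +
  fixes \<phi> :: "'e \<Rightarrow> nat" and D :: "nat set" and n :: nat and y :: "nat \<Rightarrow> 'v" and f :: "nat \<Rightarrow> 'e"
  assumes tree: "closed_tree \<phi> D n y f" and D: "finite D" "card D \<le> 1"
begin

definition S :: "'v set" where "S = y ` {..n}"
definition \<Gamma> :: "nat set" where "\<Gamma> = (\<Union>v\<in>S. miss \<phi> v) - D"

lemma col: "col \<phi>" and tash: "tash \<phi> n y f" and avoids: "avoids \<phi> D n f"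
  using tree by (auto simp: closed_tree_def)

lemma closed: "e \<in> E - {e0} \<Longrightarrow> \<phi> e \<in> \<Gamma> \<Longrightarrow> en e \<inter> S \<noteq> {} \<Longrightarrow> en e \<subseteq> S"
  using tree unfolding closed_tree_def S_def \<Gamma>_def by blast

lemma finite_S [simp]: "finite S" by (simp add: S_def)
lemma finite_\<Gamma> [simp]: "finite \<Gamma>" by (simp add: \<Gamma>_def)

lemma elem: "elem \<phi> n y"
  by (rule tashkinov[OF col tash, of n]) (auto simp: tail_def)

lemma card_S: "card S = Suc n"
  using tash by (simp add: S_def tash_def card_image)

lemma miss_unique: "u \<in> S \<Longrightarrow> v \<in> S \<Longrightarrow> c \<in> miss \<phi> u \<Longrightarrow> c \<in> miss \<phi> v \<Longrightarrow> u = v"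
  using elem_eq[OF elem] by (auto simp: S_def)

lemma e0_S: "en e0 \<subseteq> S"
  using tash by (auto simp: tash_def S_def)

lemma \<Gamma>_less: "c \<in> \<Gamma> \<Longrightarrow> c < k"
  by (auto simp: \<Gamma>_def miss_def)

lemma card_miss_D: "card (miss \<phi> v) \<le> card (miss \<phi> v - D) + 1"
  using diff_card_le_card_Diff[OF D(1), of "miss \<phi> v"] D(2) by linarith

lemma end_miss: "v \<in> en e0 \<Longrightarrow> 1 \<le> card (miss \<phi> v - D)"
  using card_miss_D[of v] card_miss_ge[OF col, of v] s by simp

definition x :: "'v \<Rightarrow> 'v \<Rightarrow> nat" where
  "x u v = card {e \<in> {e \<in> E. e = e0 \<or> \<phi> e \<in> \<Gamma>}. en e = {u, v}}"

text \<open>The edge \<open>e0\<close> adds to the weights in \<open>x\<close> without having a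
  colour, so at its ends the weight exceeds the number of colours present by one.\<close>

definition m :: "'v \<Rightarrow> nat" where
  "m v = card (miss \<phi> v - D) - (if v \<in> en e0 then 1 else 0)"

lemma x_sym: "x u v = x v u"
  by (simp add: x_def insert_commute)

lemma x_irr: "x u u = 0"
proof -
  have "en e \<noteq> {u, u}" if "e \<in> E" for e using card_en[OF that] by auto
  then have "{e \<in> {e \<in> E. e = e0 \<or> \<phi> e \<in> \<Gamma>}. en e = {u, u}} = {}" by blast
  then show ?thesis unfolding x_def by (simp only: card.empty)
qed

lemma x_deg:
  assumes v: "v \<in> S"
  shows "(\<Sum>u\<in>S. x v u) + m v = card \<Gamma>"
proof -
  let ?F = "{e \<in> E. e = e0 \<or> \<phi> e \<in> \<Gamma>}"
  let ?A = "{e \<in> E - {e0}. v \<in> en e \<and> \<phi> e \<in> \<Gamma>}"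
  have "(\<Sum>u\<in>S. x v u) = card {e \<in> ?F. v \<in> en e}"
    unfolding x_def
  proof (rule sum_pairs)
    fix e assume "e \<in> ?F" "v \<in> en e"
    then show "en e \<subseteq> S" using closed[of e] e0_S v by (cases "e = e0") auto
  qed (use v in auto)
  also have "{e \<in> ?F. v \<in> en e} = (if v \<in> en e0 then insert e0 ?A else ?A)" using e0 by auto
  also have "card \<dots> = card ?A + (if v \<in> en e0 then 1 else 0)" using finite_E by simp
  finally have 1: "(\<Sum>u\<in>S. x v u) = card ?A + (if v \<in> en e0 then 1 else 0)" .
  have "inj_on \<phi> ?A" using kadj_colour_unique[OF col] by (auto simp: inj_on_def)
  then have "card (\<phi> ` ?A) = card ?A" by (rule card_image)
  moreover have "\<phi> ` ?A = \<Gamma> - miss \<phi> v" using \<Gamma>_less by (auto simp: miss_def)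
  ultimately have 2: "card ?A = card (\<Gamma> - miss \<phi> v)" by argo
  have "\<Gamma> - miss \<phi> v = \<Gamma> - (miss \<phi> v - D)" by (auto simp: \<Gamma>_def)
  moreover have sub: "miss \<phi> v - D \<subseteq> \<Gamma>" using v by (auto simp: \<Gamma>_def)
  ultimately have "card (\<Gamma> - miss \<phi> v) = card \<Gamma> - card (miss \<phi> v - D)"
    by (simp add: card_Diff_subset)
  moreover have "card (miss \<phi> v - D) \<le> card \<Gamma>" using sub by (intro card_mono) auto
  ultimately show ?thesis using 1 2 end_miss[of v] by (simp add: m_def)
qed

lemma sum_m: "(\<Sum>v\<in>S. m v) + 2 = card \<Gamma>"
proof -
  have "card \<Gamma> = card (\<Union>v\<in>S. miss \<phi> v - D)" by (simp add: \<Gamma>_def)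
  also have "\<dots> = (\<Sum>v\<in>S. card (miss \<phi> v - D))"
    using miss_unique by (intro card_UN_disjoint) auto
  also have "\<dots> = (\<Sum>v\<in>S. m v + (if v \<in> en e0 then 1 else 0))"
    using end_miss by (intro sum.cong) (auto simp: m_def)
  also have "\<dots> = (\<Sum>v\<in>S. m v) + card (S \<inter> en e0)"
    by (simp add: sum.distrib sum.If_cases)
  also have "S \<inter> en e0 = en e0" using e0_S by auto
  finally show ?thesis using card_en[OF e0] by simp
qed

text \<open>A colour of \<open>\<Gamma>\<close> is missing at exactly one vertex of \<open>S\<close>
  by Tashkinov's theorem and never leaves \<open>S\<close> by closedness, so it matches the other
  vertices of \<open>S\<close> among themselves.\<close>

lemma \<Gamma>_count:
  assumes c: "c \<in> \<Gamma>"
  shows "card S = 2 * card {e \<in> E - {e0}. \<phi> e = c \<and> en e \<subseteq> S} + 1"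
proof -
  obtain v where v: "v \<in> S" "c \<in> miss \<phi> v" using c by (auto simp: \<Gamma>_def)
  have "S - {v} = \<Union>(en ` {e \<in> E - {e0}. \<phi> e = c \<and> en e \<subseteq> S})"
  proof (intro equalityI subsetI)
    fix u assume u: "u \<in> S - {v}"
    then have "c \<notin> miss \<phi> u" using miss_unique v by blast
    then obtain e where "e \<in> E - {e0}" "u \<in> en e" "\<phi> e = c" using \<Gamma>_less[OF c] by (auto simp: miss_def)
    then show "u \<in> \<Union>(en ` {e \<in> E - {e0}. \<phi> e = c \<and> en e \<subseteq> S})" using closed[of e] c u by blast
  qed (use v in \<open>auto simp: miss_def\<close>)
  then have "card (S - {v}) = 2 * card {e \<in> E - {e0}. \<phi> e = c \<and> en e \<subseteq> S}"
    using colour_class_card[OF col] by simp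
  then show ?thesis using v card_S by simp
qed

lemma odd_S: "odd (card S)"
proof -
  obtain u where u: "u \<in> en e0" using card_en[OF e0] by fastforce
  then have "miss \<phi> u - D \<noteq> {}" using end_miss[OF u] by (metis card.empty not_one_le_zero)
  then obtain c where "c \<in> \<Gamma>" using u e0_S by (auto simp: \<Gamma>_def)
  then show ?thesis using \<Gamma>_count by simp
qed

lemma x_pos: "e \<in> E \<Longrightarrow> e = e0 \<or> \<phi> e \<in> \<Gamma> \<Longrightarrow> en e = {u, v} \<Longrightarrow> 0 < x u v"
  using finite_E by (auto simp: x_def card_gt_0_iff)

lemma x_connected_root:
  "i \<le> n \<Longrightarrow> (\<lambda>u v. u \<in> S \<and> v \<in> S \<and> 0 < x u v)\<^sup>*\<^sup>* (y 0) (y i)"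
proof (induction i rule: less_induct)
  case (less i)
  consider "i = 0" | "i = 1" | "2 \<le> i" by linarith
  then show ?case
  proof cases
    case 2
    then have "0 < x (y 0) (y i)" using tash x_pos[of e0] e0 by (auto simp: tash_def)
    then show ?thesis using less.prems by (auto simp: S_def intro!: r_into_rtranclp)
  next
    case 3
    then obtain j t where j: "j < i" "en (f i) = {y j, y i}" and t: "t < i" "\<phi> (f i) \<in> miss \<phi> (y t)"
      and fi: "f i \<in> E" using tash_edge[OF tash _ less.prems] by blast
    have "\<phi> (f i) \<in> \<Gamma>" using t avoids less.prems 3 by (auto simp: \<Gamma>_def S_def avoids_def)
    then have "0 < x (y j) (y i)" using x_pos[OF fi] j by blast
    then show ?thesis using less.IH[OF j(1)] j less.prems
      by (auto simp: S_def intro!: rtranclp.rtrancl_into_rtrancl[of _ "y 0" "y j"])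
  qed auto
qed

lemma x_connected:
  assumes "u \<in> S" "v \<in> S"
  shows "(\<lambda>u v. u \<in> S \<and> v \<in> S \<and> 0 < x u v)\<^sup>*\<^sup>* u v"
proof -
  let ?R = "\<lambda>u v. u \<in> S \<and> v \<in> S \<and> 0 < x u v"
  have "?R\<^sup>*\<^sup>* (y 0) u" "?R\<^sup>*\<^sup>* (y 0) v" using assms x_connected_root by (auto simp: S_def)
  moreover have "?R\<^sup>*\<^sup>* u (y 0)"
    by (rule rtranclp_symmetric[OF _ \<open>?R\<^sup>*\<^sup>* (y 0) u\<close>]) (use x_sym in auto)
  ultimately show ?thesis by (meson rtranclp_trans)
qed

lemma x_edge: "0 < x u v \<Longrightarrow> \<exists>f\<in>E. en f = {u, v}"
  by (auto simp: x_def card_gt_0_iff)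

lemma not_bipartite:
  assumes "A \<subseteq> S" "\<And>u v. u \<in> S \<Longrightarrow> v \<in> S \<Longrightarrow> 0 < x u v \<Longrightarrow> (u \<in> A) \<noteq> (v \<in> A)"
  shows False
  using weights_not_bipartite[OF finite_S x_sym x_deg sum_m odd_S assms] by blast


lemma in_S_of_tash:
  assumes T: "tash \<phi> n' y' f'" and D0: "D = {}" and i: "i \<le> n'"
  shows "y' i \<in> S"
  using i
proof (induction i rule: less_induct)
  case (less i)
  consider "i \<le> 1" | "2 \<le> i" by linarith
  then show ?case
  proof cases
    case 1
    then have "y' i \<in> en e0" using T by (auto simp: tash_def le_Suc_eq)
    then show ?thesis using e0_S by blast
  next
    case 2
    obtain j where j: "j < i" "en (f' i) = {y' j, y' i}" using tash_edge(2)[OF T 2 less.prems] by blast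
    obtain t where t: "t < i" "\<phi> (f' i) \<in> miss \<phi> (y' t)" using tash_edge(3)[OF T 2 less.prems] by blast
    have "y' t \<in> S" "y' j \<in> S" using less.IH j t less.prems by auto
    moreover have "\<phi> (f' i) \<notin> D" using D0 by simp
    ultimately have "\<phi> (f' i) \<in> \<Gamma>" unfolding \<Gamma>_def using t(2) by blast
    then have "en (f' i) \<subseteq> S"
      using closed[OF tash_edge(1)[OF T 2 less.prems]] j(2) \<open>y' j \<in> S\<close> by blast
    then show ?thesis using j by simp
  qed
qed

end

section \<open>Colours crossing the boundary of a maximal tree\<close>

locale maximal_tree = closed_tree E en k s e0 \<mu> h g \<phi> "{}" n y f
  for E :: "'e set" and en :: "'e \<Rightarrow> 'v set" and k s :: nat and e0 :: 'e and \<mu> h g :: nat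
    and \<phi> :: "'e \<Rightarrow> nat" and n :: nat and y :: "nat \<Rightarrow> 'v" and f :: "nat \<Rightarrow> 'e" +
  assumes max: "col \<psi> \<Longrightarrow> tash \<psi> n' y' f' \<Longrightarrow> n' \<le> n"
begin

lemma edge_girth:
  assumes "cyc R vs" "\<And>u v. R u v \<Longrightarrow> \<exists>f\<in>E. en f = {u, v}"
  shows "g \<le> length vs"
  by (rule girth, rule cyc_mono[OF assms])

sublocale W: ring_weights S x m "card \<Gamma>" \<mu> h s g
proof
  show "x u v \<le> \<mu>" for u v
  proof -
    have "x u v \<le> card {f \<in> E. en f = {u, v}}"
      unfolding x_def using finite_E by (intro card_mono) auto
    then show ?thesis using mult[of u v] by simp
  qed
  show "v \<in> S \<Longrightarrow> s \<le> m v" for v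
    using card_miss_ge[OF col, of v] by (auto simp: m_def)
  show "cyc (\<lambda>u v. u \<in> S \<and> v \<in> S \<and> 0 < x u v) vs \<Longrightarrow> g \<le> length vs" for vs
    by (erule edge_girth) (use x_edge in auto)
qed (use x_sym x_irr x_deg sum_m s \<mu> odd_S h g x_connected in auto)

text \<open>A proper part of a cycle is bipartite, so every maximal tree avoiding a single colour
  already spans \<open>S\<close>.\<close>

lemma spanning_tree_avoiding:
  "\<exists>n' y' f'. tash \<phi> n' y' f' \<and> avoids \<phi> {\<delta>} n' f' \<and> y' ` {..n'} = S"
proof -
  obtain n' y' f' where ct: "closed_tree \<phi> {\<delta>} n' y' f'" using ex_closed_tree[OF col] by blast
  interpret A: closed_tree E en k s e0 \<mu> h g \<phi> "{\<delta>}" n' y' f'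
    by unfold_locales (use ct in auto)
  have sub: "A.S \<subseteq> S" using in_S_of_tash[OF A.tash] by (auto simp: A.S_def)
  have sub\<Gamma>: "A.\<Gamma> \<subseteq> \<Gamma>" using sub by (auto simp: A.\<Gamma>_def \<Gamma>_def)
  have "A.S = S"
  proof (rule ccontr)
    assume "A.S \<noteq> S"
    then obtain v0 where v0: "v0 \<in> S" "v0 \<notin> A.S" using sub by blast
    obtain cs where cs: "cyc W.adj cs" "set cs = S" "cs ! 0 = v0"
        and consec: "\<And>u v. W.adj u v \<Longrightarrow> \<exists>i<length cs. {u, v} = {cs ! i, cs ! ((i + 1) mod length cs)}"
      using W.ring_structure[OF v0(1)] by blast
    \<comment> \<open>Since \<open>v0\<close> has index 0 and lies outside \<open>A.S\<close>, no
      edge inside \<open>A.S\<close> wraps around the end of the list, and the parity of the index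
      is a bipartition.\<close>
    define B where "B = {v \<in> A.S. \<exists>i<length cs. v = cs ! i \<and> even i}"
    have dist: "distinct cs" using cs by (simp add: cyc_def)
    have inB: "cs ! i \<in> B \<longleftrightarrow> even i" if "i < length cs" "cs ! i \<in> A.S" for i
      using that dist by (auto simp: B_def nth_eq_iff_index_eq)
    show False
    proof (rule A.not_bipartite[of B])
      show "B \<subseteq> A.S" by (auto simp: B_def)
      fix u v assume uv: "u \<in> A.S" "v \<in> A.S" "0 < A.x u v"
      have "A.x u v \<le> x u v"
        unfolding A.x_def x_def using finite_E sub\<Gamma> by (intro card_mono) auto
      then have "W.adj u v" using uv sub by (auto simp: W.adj_def)
      then obtain i where i: "i < length cs" "{u, v} = {cs ! i, cs ! ((i + 1) mod length cs)}"
        using consec by blast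
      then have in_A: "cs ! i \<in> A.S" "cs ! ((i + 1) mod length cs) \<in> A.S" using uv by (auto simp: doubleton_eq_iff)
      have "(i + 1) mod length cs \<noteq> 0" using in_A(2) v0(2) cs(3) by metis
      then have i1: "i + 1 < length cs" using i(1) by (metis Suc_eq_plus1 Suc_lessI mod_self)
      then have "(cs ! i \<in> B) \<noteq> (cs ! ((i + 1) mod length cs) \<in> B)"
        using inB[of i] inB[of "i + 1"] in_A i(1) by simp
      then show "(u \<in> B) \<noteq> (v \<in> B)" using i(2) by (auto simp: doubleton_eq_iff)
    qed
  qed
  then show ?thesis using A.tash A.avoids by (auto simp: A.S_def)
qed

text \<open>A boundary edge \<open>eb\<close> is chosen whose outer end \<open>b\<close> is the only
  one in its \<alpha>/\<gamma>-component outside \<open>S\<close>. Its inner end \<open>u\<close>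
  misses some \<delta>, which depends on \<open>b\<close>; therefore the choice is made with a fixed
  \<alpha>, and \<alpha> and \<delta> are exchanged outside afterwards. Exchanging \<gamma> and
  \<delta> along \<open>eb\<close> and the component then makes \<gamma> missing at
  \<open>u\<close>. A spanning tree that avoids \<delta> survives all this, and any second boundary
  edge still has colour \<gamma> and extends it. This contradicts maximality, which ranges over all
  colourings.\<close>

lemma boundary_single:
  assumes \<gamma>: "\<gamma> < k" "\<gamma> \<notin> \<Gamma>"
  defines "Bd \<equiv> {e \<in> E - {e0}. \<phi> e = \<gamma> \<and> en e \<inter> S \<noteq> {} \<and> \<not> en e \<subseteq> S}"
  assumes oddB: "odd (card Bd)"
  shows "card Bd = 1"
proof (rule ccontr)
  assume c1: "card Bd \<noteq> 1"
  have finBd: "finite Bd" using finite_E by (simp add: Bd_def)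
  obtain u0 where u0: "u0 \<in> S" using e0_S card_en[OF e0] by fastforce
  obtain \<alpha> where \<alpha>: "\<alpha> \<in> miss \<phi> u0" using miss_nonempty[OF col] by blast
  have \<alpha>\<Gamma>: "\<alpha> \<in> \<Gamma>" using \<alpha> u0 by (auto simp: \<Gamma>_def)
  define R where "R = (\<lambda>u v. u \<notin> S \<and> v \<notin> S \<and> kadj \<phi> \<alpha> \<gamma> u v)"
  have R_sym: "R u v \<Longrightarrow> R v u" for u v using kadj_sym by (auto simp: R_def)
  define B where "B = {b. b \<notin> S \<and> (\<exists>e\<in>Bd. b \<in> en e)}"
  have bd_split: "\<exists>u b. en e = {u, b} \<and> u \<in> S \<and> b \<notin> S" if e: "e \<in> Bd" for e
  proof -
    obtain u where u: "u \<in> en e" "u \<in> S" using e by (auto simp: Bd_def)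
    obtain b where "en e = {u, b}" using en_pairE[of e u] u e by (auto simp: Bd_def)
    then show ?thesis using e u by (auto simp: Bd_def)
  qed
  define outer where "outer = (\<lambda>e. THE b. b \<in> en e \<and> b \<notin> S)"
  have outer: "outer e \<in> en e \<and> outer e \<notin> S" "\<And>b. b \<in> en e \<Longrightarrow> b \<notin> S \<Longrightarrow> b = outer e" if e: "e \<in> Bd" for e
  proof -
    have ex1: "\<exists>!b. b \<in> en e \<and> b \<notin> S" using bd_split[OF e] by auto
    show "outer e \<in> en e \<and> outer e \<notin> S" unfolding outer_def by (rule theI'[OF ex1])
    then show "\<And>b. b \<in> en e \<Longrightarrow> b \<notin> S \<Longrightarrow> b = outer e" using ex1 by blast
  qed
  have uniq\<gamma>: "e = e'" if "e \<in> Bd" "e' \<in> E - {e0}" "\<phi> e' = \<gamma>" "v \<in> en e" "v \<in> en e'" for e e' v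
    using kadj_colour_unique[OF col, of e e' v] that by (auto simp: Bd_def)
  have "outer ` Bd = B"
    using outer by (auto simp: B_def image_iff)
  moreover have "inj_on outer Bd"
  proof (rule inj_onI)
    fix e e' assume e: "e \<in> Bd" "e' \<in> Bd" "outer e = outer e'"
    then have "e' \<in> E - {e0}" "\<phi> e' = \<gamma>" by (auto simp: Bd_def)
    then show "e = e'" using uniq\<gamma>[OF e(1), of e' "outer e"] outer(1)[OF e(1)] outer(1)[OF e(2)] e(3) by simp
  qed
  ultimately have cardB: "card B = card Bd" and finB: "finite B"
    using card_image[of outer Bd] finBd by auto
  have R1: "p = q" if b: "b \<in> B" and "R b p" "R b q" for b p q
  proof -
    obtain e where e: "e \<in> Bd" "b \<in> en e" using b by (auto simp: B_def)
    obtain ep where ep: "ep \<in> E - {e0}" "en ep = {b, p}" "\<phi> ep \<in> {\<alpha>, \<gamma>}" "p \<notin> S"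
      using \<open>R b p\<close> by (auto simp: R_def kadj_def)
    obtain eq where eq: "eq \<in> E - {e0}" "en eq = {b, q}" "\<phi> eq \<in> {\<alpha>, \<gamma>}" "q \<notin> S"
      using \<open>R b q\<close> by (auto simp: R_def kadj_def)
    have bS: "b \<notin> S" using b by (simp add: B_def)
    have not\<gamma>: "\<phi> e' \<noteq> \<gamma>" if "e' \<in> E - {e0}" "en e' = {b, r}" "r \<notin> S" for e' r
    proof
      assume "\<phi> e' = \<gamma>"
      then have "e = e'" using uniq\<gamma>[OF e(1) that(1) _ e(2)] that(2) by simp
      then show False using e(1) that bS by (auto simp: Bd_def)
    qed
    have "\<phi> ep = \<alpha>" using not\<gamma>[OF ep(1,2,4)] ep(3) by simp
    moreover have "\<phi> eq = \<alpha>" using not\<gamma>[OF eq(1,2,4)] eq(3) by simp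
    ultimately have "\<phi> ep = \<phi> eq" by simp
    then have "ep = eq" using kadj_colour_unique[OF col ep(1) eq(1), of b] ep eq by simp
    then show ?thesis using ep eq by (auto simp: doubleton_eq_iff)
  qed
  have R2: "p = q \<or> p = r \<or> q = r" if "R v p" "R v q" "R v r" for v p q r
    using kadj_deg2[OF col] that unfolding R_def by blast
  \<comment> \<open>The components of \<open>R\<close> are paths or cycles whose vertices in \<open>B\<close> are ends, hence at most two
    per component; as \<open>card B\<close> is odd, some component contains just one.\<close>
  have "\<exists>b\<in>B. \<forall>b'\<in>B. R\<^sup>*\<^sup>* b b' \<longrightarrow> b' = b"
  proof (rule ccontr)
    assume "\<not> (\<exists>b\<in>B. \<forall>b'\<in>B. R\<^sup>*\<^sup>* b b' \<longrightarrow> b' = b)"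
    then have partner: "\<exists>b'\<in>B. R\<^sup>*\<^sup>* b b' \<and> b' \<noteq> b" if "b \<in> B" for b using that by blast
    let ?z = "\<lambda>b b'. if b \<noteq> b' \<and> R\<^sup>*\<^sup>* b b' then 1 else 0 :: nat"
    have row: "(\<Sum>b'\<in>B. ?z b b') = 1" if b: "b \<in> B" for b
    proof -
      obtain b1 where b1: "b1 \<in> B" "R\<^sup>*\<^sup>* b b1" "b1 \<noteq> b" using partner[OF b] by blast
      have "b2 = b1" if b2: "b2 \<in> B" "R\<^sup>*\<^sup>* b b2" "b2 \<noteq> b" for b2
      proof (rule ccontr)
        assume "b2 \<noteq> b1"
        then show False
          using component_at_most_two_ends[of R b b1 b2] R_sym R2 R1 b b1 b2 by blast
      qed
      then have "{b' \<in> B. b \<noteq> b' \<and> R\<^sup>*\<^sup>* b b'} = {b1}" using b1 by blast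
      moreover have "(\<Sum>b'\<in>B. ?z b b') = card {b' \<in> B. b \<noteq> b' \<and> R\<^sup>*\<^sup>* b b'}"
        using finB by (simp add: sum.If_cases Int_def)
      ultimately show ?thesis by simp
    qed
    have "even (\<Sum>b\<in>B. \<Sum>b'\<in>B. ?z b b')"
      using finB rtranclp_symmetric[of R, OF R_sym] by (intro even_symmetric_sum) auto
    then show False using row oddB cardB by simp
  qed
  then obtain b where b: "b \<in> B" and alone: "\<And>b'. b' \<in> B \<Longrightarrow> R\<^sup>*\<^sup>* b b' \<Longrightarrow> b' = b" by blast
  obtain eb where eb: "eb \<in> Bd" "b \<in> en eb" using b by (auto simp: B_def)
  have bS: "b \<notin> S" using b by (simp add: B_def)
  obtain u b' where ub: "en eb = {u, b'}" "u \<in> S" "b' \<notin> S" using bd_split[OF eb(1)] by blast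
  then have "b' = b" using eb(2) bS by auto
  then have u: "en eb = {u, b}" "u \<in> S" using ub by simp_all
  obtain \<delta> where \<delta>: "\<delta> \<in> miss \<phi> u" using miss_nonempty[OF col] by blast
  have \<delta>\<Gamma>: "\<delta> \<in> \<Gamma>" using \<delta> u by (auto simp: \<Gamma>_def)
  have lt: "\<alpha> < k" "\<delta> < k" using \<Gamma>_less \<alpha>\<Gamma> \<delta>\<Gamma> by auto
  have \<gamma>ne: "\<gamma> \<noteq> \<alpha>" "\<gamma> \<noteq> \<delta>" using \<gamma> \<alpha>\<Gamma> \<delta>\<Gamma> by auto
  \<comment> \<open>Outside \<open>S\<close> the colours \<open>\<alpha>\<close> and \<open>\<delta>\<close> can be exchanged, as neither of them crosses the boundary.\<close>
  define \<phi>1 where "\<phi>1 = kswap \<phi> \<alpha> \<delta> (- S)"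
  have cl1: "kclosed \<phi> \<alpha> \<delta> (- S)"
    unfolding kclosed_def using closed \<alpha>\<Gamma> \<delta>\<Gamma> by blast
  have col1: "col \<phi>1" unfolding \<phi>1_def by (rule col_kswap[OF col lt cl1])
  have miss1: "miss \<phi>1 v = miss \<phi> v" if "v \<in> S" for v
    using miss_kswap[OF lt cl1] that by (auto simp: \<phi>1_def)
  have \<phi>1_in: "\<phi>1 e = \<phi> e" if "en e \<subseteq> S" for e using that by (auto simp: \<phi>1_def kswap_def)
  have \<phi>1_\<gamma>: "\<phi>1 e = \<gamma> \<longleftrightarrow> \<phi> e = \<gamma>" for e
    using \<gamma>ne by (auto simp: \<phi>1_def kswap_def transpose_def)
  \<comment> \<open>With \<alpha> replaced by \<delta> outside \<open>S\<close>, this is a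
    \<gamma>/\<delta>-chain: it enters \<open>S\<close> only through \<open>eb\<close> and stops at
    \<open>u\<close>, where \<delta> is missing.\<close>
  define K where "K = insert u {w. R\<^sup>*\<^sup>* b w}"
  have K_out: "w \<notin> S" if "R\<^sup>*\<^sup>* b w" for w
    using that bS by (induction rule: rtranclp_induct) (auto simp: R_def)
  have R_edge: "R\<^sup>*\<^sup>* b w'" if "R\<^sup>*\<^sup>* b w" "e \<in> E - {e0}" "en e = {w, w'}" "w' \<notin> S" "\<phi> e \<in> {\<alpha>, \<gamma>}" for w w' e
  proof -
    have "kadj \<phi> \<alpha> \<gamma> w w'" unfolding kadj_def using that(2,3,5) by blast
    then have "R w w'" using K_out[OF that(1)] that(4) by (simp add: R_def)
    then show ?thesis using that(1) by simp
  qed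
  have cl2: "kclosed \<phi>1 \<gamma> \<delta> K"
    unfolding kclosed_def
  proof (intro ballI impI)
    fix e assume e: "e \<in> E - {e0}" "\<phi>1 e \<in> {\<gamma>, \<delta>}" "en e \<inter> K \<noteq> {}"
    show "en e \<subseteq> K"
    proof (cases "u \<in> en e")
      case True
      have "\<phi>1 e \<noteq> \<delta>" using miss1[OF u(2)] \<delta> e(1) True by (auto simp: miss_def)
      then have "\<phi> e = \<gamma>" using e \<phi>1_\<gamma> by auto
      then have "e = eb" using uniq\<gamma>[OF eb(1) e(1), of u] True u by simp
      then show ?thesis using u by (auto simp: K_def)
    next
      case False
      then obtain w where w: "w \<in> en e" "R\<^sup>*\<^sup>* b w" using e(3) by (auto simp: K_def)
      obtain w' where w': "en e = {w, w'}" using en_pairE[of e w] e w by auto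
      have wS: "w \<notin> S" using K_out w by blast
      show ?thesis
      proof (cases "\<phi> e = \<gamma>")
        case True
        show ?thesis
        proof (cases "w' \<in> S")
          case in_S: True
          then have "e \<in> Bd" using e(1) \<open>\<phi> e = \<gamma>\<close> w' wS by (auto simp: Bd_def)
          then have "w \<in> B" using w wS by (auto simp: B_def)
          then have "w = b" using alone w by blast
          then have "e = eb" using uniq\<gamma>[OF eb(1) e(1) \<open>\<phi> e = \<gamma>\<close> eb(2)] w by blast
          then show ?thesis using u by (auto simp: K_def)
        next
          case out_S: False
          then show ?thesis using R_edge[OF w(2) e(1) w' out_S] \<open>\<phi> e = \<gamma>\<close> w w' by (auto simp: K_def)
        qed
      next
        case False
        then have "\<phi>1 e = \<delta>" using e(2) \<phi>1_\<gamma> by auto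
        moreover have "\<phi>1 e = transpose \<alpha> \<delta> (\<phi> e)" using w wS by (auto simp: \<phi>1_def kswap_def)
        ultimately have \<phi>e: "\<phi> e = \<alpha>" by (metis transpose_apply_second transpose_involutory)
        then have "w' \<notin> S" using closed[OF e(1)] \<alpha>\<Gamma> w' wS by auto
        then show ?thesis using R_edge[OF w(2) e(1) w'] \<phi>e w w' by (auto simp: K_def)
      qed
    qed
  qed
  define \<psi> where "\<psi> = kswap \<phi>1 \<gamma> \<delta> K"
  have col2: "col \<psi>" unfolding \<psi>_def by (rule col_kswap[OF col1 \<gamma>(1) lt(2) cl2])
  have KS: "K \<inter> S = {u}" using K_out u by (auto simp: K_def)
  have miss2: "c \<in> miss \<psi> v" if "v \<in> S" "c \<in> miss \<phi> v" "c \<noteq> \<gamma>" "c \<noteq> \<delta>" for v c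
    using miss_kswap[OF \<gamma>(1) lt(2) cl2, of c v] that miss1[OF that(1)]
    by (auto simp: \<psi>_def transpose_def)
  have miss_u: "\<gamma> \<in> miss \<psi> u"
    using miss_kswap[OF \<gamma>(1) lt(2) cl2, of \<gamma> u] miss1[OF u(2)] \<delta> by (simp add: \<psi>_def K_def)
  obtain n' y' f' where T: "tash \<phi> n' y' f'" "avoids \<phi> {\<delta>} n' f'" "y' ` {..n'} = S"
    using spanning_tree_avoiding by blast
  have "tash \<psi> n' y' f'"
    unfolding tash_def
  proof (intro conjI allI impI)
    fix i assume i: "2 \<le> i \<and> i \<le> n'"
    note ed = tash_edge[OF T(1), of i]
    show "f' i \<in> E - {e0}" "\<exists>j<i. en (f' i) = {y' j, y' i}" using ed i by auto
    obtain j where j: "j < i" "en (f' i) = {y' j, y' i}" using ed(2) i by blast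
    obtain t where t: "t < i" "\<phi> (f' i) \<in> miss \<phi> (y' t)" using ed(3) i by blast
    have inS: "y' r \<in> S" if "r \<le> i" for r using that T(3) i by (metis atMost_iff imageI order_trans)
    have c: "\<phi> (f' i) \<noteq> \<delta>" "\<phi> (f' i) \<noteq> \<gamma>"
      using T(2) i t inS[of t] \<gamma>(2) by (auto simp: avoids_def \<Gamma>_def)
    have "\<phi>1 (f' i) = \<phi> (f' i)" using \<phi>1_in[of "f' i"] j inS by simp
    then have "\<psi> (f' i) = \<phi> (f' i)" using c by (auto simp: \<psi>_def kswap_def transpose_def)
    then show "\<exists>j<i. \<psi> (f' i) \<in> miss \<psi> (y' j)" using miss2[OF inS[of t] t(2)] c t(1) by auto
  qed (use T(1) in \<open>auto simp: tash_def\<close>)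
  moreover have "n' = n"
  proof -
    have "card S = Suc n'" using T(1,3) card_image[of y' "{..n'}"] by (simp add: tash_def)
    then show ?thesis using card_S by simp
  qed
  ultimately have T2: "tash \<psi> n y' f'" by simp
  have "\<exists>e\<in>Bd. e \<noteq> eb"
  proof (rule ccontr)
    assume "\<not> (\<exists>e\<in>Bd. e \<noteq> eb)"
    then have "Bd = {eb}" using eb(1) by blast
    then show False using c1 by simp
  qed
  then obtain e where e: "e \<in> Bd" "e \<noteq> eb" by blast
  obtain v w where vw: "en e = {v, w}" "v \<in> S" "w \<notin> S" using bd_split[OF e(1)] by blast
  have eE: "e \<in> E - {e0}" "\<phi> e = \<gamma>" using e by (auto simp: Bd_def)
  have "v \<noteq> u" using uniq\<gamma>[OF eb(1) eE, of u] e(2) u vw by auto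
  moreover have "\<not> R\<^sup>*\<^sup>* b w"
  proof
    assume "R\<^sup>*\<^sup>* b w"
    moreover have "w \<in> B" using vw e by (auto simp: B_def)
    ultimately have "w = b" using alone by blast
    then show False using uniq\<gamma>[OF eb(1) eE eb(2)] e(2) vw by auto
  qed
  moreover have "w \<noteq> u" using vw u by auto
  moreover have "\<not> R\<^sup>*\<^sup>* b v" using K_out vw by blast
  ultimately have "en e \<inter> K = {}" using vw(1) by (auto simp: K_def)
  then have \<psi>e: "\<psi> e = \<gamma>" using \<phi>1_\<gamma> eE by (simp add: \<psi>_def kswap_def)
  obtain j where j: "j \<le> n" "v = y' j" using T(3) vw(2) \<open>n' = n\<close> by auto
  obtain t where t: "t \<le> n" "u = y' t" using T(3) u(2) \<open>n' = n\<close> by auto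
  have "tash \<psi> (Suc n) (y'(Suc n := w)) (f'(Suc n := e))"
    using tash_extend[OF T2 eE(1) j(1), of w t] vw j t miss_u \<psi>e T(3) \<open>n' = n\<close> by simp
  then show False using max[OF col2] by fastforce
qed

text \<open>A colour outside \<open>\<Gamma>\<close> is present at every vertex of \<open>S\<close>.
  Its edges inside \<open>S\<close> cover an even number of vertices, so an odd number of its edges
  cross the boundary, hence exactly one.\<close>

lemma colour_count:
  assumes c: "c < k"
  shows "card S = 2 * card {e \<in> E - {e0}. \<phi> e = c \<and> en e \<subseteq> S} + 1"
proof (cases "c \<in> \<Gamma>")
  case True
  then show ?thesis by (rule \<Gamma>_count)
next
  case False
  define Bd where "Bd = {e \<in> E - {e0}. \<phi> e = c \<and> en e \<inter> S \<noteq> {} \<and> \<not> en e \<subseteq> S}"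
  define In where "In = {e \<in> E - {e0}. \<phi> e = c \<and> en e \<subseteq> S}"
  have cardIn: "card (\<Union>(en ` In)) = 2 * card In" unfolding In_def by (rule colour_class_card[OF col])
  have single: "card (en e \<inter> S) = 1" if e: "e \<in> Bd" for e
  proof -
    obtain u where u: "u \<in> en e" "u \<in> S" using e by (auto simp: Bd_def)
    obtain b where "en e = {u, b}" using en_pairE[of e u] u e by (auto simp: Bd_def)
    then have "en e \<inter> S = {u}" using e u by (auto simp: Bd_def)
    then show ?thesis by simp
  qed
  have finBd: "finite Bd" using finite_E by (simp add: Bd_def)
  have "card (\<Union>e\<in>Bd. en e \<inter> S) = (\<Sum>e\<in>Bd. card (en e \<inter> S))"
  proof (rule card_UN_disjoint)
    show "\<forall>e\<in>Bd. \<forall>j\<in>Bd. e \<noteq> j \<longrightarrow> en e \<inter> S \<inter> (en j \<inter> S) = {}"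
      using kadj_colour_unique[OF col] unfolding Bd_def by blast
  qed (use finBd in auto)
  then have cardBd: "card (\<Union>e\<in>Bd. en e \<inter> S) = card Bd" using single by simp
  have S: "S = \<Union>(en ` In) \<union> (\<Union>e\<in>Bd. en e \<inter> S)"
  proof (intro equalityI subsetI)
    fix u assume u: "u \<in> S"
    then have "c \<notin> miss \<phi> u" using False by (auto simp: \<Gamma>_def)
    then obtain e where "e \<in> E - {e0}" "u \<in> en e" "\<phi> e = c" using c by (auto simp: miss_def)
    then show "u \<in> \<Union>(en ` In) \<union> (\<Union>e\<in>Bd. en e \<inter> S)" using u unfolding In_def Bd_def by blast
  qed (auto simp: In_def)
  have disj: "\<Union>(en ` In) \<inter> (\<Union>e\<in>Bd. en e \<inter> S) = {}"
    using kadj_colour_unique[OF col] unfolding In_def Bd_def by blast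
  have "card S = card (\<Union>(en ` In)) + card (\<Union>e\<in>Bd. en e \<inter> S)"
    using card_Un_disjoint[OF _ _ disj] S finite_S by (metis finite_Un)
  then have tot: "card S = 2 * card In + card Bd" using cardIn cardBd by simp
  then have "odd (card Bd)" using odd_S by simp
  then have "card Bd = 1" using boundary_single[OF c False] unfolding Bd_def by blast
  then show ?thesis using tot by (simp add: In_def)
qed

section \<open>All edges inside a maximal tree\<close>

definition ES :: "'e set" where "ES = {e \<in> E. en e \<subseteq> S}"

lemma card_ES: "2 * card ES = k * (card S - 1) + 2"
proof -
  let ?C = "\<lambda>c. {e \<in> E - {e0}. \<phi> e = c \<and> en e \<subseteq> S}"
  have "ES = insert e0 (\<Union>c\<in>{..<k}. ?C c)"
    using e0 e0_S col by (auto simp: ES_def proper_on_def)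
  moreover have "card (\<Union>c\<in>{..<k}. ?C c) = (\<Sum>c<k. card (?C c))"
    using finite_E by (intro card_UN_disjoint) auto
  moreover have "finite (\<Union>c\<in>{..<k}. ?C c)" using finite_E by auto
  moreover have "e0 \<notin> (\<Union>c\<in>{..<k}. ?C c)" by auto
  ultimately have "card ES = (\<Sum>c<k. card (?C c)) + 1" by simp
  moreover have "2 * (\<Sum>c<k. card (?C c)) = (\<Sum>c<k. card S - 1)"
    unfolding sum_distrib_left using colour_count by (intro sum.cong) auto
  ultimately show ?thesis by simp
qed

text \<open>As \<open>card S\<close> is odd, a colour class inside \<open>S\<close> has at most
  \<open>(card S - 1) / 2\<close> edges, and \<open>card_ES\<close> is one more than
  \<open>k\<close> such classes can hold.\<close>

lemma not_colorable_ES: "\<not> proper_on ES en k c"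
proof
  assume c: "proper_on ES en k c"
  let ?C = "\<lambda>i. {e \<in> ES. c e = i}"
  have finES: "finite ES" using finite_E by (simp add: ES_def)
  have "2 * card (?C i) \<le> card S - 1" for i
  proof -
    have "card (\<Union>(en ` ?C i)) = 2 * card (?C i)"
      using c by (intro matching_card) (auto simp: ES_def proper_on_def)
    moreover have "card (\<Union>(en ` ?C i)) \<le> card S" by (intro card_mono) (auto simp: ES_def)
    ultimately have "2 * card (?C i) \<le> card S" by simp
    moreover have "2 * card (?C i) \<noteq> card S" using odd_S by (metis even_mult_iff even_numeral)
    ultimately show ?thesis by linarith
  qed
  then have "(\<Sum>i<k. 2 * card (?C i)) \<le> (\<Sum>i<k. card S - 1)" by (intro sum_mono)
  moreover have "ES = (\<Union>i\<in>{..<k}. ?C i)" using c by (auto simp: proper_on_def)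
  then have "card ES = (\<Sum>i<k. card (?C i))"
    using finES card_UN_disjoint[of "{..<k}" ?C] by auto
  ultimately show False using card_ES by (simp add: sum_distrib_left[symmetric])
qed

definition z :: "'v \<Rightarrow> 'v \<Rightarrow> nat" where "z u v = card {e \<in> ES. en e = {u, v}}"

lemma sum_z: "v \<in> S \<Longrightarrow> (\<Sum>u\<in>S. z v u) = card {e \<in> ES. v \<in> en e}"
  unfolding z_def by (rule sum_pairs) (auto simp: ES_def)

lemma sum_sum_z: "(\<Sum>v\<in>S. \<Sum>u\<in>S. z v u) = k * (card S - 1) + 2"
proof -
  have fin: "finite ES" using finite_E by (simp add: ES_def)
  have "(\<Sum>v\<in>S. \<Sum>u\<in>S. z v u) = (\<Sum>v\<in>S. card {e \<in> ES. v \<in> en e})" using sum_z by (intro sum.cong) auto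
  also have "\<dots> = (\<Sum>v\<in>S. \<Sum>e\<in>ES. if v \<in> en e then 1 else 0)"
    using fin by (simp add: sum.If_cases Int_def)
  also have "\<dots> = (\<Sum>e\<in>ES. \<Sum>v\<in>S. if v \<in> en e then 1 else 0)" by (rule sum.swap)
  also have "\<dots> = (\<Sum>e\<in>ES. 2)"
  proof (rule sum.cong[OF refl])
    fix e assume "e \<in> ES"
    then have "S \<inter> {v. v \<in> en e} = en e" "card (en e) = 2" using card_en by (auto simp: ES_def)
    then show "(\<Sum>v\<in>S. if v \<in> en e then 1 else 0) = (2::nat)" by (simp add: sum.If_cases)
  qed
  finally show ?thesis using card_ES by simp
qed

lemma z_le_degree: "v \<in> S \<Longrightarrow> (\<Sum>u\<in>S. z v u) + s \<le> k"
proof -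
  assume v: "v \<in> S"
  have "card {e \<in> ES. v \<in> en e} \<le> card {e \<in> E. v \<in> en e}"
    using finite_E by (intro card_mono) (auto simp: ES_def)
  then show ?thesis using sum_z[OF v] degree[of v] by simp
qed

text \<open>With \<open>k\<close> in the role of \<open>M\<close>, the deficits
  \<open>k - (\<Sum>u\<in>S. z v u)\<close> add up to \<open>k - 2\<close> precisely because of the
  edge count \<open>card_ES\<close>; so the weights \<open>z\<close> of all edges inside
  \<open>S\<close> satisfy the same axioms as \<open>x\<close>.\<close>

theorem ring_exists:
  "\<exists>cs. cyc (\<lambda>u v. \<exists>e\<in>E. en e = {u, v}) cs \<and>
     (\<forall>e\<in>E. en e \<subseteq> set cs \<longrightarrow> (\<exists>i<length cs. en e = {cs ! i, cs ! ((i + 1) mod length cs)})) \<and>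
     (\<forall>c. \<not> proper_on {e \<in> E. en e \<subseteq> set cs} en k c)"
proof -
  have z_edge: "\<exists>f\<in>E. en f = {u, v}" if "0 < z u v" for u v
    using that by (auto simp: z_def ES_def card_gt_0_iff)
  interpret Z: ring_weights S z "\<lambda>v. k - (\<Sum>u\<in>S. z v u)" k \<mu> h s g
  proof
    show "z u v = z v u" for u v by (simp add: z_def insert_commute)
    show "z u u = 0" for u
    proof -
      have "en e \<noteq> {u, u}" if "e \<in> ES" for e using card_en[of e] that by (auto simp: ES_def)
      then have "{e \<in> ES. en e = {u, u}} = {}" by blast
      then show ?thesis unfolding z_def by (simp only: card.empty)
    qed
    show "z u v \<le> \<mu>" for u v
    proof -
      have "z u v \<le> card {f \<in> E. en f = {u, v}}"
        unfolding z_def using finite_E by (intro card_mono) (auto simp: ES_def)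
      then show ?thesis using mult[of u v] by simp
    qed
    show "(\<Sum>u\<in>S. z v u) + (k - (\<Sum>u\<in>S. z v u)) = k" if "v \<in> S" for v using z_le_degree[OF that] by simp
    show "s \<le> k - (\<Sum>u\<in>S. z v u)" if "v \<in> S" for v using z_le_degree[OF that] by linarith
    show "(\<Sum>v\<in>S. k - (\<Sum>u\<in>S. z v u)) + 2 = k"
    proof -
      have "(\<Sum>v\<in>S. k - (\<Sum>u\<in>S. z v u)) + (\<Sum>v\<in>S. \<Sum>u\<in>S. z v u) = (\<Sum>v\<in>S. k)"
        unfolding sum.distrib[symmetric] using z_le_degree by (intro sum.cong) fastforce+
      also have "\<dots> = k * (card S - 1) + k" using card_S by (simp add: algebra_simps)
      finally show ?thesis using sum_sum_z by simp
    qed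
    show "cyc (\<lambda>u v. u \<in> S \<and> v \<in> S \<and> 0 < z u v) vs \<Longrightarrow> g \<le> length vs" for vs
      by (erule edge_girth) (use z_edge in auto)
    show "(\<lambda>u v. u \<in> S \<and> v \<in> S \<and> 0 < z u v)\<^sup>*\<^sup>* u v" if "u \<in> S" "v \<in> S" for u v
    proof -
      have "(\<lambda>u v. u \<in> S \<and> v \<in> S \<and> 0 < x u v) \<le> (\<lambda>u v. u \<in> S \<and> v \<in> S \<and> 0 < z u v)"
      proof (intro predicate2I conjI)
        fix u v assume uv: "u \<in> S \<and> v \<in> S \<and> 0 < x u v"
        have "x u v \<le> z u v"
          unfolding x_def z_def using uv finite_E by (intro card_mono) (auto simp: ES_def)
        then show "0 < z u v" using uv by simp
      qed auto
      then show ?thesis using x_connected[OF that] rtranclp_mono by blast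
    qed
  qed (use s \<mu> odd_S h g in auto)
  obtain v0 where "v0 \<in> S" using e0_S card_en[OF e0] by fastforce
  then obtain cs where cs: "cyc Z.adj cs" "set cs = S"
      and consec: "\<And>u v. Z.adj u v \<Longrightarrow> \<exists>i<length cs. {u, v} = {cs ! i, cs ! ((i + 1) mod length cs)}"
    using Z.ring_structure by blast
  have "cyc (\<lambda>u v. \<exists>e\<in>E. en e = {u, v}) cs"
    by (rule cyc_mono[OF cs(1)]) (use z_edge in \<open>auto simp: Z.adj_def\<close>)
  moreover have "\<exists>i<length cs. en e = {cs ! i, cs ! ((i + 1) mod length cs)}" if e: "e \<in> E" "en e \<subseteq> S" for e
  proof -
    obtain u v where uv: "en e = {u, v}" using card_en[OF e(1)] by (auto simp: card_2_iff)
    have "0 < z u v" unfolding z_def using e uv finite_E by (auto simp: ES_def card_gt_0_iff)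
    then have "Z.adj u v" using e uv by (auto simp: Z.adj_def)
    then show ?thesis using consec uv by metis
  qed
  ultimately show ?thesis
    using cs(2) not_colorable_ES unfolding ES_def by (intro exI[of _ cs]) simp
qed

end

theorem (in near_ring) ring_exists:
  "\<exists>cs. cyc (\<lambda>u v. \<exists>e\<in>E. en e = {u, v}) cs \<and>
     (\<forall>e\<in>E. en e \<subseteq> set cs \<longrightarrow> (\<exists>i<length cs. en e = {cs ! i, cs ! ((i + 1) mod length cs)})) \<and>
     (\<forall>c. \<not> proper_on {e \<in> E. en e \<subseteq> set cs} en k c)"
proof -
  let ?P = "\<lambda>n. \<exists>\<phi> y f. col \<phi> \<and> tash \<phi> n y f"
  have "?P 1" using tash_initial colorable by blast
  have bound: "\<forall>m. ?P m \<longrightarrow> m \<le> card (\<Union>(en ` E))" using tash_size by (meson less_imp_le)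
  define n where "n = Greatest ?P"
  have "?P n" unfolding n_def by (rule GreatestI_nat[where P = ?P, OF \<open>?P 1\<close>]) (use bound in blast)
  then obtain \<phi> y f where T: "col \<phi>" "tash \<phi> n y f" by blast
  have max: "m \<le> n" if "?P m" for m
    unfolding n_def by (rule Greatest_le_nat[where P = ?P, OF that]) (use bound in blast)
  have "closed_tree \<phi> {} n y f"
    by (rule maximal_closed[OF T]) (use max[of "Suc n"] T(1) in \<open>auto simp: avoids_def\<close>)
  then interpret maximal_tree E en k s e0 \<mu> h g \<phi> n y f
    by unfold_locales (use max in auto)
  show ?thesis by (rule ring_exists)
qed

section \<open>Translation to multigraphs\<close>

lemma cyc_edges:
  assumes "cyc (\<lambda>u v. \<exists>e\<in>F. en e = {u, v}) vs"
  shows "\<exists>es. length es = length vs \<and> distinct es \<and> set es \<subseteq> F \<and>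
    (\<forall>i<length vs. en (es ! i) = {vs ! i, vs ! (Suc i mod length vs)})"
proof -
  let ?L = "length vs"
  have L: "3 \<le> ?L" and dist: "distinct vs" using assms by (auto simp: cyc_def)
  have "\<exists>e\<in>F. en e = {vs ! i, vs ! (Suc i mod ?L)}" if i: "i < ?L" for i
  proof (cases "Suc i < ?L")
    case True
    have "successively (\<lambda>u v. \<exists>e\<in>F. en e = {u, v}) vs" using assms by (simp add: cyc_def)
    then show ?thesis using successively_nth[OF _ True] True by fastforce
  next
    case False
    then have "Suc i = ?L" using i by simp
    moreover have "vs \<noteq> []" using L by auto
    ultimately show ?thesis using assms by (auto simp: cyc_def last_conv_nth hd_conv_nth simp flip: \<open>Suc i = ?L\<close>)
  qed
  then obtain ch where ch: "\<And>i. i < ?L \<Longrightarrow> ch i \<in> F \<and> en (ch i) = {vs ! i, vs ! (Suc i mod ?L)}" by metis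
  have "inj_on ch {..<?L}"
  proof (rule inj_onI, rule ccontr)
    fix i j assume ij: "i \<in> {..<?L}" "j \<in> {..<?L}" "ch i = ch j" "i \<noteq> j"
    then have "{vs ! i, vs ! (Suc i mod ?L)} = {vs ! j, vs ! (Suc j mod ?L)}" using ch by (metis lessThan_iff)
    moreover have "Suc i mod ?L < ?L" "Suc j mod ?L < ?L" using L by (auto intro: mod_less_divisor)
    \<comment> \<open>A common edge at two positions would make each position the successor of the
      other, which needs a list of length 2.\<close>
    ultimately have "i = Suc j mod ?L" "j = Suc i mod ?L"
      using ij dist by (auto simp: doubleton_eq_iff nth_eq_iff_index_eq)
    moreover have "Suc r mod ?L = (if Suc r = ?L then 0 else Suc r)" if "r < ?L" for r using that by simp
    ultimately show False using L ij(1,2) by (auto split: if_splits)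
  qed
  then show ?thesis
    using ch by (intro exI[of _ "map ch [0..<?L]"]) (auto simp: distinct_map atLeast0LessThan)
qed

lemma cyc_girth_bound:
  assumes G: "finite_multigraph G" and "cyc (\<lambda>u v. \<exists>e\<in>edges G. ends G e = {u, v}) vs"
  shows "girth G \<le> enat (length vs)"
proof -
  obtain es where es: "length es = length vs" "distinct es" "set es \<subseteq> edges G"
      "\<And>i. i < length vs \<Longrightarrow> ends G (es ! i) = {vs ! i, vs ! (Suc i mod length vs)}"
    using cyc_edges[OF assms(2)] by blast
  have vs: "3 \<le> length vs" "distinct vs" using assms(2) by (auto simp: cyc_def)
  define C where "C = \<lparr>verts = set vs, edges = set es, ends = ends G\<rparr>"
  have sub: "ends G e \<subseteq> set vs" if e: "e \<in> set es" for e
  proof -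
    obtain i where i: "i < length vs" "e = es ! i" using e es(1) by (metis in_set_conv_nth)
    have "Suc i mod length vs < length vs" using vs by (intro mod_less_divisor) auto
    then show ?thesis using es(4)[OF i(1)] i by simp
  qed
  have "set vs \<subseteq> verts G"
  proof
    fix v assume "v \<in> set vs"
    then obtain i where i: "i < length vs" "v = vs ! i" by (metis in_set_conv_nth)
    then have "es ! i \<in> edges G" "v \<in> ends G (es ! i)" using es(1,3) es(4)[OF i(1)] by auto
    then show "v \<in> verts G" using G by (auto simp: finite_multigraph_def)
  qed
  then have "subgraph C G"
    using G es(3) sub by (auto simp: subgraph_def C_def finite_multigraph_def)
  moreover have "cycle_graph (length vs) C"
    unfolding cycle_graph_def using vs es by (auto simp: C_def)
  ultimately show ?thesis unfolding girth_def by (intro Inf_lower) blast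
qed

lemma proper_edge_coloring_iff: "proper_edge_coloring G k c \<longleftrightarrow> proper_on (edges G) (ends G) k c"
  by (simp add: proper_edge_coloring_def proper_on_def)

lemma proper_on_mono: "proper_on E en k c \<Longrightarrow> F \<subseteq> E \<Longrightarrow> k \<le> l \<Longrightarrow> proper_on F en l c"
  unfolding proper_on_def by (meson less_le_trans subsetD)

lemma ex_proper_edge_coloring:
  assumes "finite (edges G)"
  shows "\<exists>k c. proper_edge_coloring G k c"
proof -
  obtain c :: "_ \<Rightarrow> nat" and k where c: "inj_on c (edges G)" "c ` edges G = {i. i < k}"
    using finite_imp_inj_to_nat_seg[OF assms] by blast
  have "proper_edge_coloring G k c"
    unfolding proper_edge_coloring_def using c by (auto dest: inj_onD)
  then show ?thesis by blast
qed

lemma chromatic_index_eq_Suc: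
  assumes "proper_edge_coloring G (Suc k) c" "\<And>c. \<not> proper_edge_coloring G k c"
  shows "chromatic_index G = Suc k"
  unfolding chromatic_index_def
proof (rule Least_equality)
  show "\<exists>c. proper_edge_coloring G (Suc k) c" using assms(1) by blast
  fix j assume "\<exists>c. proper_edge_coloring G j c"
  then show "Suc k \<le> j"
    using assms(2) proper_on_mono[of "edges G" "ends G" j] unfolding proper_edge_coloring_iff
    by (metis not_less_eq_eq order_refl)
qed

theorem theorem1p2:
  fixes G :: "('v, 'e) multigraph" and g :: nat
  assumes "g \<ge> 5"
    and "finite_multigraph G"
    and "girth G \<ge> enat g"
    and "edge_multiplicity G \<ge> g div 2 + 1"
    and "int (chromatic_index G) =
           int (max_degree G) + \<lceil>real (edge_multiplicity G) / real (g div 2)\<rceil>"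
  shows "\<exists>R. subgraph R G \<and> ring_graph R \<and> chromatic_index R = chromatic_index G"
proof -
  define \<mu> where "\<mu> = edge_multiplicity G"
  define h where "h = g div 2"
  define q where "q = nat \<lceil>real \<mu> / real h\<rceil>"
  have h: "2 \<le> h" "2 * h \<le> g" using assms(1) by (auto simp: h_def)
  have \<mu>h: "h + 1 \<le> \<mu>" using assms(4) by (simp add: \<mu>_def h_def)
  \<comment> \<open>Here the lower bound on the multiplicity enters: it gives
    \<open>2 \<le> q\<close>, hence \<open>1 \<le> s\<close>, which is the surplus of missing
    colours that Tashkinov's theorem needs.\<close>
  have "1 < real \<mu> / real h" using \<mu>h h by (simp add: field_simps)
  then have q: "int q = \<lceil>real \<mu> / real h\<rceil>" "2 \<le> q" unfolding q_def by linarith+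
  have "real \<mu> / real h \<le> real q" using q(1) by (metis le_of_int_ceiling of_int_of_nat_eq)
  then have "real \<mu> \<le> real (h * q)" using h by (simp add: field_simps)
  then have \<mu>q: "\<mu> \<le> h * q" by linarith
  define s where "s = q - 1"
  define k where "k = max_degree G + s"
  have s: "1 \<le> s" "q = s + 1" using q by (auto simp: s_def)
  have \<chi>: "chromatic_index G = Suc k"
    using assms(5) q s unfolding \<mu>_def[symmetric] h_def[symmetric] k_def by linarith
  have finG: "finite (verts G)" "finite (edges G)"
    and edgeG: "\<And>e. e \<in> edges G \<Longrightarrow> ends G e \<subseteq> verts G \<and> card (ends G e) = 2"
    using assms(2) by (auto simp: finite_multigraph_def)
  have notk: "\<not> proper_on (edges G) (ends G) k c" for c
    using not_less_Least[of k "\<lambda>k. \<exists>c. proper_edge_coloring G k c"] \<chi>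
    unfolding chromatic_index_def proper_edge_coloring_iff by auto
  obtain c0 where c0: "proper_on (edges G) (ends G) (Suc k) c0"
    using LeastI_ex[OF ex_proper_edge_coloring[OF finG(2)]] \<chi>
    unfolding chromatic_index_def proper_edge_coloring_iff by auto
  let ?P = "\<lambda>F. F \<subseteq> edges G \<and> (\<forall>c. \<not> proper_on F (ends G) k c)"
  have "?P (edges G)" using notk by simp
  then obtain E where E: "?P E" and least: "\<And>F. ?P F \<Longrightarrow> card E \<le> card F"
    using ex_has_least_nat[of ?P "edges G" card] by blast
  have finE: "finite E" using E finG finite_subset by blast
  have "E \<noteq> {}" using E by (auto simp: proper_on_def)
  then obtain e0 where e0: "e0 \<in> E" by blast
  have "\<exists>\<phi>. proper_on (E - {e0}) (ends G) k \<phi>"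
  proof (rule ccontr)
    assume "\<nexists>\<phi>. proper_on (E - {e0}) (ends G) k \<phi>"
    then have "card E \<le> card (E - {e0})" using E by (intro least) auto
    then show False using e0 finE card_Diff1_less[of E e0] by simp
  qed
  then interpret near_ring E "ends G" k s e0 \<mu> h g
  proof unfold_locales
    show "card {f \<in> E. v \<in> ends G f} + s \<le> k" for v
    proof (cases "v \<in> verts G")
      case True
      have "card {f \<in> E. v \<in> ends G f} \<le> vertex_degree G v"
        unfolding vertex_degree_def using E finG by (intro card_mono) auto
      also have "\<dots> \<le> max_degree G"
        unfolding max_degree_def using True finG by (intro Max_ge) auto
      finally show ?thesis by (simp add: k_def)
    next
      case False
      then have "{f \<in> E. v \<in> ends G f} = {}" using E edgeG by blast
      then have "card {f \<in> E. v \<in> ends G f} = 0" by (simp only: card.empty)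
      then show ?thesis by (simp add: k_def)
    qed
    show "card {f \<in> E. ends G f = {u, v}} \<le> \<mu>" for u v
    proof (cases "u \<in> verts G \<and> v \<in> verts G \<and> u \<noteq> v")
      case True
      let ?M = "{card {e \<in> edges G. ends G e = {u, v}} | u v. u \<in> verts G \<and> v \<in> verts G \<and> u \<noteq> v}"
      have "?M \<subseteq> (\<lambda>(u, v). card {e \<in> edges G. ends G e = {u, v}}) ` (verts G \<times> verts G)" by auto
      then have "finite ?M" using finG finite_subset by blast
      have "card {f \<in> E. ends G f = {u, v}} \<le> card {e \<in> edges G. ends G e = {u, v}}"
        using E finG by (intro card_mono) auto
      also have "\<dots> \<le> \<mu>"
        unfolding \<mu>_def edge_multiplicity_def using True \<open>finite ?M\<close> by (intro Max_ge) auto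
      finally show ?thesis .
    next
      case False
      have "ends G f \<noteq> {u, v}" if "f \<in> E" for f
      proof
        assume uv: "ends G f = {u, v}"
        have "f \<in> edges G" using that E by blast
        then have "{u, v} \<subseteq> verts G" "card {u, v} = 2" using edgeG[of f] uv by auto
        then show False using False by auto
      qed
      then have "{f \<in> E. ends G f = {u, v}} = {}" by blast
      then show ?thesis by (simp only: card.empty)
    qed
    show "g \<le> length vs" if c: "cyc (\<lambda>u v. \<exists>f\<in>E. ends G f = {u, v}) vs" for vs
    proof -
      have "cyc (\<lambda>u v. \<exists>f\<in>edges G. ends G f = {u, v}) vs"
        by (rule cyc_mono[OF c]) (use E in blast)
      then have "enat g \<le> enat (length vs)" using cyc_girth_bound[OF assms(2)] assms(3) by (meson order_trans)
      then show ?thesis by simp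
    qed
  qed (use finE E e0 edgeG s \<mu>q h assms(1) in auto)
  obtain cs where cs: "cyc (\<lambda>u v. \<exists>e\<in>E. ends G e = {u, v}) cs"
      and consec: "\<And>e. e \<in> E \<Longrightarrow> ends G e \<subseteq> set cs \<Longrightarrow>
        \<exists>i<length cs. ends G e = {cs ! i, cs ! ((i + 1) mod length cs)}"
      and not_col: "\<And>c. \<not> proper_on {e \<in> E. ends G e \<subseteq> set cs} (ends G) k c"
    using ring_exists by blast
  define F where "F = {e \<in> E. ends G e \<subseteq> set cs}"
  define R where "R = \<lparr>verts = set cs, edges = F, ends = ends G\<rparr>"
  obtain es where es: "length es = length cs" "distinct es" "set es \<subseteq> E"
      "\<And>i. i < length cs \<Longrightarrow> ends G (es ! i) = {cs ! i, cs ! (Suc i mod length cs)}"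
    using cyc_edges[OF cs] by blast
  have len: "3 \<le> length cs" "distinct cs" using cs by (auto simp: cyc_def)
  have in_cs: "cs ! (i mod length cs) \<in> set cs" for i using len by (intro nth_mem mod_less_divisor) auto
  have esF: "set es \<subseteq> F"
  proof
    fix e assume e: "e \<in> set es"
    then obtain i where i: "i < length cs" "e = es ! i" using es(1) by (metis in_set_conv_nth)
    then have "ends G e \<subseteq> set cs" using es(4)[OF i(1)] in_cs[of "Suc i"] by simp
    then show "e \<in> F" using e es(3) by (auto simp: F_def)
  qed
  have "set cs \<subseteq> verts G"
  proof
    fix v assume "v \<in> set cs"
    then obtain i where i: "i < length cs" "v = cs ! i" by (metis in_set_conv_nth)
    then have "es ! i \<in> E" "v \<in> ends G (es ! i)" using es(1,3) es(4)[OF i(1)] by auto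
    then show "v \<in> verts G" using E edgeG by blast
  qed
  then have sub: "subgraph R G"
    using assms(2) E finE edgeG by (auto simp: subgraph_def R_def F_def finite_multigraph_def)
  have "ring_graph R"
    unfolding ring_graph_def
  proof (intro exI conjI)
    let ?C = "\<lparr>verts = set cs, edges = set es, ends = ends G\<rparr>"
    show "cycle_graph (length cs) ?C" unfolding cycle_graph_def using len es by auto
    show "verts ?C = verts R" by (simp add: R_def)
    show "subgraph ?C R"
      using sub esF by (auto simp: subgraph_def R_def F_def finite_multigraph_def)
    show "\<forall>e\<in>edges R. \<exists>f\<in>edges ?C. ends R e = ends R f"
    proof
      fix e assume "e \<in> edges R"
      then obtain i where "i < length cs" "ends G e = {cs ! i, cs ! ((i + 1) mod length cs)}"
        using consec[of e] by (auto simp: R_def F_def)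
      then show "\<exists>f\<in>edges ?C. ends R e = ends R f"
        using es(1) es(4)[of i] by (intro bexI[of _ "es ! i"]) (auto simp: R_def)
    qed
  qed
  moreover have "chromatic_index R = Suc k"
  proof (rule chromatic_index_eq_Suc)
    have "F \<subseteq> edges G" using E by (auto simp: F_def)
    then show "proper_edge_coloring R (Suc k) c0"
      unfolding proper_edge_coloring_iff using proper_on_mono[OF c0] by (simp add: R_def)
    show "\<not> proper_edge_coloring R k c" for c
      unfolding proper_edge_coloring_iff using not_col by (simp add: R_def F_def)
  qed
  ultimately show ?thesis using sub \<chi> by auto
qed

end
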